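(* Let $s\geq 3$ be an integer. There exist constants $C,\beta,\gamma>0$, depending only on $s$, such that the following holds for every sufficiently large $n$. (a) If $b\geq C n^{1-1/\lceil s/2\rceil}$, then Breaker wins the $(1:b)$ rainbow-connectivity game $\mathcal{C}_{s,n}$. (b) If $b\leq \gamma n^{1-1/\lceil s/2\rceil}$, then Maker wins the $(1:b)$ game $\mathcal{C}_{s,n}$. Moreover, she has a strategy with which she obtains, for every pair of vertices and for every ordering of the $s$ colors, at least $\beta n^{s-1}b^{-s}$ rainbow paths of length $s$ between these two vertices whose edges have the colors in that order. In particular, the threshold bias of $\mathcal{C}_{s,n}$ is of order $n^{1-1/\lceil s/2\rceil}$.
   Context: A $(1:b)$ Maker-Breaker game on a finite board $X$ with a family of winning sets: Maker and Breaker alternately claim unclaimed elements of $X$, Maker $1$ per round and Breaker $b$ per round, until all are claimed; Maker wins if she claims all elements of some winning set, otherwise Breaker wins. The threshold bias is the unique integer $b_0$ such that Breaker wins the $(1:b)$ game iff $b\geq b_0$. For integers $1\leq s\leq n$, the rainbow-connectivity game $\mathcal{C}_{s,n}$ is played on the board $X=\bigcup_{i\in[s]}E(G_i)$, where $G_1,\dots,G_s$ are distinct copies of $K_n$ on the common vertex set $V=[n]$; an edge of $G_i$ is said to have color $i$. A path is rainbow if its edges have pairwise distinct colors. Maker wins iff at the end every two vertices of $V$ are joined by a rainbow path consisting of Maker's edges. *)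

theory Defs
  imports Complex_Main
begin

text \<open>A position is given by Maker's claimed set M, Breaker's claimed set Bk and a flag
  telling whether Maker (True) or Breaker (False) is to move. Maker claims one free element
  per turn, Breaker claims b free elements per turn (or all remaining ones if fewer are left).
  The game ends when the board X is fully claimed.

  maker_forces X b Q t M Bk: from this position Maker has a strategy guaranteeing that her
  final set satisfies Q.
  breaker_forces X b R t M Bk: from this position Breaker has a strategy guaranteeing that
  Maker's final set satisfies R.\<close>

inductive maker_forces ::
  "'a set \<Rightarrow> nat \<Rightarrow> ('a set \<Rightarrow> bool) \<Rightarrow> bool \<Rightarrow> 'a set \<Rightarrow> 'a set \<Rightarrow> bool"
  for X :: "'a set" and b :: nat and Q :: "'a set \<Rightarrow> bool" where
  mf_end: "X - (M \<union> Bk) = {} \<Longrightarrow> Q M \<Longrightarrow> maker_forces X b Q t M Bk"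
| mf_maker: "e \<in> X - (M \<union> Bk) \<Longrightarrow> maker_forces X b Q False (insert e M) Bk
      \<Longrightarrow> maker_forces X b Q True M Bk"
| mf_breaker: "X - (M \<union> Bk) \<noteq> {} \<Longrightarrow>
      (\<forall>S. S \<subseteq> X - (M \<union> Bk) \<and> card S = min b (card (X - (M \<union> Bk)))
            \<longrightarrow> maker_forces X b Q True M (Bk \<union> S))
      \<Longrightarrow> maker_forces X b Q False M Bk"

inductive breaker_forces ::
  "'a set \<Rightarrow> nat \<Rightarrow> ('a set \<Rightarrow> bool) \<Rightarrow> bool \<Rightarrow> 'a set \<Rightarrow> 'a set \<Rightarrow> bool"
  for X :: "'a set" and b :: nat and R :: "'a set \<Rightarrow> bool" where
  bf_end: "X - (M \<union> Bk) = {} \<Longrightarrow> R M \<Longrightarrow> breaker_forces X b R t M Bk"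
| bf_maker: "X - (M \<union> Bk) \<noteq> {} \<Longrightarrow>
      (\<forall>e \<in> X - (M \<union> Bk). breaker_forces X b R False (insert e M) Bk)
      \<Longrightarrow> breaker_forces X b R True M Bk"
| bf_breaker: "S \<subseteq> X - (M \<union> Bk) \<Longrightarrow> card S = min b (card (X - (M \<union> Bk))) \<Longrightarrow>
      X - (M \<union> Bk) \<noteq> {} \<Longrightarrow> breaker_forces X b R True M (Bk \<union> S)
      \<Longrightarrow> breaker_forces X b R False M Bk"

definition maker_wins :: "'a set \<Rightarrow> 'a set set \<Rightarrow> nat \<Rightarrow> bool" where
  "maker_wins X W b = maker_forces X b (\<lambda>M. \<exists>A\<in>W. A \<subseteq> M) True {} {}"

definition breaker_wins :: "'a set \<Rightarrow> 'a set set \<Rightarrow> nat \<Rightarrow> bool" where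
  "breaker_wins X W b = breaker_forces X b (\<lambda>M. \<not> (\<exists>A\<in>W. A \<subseteq> M)) True {} {}"

text \<open>Board: pairs (i, e) with colour i in {1..s} and e an edge {u,v} of K_n on [n] = {1..n}.\<close>

definition rc_board :: "nat \<Rightarrow> nat \<Rightarrow> (nat \<times> nat set) set" where
  "rc_board s n = {(i, {u, v}) | i u v. i \<in> {1..s} \<and> u \<in> {1..n} \<and> v \<in> {1..n} \<and> u \<noteq> v}"

definition rainbow_path :: "(nat \<times> nat set) set \<Rightarrow> nat list \<Rightarrow> nat list \<Rightarrow> bool" where
  "rainbow_path M vs cs \<longleftrightarrow> length vs = Suc (length cs) \<and> distinct vs \<and> distinct cs \<and>
     (\<forall>j < length cs. (cs ! j, {vs ! j, vs ! Suc j}) \<in> M)"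

definition rainbow_connected :: "nat \<Rightarrow> (nat \<times> nat set) set \<Rightarrow> bool" where
  "rainbow_connected n M \<longleftrightarrow> (\<forall>x \<in> {1..n}. \<forall>y \<in> {1..n}. x \<noteq> y \<longrightarrow>
     (\<exists>vs cs. rainbow_path M vs cs \<and> hd vs = x \<and> last vs = y))"

text \<open>Winning sets of C_{s,n}: rainbow-connected edge sets (Maker wins iff her final set
  contains one, i.e. iff her final set is rainbow connected, since the property is monotone).\<close>

definition rc_winning_sets :: "nat \<Rightarrow> nat \<Rightarrow> (nat \<times> nat set) set set" where
  "rc_winning_sets s n = {A. A \<subseteq> rc_board s n \<and> rainbow_connected n A}"

definition num_ordered_paths :: "(nat \<times> nat set) set \<Rightarrow> nat \<Rightarrow> nat \<Rightarrow> nat list \<Rightarrow> nat" where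
  "num_ordered_paths M x y cs = card {vs. rainbow_path M vs cs \<and> hd vs = x \<and> last vs = y}"

end

theory Submission
  imports Defs
begin

text \<open>Let \<open>m = \<lceil>s/2\<rceil>\<close>, and let \<open>D = n/b\<close> be the order of Maker's degrees in each colour.

  Breaker picks two vertices x and y away from Maker's first edge. He keeps every edge between two vertices
  already touched by Maker decided, so that Maker only ever attaches fresh vertices and x, y stay in different
  components. With the other half of his bias he exhausts the edges at the balls about x and y, radius by
  radius. After about \<open>D ^ (m - 1)\<close> rounds the balls of radius \<open>m - 1\<close> are final and have
  \<open>O(b)\<close> vertices, so from then on he can answer each Maker edge by claiming everything between its
  endpoints and these balls. Hence the balls of radius m never meet, and every path from x to y is longer than
  \<open>2m \<ge> s\<close>.

  Maker derandomises the random graph in which a free edge is present with probability of order \<open>1/b\<close>.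
  She keeps a sum of exponentials \<open>exp (- \<lambda> F)\<close> small, F being the conditional expectation of the number
  of paths between given ends with given colours, together with potentials that prevent large degrees and many
  disjoint walks between two vertices. To first order the element of largest gain compensates Breaker's next b
  elements. The second order term, the paths lost when Breaker answers an edge of a path by another one, is
  charged to whichever of the two lies at distance at most m from an end; the degree and walk bounds make the
  total charge a small multiple of the expectation exactly when \<open>b \<le> \<gamma> n powr (1 - 1/m)\<close>.\<close>

section \<open>Strategies from invariants\<close>

text \<open>Both halves compare \<open>D ^ m\<close> with n. Breaker's budget must cover a set of
  about \<open>D ^ (m - 1)\<close> vertices in every round, and this is O(b) when
  \<open>D ^ m\<close> is O(n). For Maker the opposite inequality
  \<open>n \<le> \<gamma> * D ^ m\<close> makes two walks of total length about m plentiful enough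
  to control what two answers can spoil. The obstacle is that exp is convex, so balancing Maker's
  gain against Breaker's loss to first order is not enough. Hence
  \<open>p = 1 / (2 * b + 1)\<close>: one Maker element gains 2b times what one Breaker element
  destroys, and the spare factor 2 absorbs the curvature. Every term of the potential then changes
  by at most \<open>- b * j e0 + (\<Sum>e\<in>S. j e)\<close> for some function j, and one element
  maximising the sum of all the j serves all terms at once. The number \<nu>, with
  \<open>\<nu> ^ (2 * m) = n\<close>, is a safety margin over the expected number
  \<open>D ^ k / n\<close> of walks. It is large enough that constantly many factors
  \<open>1 / \<nu>\<close> beat any union bound polynomial in n, and small enough that its square is
  at most \<open>\<gamma> * D\<close>, so it does no harm in a product of two walk counts.\<close>

lemma breaker_forces_invariant:
  fixes Inv :: "'a set \<Rightarrow> 'a set \<Rightarrow> bool"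
  assumes fin: "finite X"
    and step: "\<And>M Bk e. Inv M Bk \<Longrightarrow> e \<in> X - (M \<union> Bk) \<Longrightarrow>
      \<exists>S0 \<subseteq> X - (insert e M \<union> Bk). card S0 \<le> b \<and>
        (\<forall>S. S0 \<subseteq> S \<longrightarrow> S \<subseteq> X - (insert e M \<union> Bk) \<longrightarrow> Inv (insert e M) (Bk \<union> S))"
    and final: "\<And>M Bk. Inv M Bk \<Longrightarrow> X - (M \<union> Bk) = {} \<Longrightarrow> R M"
  shows "Inv M Bk \<Longrightarrow> breaker_forces X b R True M Bk"
proof (induction "card (X - (M \<union> Bk))" arbitrary: M Bk rule: less_induct)
  case less
  show ?case
  proof (cases "X - (M \<union> Bk) = {}")
    case True
    then show ?thesis using final[OF less.prems] by (auto intro: bf_end)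
  next
    case False
    have "breaker_forces X b R False (insert e M) Bk" if e: "e \<in> X - (M \<union> Bk)" for e
    proof -
      let ?F = "X - (insert e M \<union> Bk)"
      obtain S0 where S0: "S0 \<subseteq> ?F" "card S0 \<le> b"
        and inv: "\<And>S. S0 \<subseteq> S \<Longrightarrow> S \<subseteq> ?F \<Longrightarrow> Inv (insert e M) (Bk \<union> S)"
        using step[OF less.prems e] by blast
      have finF: "finite ?F" using fin by auto
      show ?thesis
      proof (cases "?F = {}")
        case True
        then show ?thesis using final[OF inv[of "{}"]] S0 by (auto intro: bf_end)
      next
        case False
        \<comment> \<open>The rules fix the size of Breaker's answer, so the elements he needs are
          padded; this is why \<open>step\<close> has to tolerate every superset of
          \<open>S0\<close>.\<close>
        obtain S where S: "S0 \<subseteq> S" "S \<subseteq> ?F" "card S = min b (card ?F)"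
          using exists_subset_between[of S0 "min b (card ?F)" ?F] S0 finF
          by (metis card_mono min.boundedI min.cobounded2)
        have "X - (insert e M \<union> (Bk \<union> S)) \<subset> X - (M \<union> Bk)" using e by auto
        then have "card (X - (insert e M \<union> (Bk \<union> S))) < card (X - (M \<union> Bk))"
          using fin by (auto intro: psubset_card_mono)
        from less.hyps[OF this inv[OF S(1,2)]] show ?thesis
          using bf_breaker[OF S(2,3) False] by simp
      qed
    qed
    then show ?thesis using False by (intro bf_maker) simp_all
  qed
qed

text \<open>The invariant is only asked for when Maker is to move, because her potential is
  controlled over a full round and not after her own element alone.\<close>

lemma maker_forces_invariant:
  fixes Inv :: "'a set \<Rightarrow> 'a set \<Rightarrow> bool"
  assumes fin: "finite X"
    and step: "\<And>M Bk. Inv M Bk \<Longrightarrow> X - (M \<union> Bk) \<noteq> {} \<Longrightarrow>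
      \<exists>e \<in> X - (M \<union> Bk). \<forall>S \<subseteq> X - (insert e M \<union> Bk).
        card S = min b (card (X - (insert e M \<union> Bk))) \<longrightarrow> Inv (insert e M) (Bk \<union> S)"
    and final: "\<And>M Bk. Inv M Bk \<Longrightarrow> X - (M \<union> Bk) = {} \<Longrightarrow> Q M"
  shows "Inv M Bk \<Longrightarrow> maker_forces X b Q True M Bk"
proof (induction "card (X - (M \<union> Bk))" arbitrary: M Bk rule: less_induct)
  case less
  show ?case
  proof (cases "X - (M \<union> Bk) = {}")
    case True
    then show ?thesis using final[OF less.prems] by (auto intro: mf_end)
  next
    case False
    let ?F = "\<lambda>e. X - (insert e M \<union> Bk)"
    obtain e where e: "e \<in> X - (M \<union> Bk)"
      and inv: "\<And>S. S \<subseteq> ?F e \<Longrightarrow> card S = min b (card (?F e)) \<Longrightarrow> Inv (insert e M) (Bk \<union> S)"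
      using step[OF less.prems False] by blast
    have "maker_forces X b Q False (insert e M) Bk"
    proof (cases "?F e = {}")
      case True
      have "card (?F e) = 0" unfolding True by simp
      then have "Inv (insert e M) (Bk \<union> {})" by (intro inv) simp_all
      with True have "Q (insert e M)" using final[of "insert e M" Bk] by simp
      with True show ?thesis by (intro mf_end)
    next
      case ne: False
      have "maker_forces X b Q True (insert e M) (Bk \<union> S)"
        if "S \<subseteq> ?F e \<and> card S = min b (card (?F e))" for S
      proof -
        have "X - (insert e M \<union> (Bk \<union> S)) \<subset> X - (M \<union> Bk)" using e by auto
        then have "card (X - (insert e M \<union> (Bk \<union> S))) < card (X - (M \<union> Bk))"
          using fin by (auto intro: psubset_card_mono)
        from less.hyps[OF this inv] that show ?thesis by blast
      qed
      then show ?thesis using ne by (intro mf_breaker) simp_all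
    qed
    with e show ?thesis by (rule mf_maker)
  qed
qed

lemma maker_forces_mono:
  "maker_forces X b Q t M Bk \<Longrightarrow> (\<And>M. Q M \<Longrightarrow> Q' M) \<Longrightarrow> maker_forces X b Q' t M Bk"
proof (induction rule: maker_forces.induct)
  case (mf_end M Bk t)
  then show ?case by (auto intro: maker_forces.mf_end)
next
  case (mf_maker e M Bk)
  then show ?case by (auto intro: maker_forces.mf_maker)
next
  case (mf_breaker M Bk)
  show ?case
    by (rule maker_forces.mf_breaker) (use mf_breaker in auto)
qed

section \<open>Breaker separates two vertices\<close>

lemma rc_boardE:
  assumes "e \<in> rc_board s n"
  obtains i u v where "e = (i, {u, v})" "i \<in> {1..s}" "u \<in> {1..n}" "v \<in> {1..n}" "u \<noteq> v"
  using assms unfolding rc_board_def by blast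

lemma card_rc_board_touching:
  assumes "finite U" "finite T"
  shows "card {e \<in> rc_board s n. snd e \<inter> U \<noteq> {} \<and> snd e \<subseteq> T} \<le> s * card U * card T"
proof -
  let ?f = "\<lambda>(i::nat, u::nat, v). (i, {u, v})"
  have "{e \<in> rc_board s n. snd e \<inter> U \<noteq> {} \<and> snd e \<subseteq> T} \<subseteq> ?f ` ({1..s} \<times> U \<times> T)"
  proof
    fix e assume "e \<in> {e \<in> rc_board s n. snd e \<inter> U \<noteq> {} \<and> snd e \<subseteq> T}"
    then have e: "e \<in> rc_board s n" "snd e \<inter> U \<noteq> {}" "snd e \<subseteq> T" by auto
    obtain i u v where i: "e = (i, {u, v})" "i \<in> {1..s}" using e(1) by (rule rc_boardE)
    with e consider "u \<in> U" "v \<in> T" | "v \<in> U" "u \<in> T" by auto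
    then show "e \<in> ?f ` ({1..s} \<times> U \<times> T)"
    proof cases
      case 1
      then show ?thesis using i by (intro image_eqI[of _ _ "(i, u, v)"]) auto
    next
      case 2
      then show ?thesis using i by (intro image_eqI[of _ _ "(i, v, u)"]) auto
    qed
  qed
  then have "card {e \<in> rc_board s n. snd e \<inter> U \<noteq> {} \<and> snd e \<subseteq> T} \<le> card (?f ` ({1..s} \<times> U \<times> T))"
    using assms by (intro card_mono) auto
  also have "\<dots> \<le> card ({1..s} \<times> U \<times> T)" using assms by (intro card_image_le) auto
  finally show ?thesis by (simp add: card_cartesian_product mult.assoc)
qed

lemma finite_rc_board [simp]: "finite (rc_board s n)"
proof (rule finite_subset)
  show "rc_board s n \<subseteq> {1..s} \<times> Pow {1..n}" unfolding rc_board_def by auto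
qed auto

lemma snd_rc_board: "e \<in> rc_board s n \<Longrightarrow> snd e \<subseteq> {1..n}"
  by (auto elim: rc_boardE)

lemma card_snd_rc_board: "e \<in> rc_board s n \<Longrightarrow> card (snd e) = 2"
  by (auto elim: rc_boardE)

lemma rc_board_other_endpoint: "e \<in> rc_board s n \<Longrightarrow> u \<in> snd e \<Longrightarrow> \<exists>v. snd e = {u, v}"
  by (auto elim!: rc_boardE)

section \<open>Balls in Maker's graph, with colours forgotten\<close>

primrec ball :: "(nat \<times> nat set) set \<Rightarrow> nat set \<Rightarrow> nat \<Rightarrow> nat set" where
  "ball M Z 0 = Z"
| "ball M Z (Suc j) = ball M Z j \<union> \<Union> (snd ` {e \<in> M. snd e \<inter> ball M Z j \<noteq> {}})"

lemma ball_mono_radius: "i \<le> j \<Longrightarrow> ball M Z i \<subseteq> ball M Z j"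
  by (rule lift_Suc_mono_le[of "ball M Z"]) auto

lemma ball_Un: "ball M (Z \<union> Z') j = ball M Z j \<union> ball M Z' j"
  by (induction j) auto

lemma ball_mono_set:
  assumes "Z \<subseteq> Z'"
  shows "ball M Z j \<subseteq> ball M Z' j"
proof -
  have "Z \<union> Z' = Z'" using assms by blast
  with ball_Un[of M Z Z' j] have "ball M Z' j = ball M Z j \<union> ball M Z' j" by argo
  then show ?thesis by blast
qed

lemma ball_subset: "ball M Z j \<subseteq> Z \<union> \<Union> (snd ` M)"
  by (induction j) auto

text \<open>C is a union of components of Maker's graph. Applied to C and to its complement, this
  makes balls of every radius about separated vertices disjoint.\<close>

lemma ball_subset_union_of_components:
  assumes "Z \<subseteq> C" "\<And>e. e \<in> M \<Longrightarrow> snd e \<subseteq> C \<or> snd e \<inter> C = {}"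
  shows "ball M Z j \<subseteq> C"
proof (induction j)
  case (Suc j)
  have "snd e \<subseteq> C" if "e \<in> M" "snd e \<inter> ball M Z j \<noteq> {}" for e
    using assms(2)[OF that(1)] that(2) Suc.IH by blast
  with Suc show ?case by auto
qed (use assms in simp)

text \<open>Only an edge meeting a smaller ball can enlarge the ball of radius j. So once no free
  edge meets the smaller balls, radius j is final for the rest of the game.\<close>

lemma ball_insert:
  assumes "\<And>i. i < j \<Longrightarrow> snd e \<inter> ball M Z i = {}"
  shows "ball (insert e M) Z j = ball M Z j"
  using assms
proof (induction j)
  case (Suc j)
  have "snd e \<inter> ball M Z j = {}" using Suc.prems by simp
  moreover have "ball (insert e M) Z j = ball M Z j" using Suc by simp
  ultimately show ?case by auto
qed simp

lemma rainbow_path_in_ball: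
  assumes "rainbow_path M vs cs" "i \<le> length cs" "j \<le> length cs - i"
  shows "vs ! (i + j) \<in> ball M {vs ! i} j" "vs ! i \<in> ball M {vs ! (i + j)} j"
proof -
  have edge: "(cs ! k, {vs ! k, vs ! Suc k}) \<in> M" if "k < length cs" for k
    using assms(1) that unfolding rainbow_path_def by blast
  show "vs ! (i + j) \<in> ball M {vs ! i} j" using assms(2,3)
  proof (induction j)
    case (Suc j)
    then have "vs ! (i + j) \<in> ball M {vs ! i} j" "(cs ! (i + j), {vs ! (i + j), vs ! Suc (i + j)}) \<in> M"
      using edge[of "i + j"] by auto
    then show ?case by (auto intro!: bexI)
  qed simp
  have "vs ! (l - j) \<in> ball M {vs ! l} j" if "j \<le> l" "l \<le> length cs" for l j
    using that
  proof (induction j)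
    case (Suc j)
    then have "vs ! (l - j) \<in> ball M {vs ! l} j" "(cs ! (l - Suc j), {vs ! (l - Suc j), vs ! (l - j)}) \<in> M"
      using edge[of "l - Suc j"] by (auto simp: Suc_diff_Suc)
    then show ?case by (auto intro!: bexI)
  qed simp
  from this[of j "i + j"] show "vs ! i \<in> ball M {vs ! (i + j)} j" using assms(2,3) by simp
qed


declare ball.simps(2) [simp del]

text \<open>As v is untouched, e only hangs a new leaf on the side of x. The balls about y of radius
  below m miss e, and the ball of radius m about x gains at most u and v, neither of which is near
  y.\<close>

lemma ball_insert_one_endpoint:
  assumes e: "snd e = {u, v}" and "u \<in> ball M {x} (m - 1)" "v \<notin> {x, y} \<union> \<Union> (snd ` M)"
    and disj: "ball M {x} m \<inter> ball M {y} m = {}" and m: "m > 0"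
    and inner: "\<And>j. j < m - 1 \<Longrightarrow> snd e \<inter> ball M {x, y} j = {}"
  shows "ball (insert e M) {x} m \<inter> ball (insert e M) {y} m = {}"
proof -
  obtain k where k: "m = Suc k" using m by (cases m) auto
  have inner': "snd e \<inter> ball M {z} j = {}" if "j < k" "z \<in> {x, y}" for j z
    using inner[of j] that ball_mono_set[of "{z}" "{x, y}" M j] k by auto
  have ux: "u \<in> ball M {x} k" using assms(2) k by simp
  then have uy: "u \<notin> ball M {y} m"
    using disj ball_mono_radius[of k m M "{x}"] k by auto
  have vy: "v \<notin> ball M {y} m" using ball_subset[of M "{y}" m] assms(3) by auto
  have "snd e \<inter> ball M {y} j = {}" if "j < m" for j
    using uy vy ball_mono_radius[of j m M "{y}"] that e by auto
  then have y: "ball (insert e M) {y} m = ball M {y} m" by (rule ball_insert)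
  have "ball (insert e M) {x} k = ball M {x} k" using inner' by (intro ball_insert) auto
  then have "ball (insert e M) {x} m \<subseteq> ball M {x} m \<union> {u, v}" using k e by (auto simp: ball.simps(2))
  with y uy vy disj show ?thesis by auto
qed

section \<open>Breaker's exploration in phases\<close>

primrec phase_end :: "nat \<Rightarrow> nat \<Rightarrow> nat" where
  "phase_end r 0 = 2 + 2 * r"
| "phase_end r (Suc i) = phase_end r i + 1 + r * (2 + 2 * phase_end r i)"

lemma phase_end_mono: "i \<le> j \<Longrightarrow> phase_end r i \<le> phase_end r j"
  by (rule lift_Suc_mono_le[of "phase_end r"]) auto

text \<open>In \<open>phase_end\<close>, a position with t Maker edges has at most
  \<open>2 + 2 * t\<close> touched vertices, each on at most \<open>s * n \<le> h * r\<close> edges,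
  which Breaker exhausts in r rounds at h per round. So a phase multiplies the elapsed time by at
  most \<open>5 * r\<close>, and the last one, \<open>i = m - 2\<close>, ends after about
  \<open>r ^ (m - 1)\<close> rounds.\<close>

lemma phase_end_le: "r \<ge> 1 \<Longrightarrow> phase_end r i + 1 \<le> (5 * r) ^ Suc i"
proof (induction i)
  case (Suc i)
  have "phase_end r (Suc i) + 1 \<le> (phase_end r i + 1) * (5 * r)"
  proof -
    have "(phase_end r i * 3 + 2) * 1 \<le> (phase_end r i * 3 + 2) * r"
      using Suc.prems by (intro mult_left_mono) auto
    then show ?thesis using Suc.prems by (simp add: algebra_simps)
  qed
  also have "\<dots> \<le> (5 * r) ^ Suc i * (5 * r)" using Suc by (intro mult_right_mono) auto
  finally show ?case by (simp add: ac_simps)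
qed simp

definition touched :: "nat set \<Rightarrow> (nat \<times> nat set) set \<Rightarrow> nat set" where
  "touched Z M = Z \<union> \<Union> (snd ` M)"

lemma card_touched:
  assumes "finite Z" "finite M" "M \<subseteq> rc_board s n"
  shows "finite (touched Z M)" "card (touched Z M) \<le> card Z + 2 * card M"
proof -
  have fin: "finite (snd e)" "card (snd e) \<le> 2" if "e \<in> M" for e
    using subsetD[OF assms(3) that] by (auto elim: rc_boardE)
  show "finite (touched Z M)" using assms fin by (auto simp: touched_def)
  have "card (touched Z M) \<le> card Z + card (\<Union> (snd ` M))"
    unfolding touched_def by (rule card_Un_le)
  also have "card (\<Union> (snd ` M)) \<le> (\<Sum>e\<in>M. card (snd e))"
    by (rule card_UN_le[OF assms(2)])
  also have "\<dots> \<le> (\<Sum>e\<in>M. 2)" by (rule sum_mono) (use fin in auto)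
  finally show "card (touched Z M) \<le> card Z + 2 * card M" by simp
qed

lemma ball_subset_touched: "ball M Z j \<subseteq> touched Z M"
  unfolding touched_def by (rule ball_subset)

definition decided_within :: "nat \<Rightarrow> nat \<Rightarrow> nat set \<Rightarrow> (nat \<times> nat set) set \<Rightarrow> (nat \<times> nat set) set \<Rightarrow> bool" where
  "decided_within s n T M Bk \<longleftrightarrow> {e \<in> rc_board s n. snd e \<subseteq> T} \<subseteq> M \<union> Bk"

text \<open>The balls about x and y are completed radius by radius: \<open>exploring i\<close> says that no free edge
  meets the ball of radius \<open>i - 1\<close>, so that the ball of radius \<open>i\<close> is already final. The last
  conjunct is the budget: every round Breaker claims h free edges at that ball.\<close>

definition exploring :: "nat \<Rightarrow> nat \<Rightarrow> nat \<Rightarrow> nat \<Rightarrow> nat \<Rightarrow> nat \<Rightarrow> nat \<Rightarrow>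
    (nat \<times> nat set) set \<Rightarrow> (nat \<times> nat set) set \<Rightarrow> bool" where
  "exploring s n h r x y i M Bk \<longleftrightarrow> M \<subseteq> rc_board s n \<and>
     decided_within s n (touched {x, y} M) M Bk \<and>
     (\<exists>C. x \<in> C \<and> y \<notin> C \<and> C \<subseteq> touched {x, y} M \<and> (\<forall>e\<in>M. snd e \<subseteq> C \<or> snd e \<inter> C = {})) \<and>
     (\<forall>e\<in>rc_board s n - (M \<union> Bk). \<forall>j<i. snd e \<inter> ball M {x, y} j = {}) \<and>
     h * (card M + 1) + card {e \<in> rc_board s n - (M \<union> Bk). snd e \<inter> ball M {x, y} i \<noteq> {}}
       \<le> h * phase_end r i"

text \<open>The final regime. Keeping all pairs of touched vertices decided would cost more in every
  round, so now only pairs with an end in the ball of radius \<open>m - 1\<close> are kept decided.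
  That ball has stopped growing, and its size l bounds the cost of a round for good.\<close>

definition separated :: "nat \<Rightarrow> nat \<Rightarrow> nat \<Rightarrow> nat \<Rightarrow> nat \<Rightarrow> nat \<Rightarrow>
    (nat \<times> nat set) set \<Rightarrow> (nat \<times> nat set) set \<Rightarrow> bool" where
  "separated s n l m x y M Bk \<longleftrightarrow> M \<subseteq> rc_board s n \<and>
     card (ball M {x, y} (m - 1)) \<le> l \<and>
     {e \<in> rc_board s n. snd e \<subseteq> touched {x, y} M \<and> snd e \<inter> ball M {x, y} (m - 1) \<noteq> {}} \<subseteq> M \<union> Bk \<and>
     (\<forall>e\<in>rc_board s n - (M \<union> Bk). \<forall>j<m - 1. snd e \<inter> ball M {x, y} j = {}) \<and>
     ball M {x} m \<inter> ball M {y} m = {}"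

lemma separated_step:
  assumes sep: "separated s n l m x y M Bk" and e: "e \<in> rc_board s n - (M \<union> Bk)" and m: "m > 0"
    and b: "2 * s * (l + 2) \<le> b"
  shows "\<exists>S0 \<subseteq> rc_board s n - (insert e M \<union> Bk). card S0 \<le> b \<and>
        (\<forall>S. S0 \<subseteq> S \<longrightarrow> S \<subseteq> rc_board s n - (insert e M \<union> Bk) \<longrightarrow>
          separated s n l m x y (insert e M) (Bk \<union> S))"
proof -
  let ?X = "rc_board s n" and ?L = "ball M {x, y} (m - 1)"
  let ?T = "touched {x, y} M" and ?T' = "touched {x, y} (insert e M)"
  define S0 where "S0 = {f \<in> ?X. snd f \<inter> snd e \<noteq> {} \<and> snd f \<subseteq> ?L \<union> snd e} - (insert e M \<union> Bk)"
  have M: "M \<subseteq> ?X" and L: "card ?L \<le> l"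
    and dec: "{e \<in> ?X. snd e \<subseteq> ?T \<and> snd e \<inter> ?L \<noteq> {}} \<subseteq> M \<union> Bk"
    and inner: "\<And>f j. f \<in> ?X - (M \<union> Bk) \<Longrightarrow> j < m - 1 \<Longrightarrow> snd f \<inter> ball M {x, y} j = {}"
    and disj: "ball M {x} m \<inter> ball M {y} m = {}"
    using sep unfolding separated_def by blast+
  have finM: "finite M" using M by (rule finite_subset) simp
  have finL: "finite ?L"
    by (rule finite_subset[OF ball_subset_touched card_touched(1)[OF _ finM M]]) simp
  have fine: "finite (snd e)" "card (snd e) = 2"
    using e card_snd_rc_board[of e s n] by (auto elim: rc_boardE)
  have "card S0 \<le> card {f \<in> ?X. snd f \<inter> snd e \<noteq> {} \<and> snd f \<subseteq> ?L \<union> snd e}"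
    unfolding S0_def by (intro card_mono) auto
  also have "\<dots> \<le> s * card (snd e) * card (?L \<union> snd e)"
    using fine finL by (intro card_rc_board_touching) auto
  also have "\<dots> \<le> s * 2 * (l + 2)"
    using card_Un_le[of ?L "snd e"] L fine by (intro mult_mono) auto
  also have "\<dots> \<le> b" using b by (simp add: algebra_simps)
  finally have S0b: "card S0 \<le> b" .
  have S0: "S0 \<subseteq> ?X - (insert e M \<union> Bk)" unfolding S0_def by auto
  have ball_eq: "ball (insert e M) {x, y} j = ball M {x, y} j" if "j \<le> m - 1" for j
    using inner[OF e] that by (intro ball_insert) auto
  have disj': "ball (insert e M) {x} m \<inter> ball (insert e M) {y} m = {}"
  proof (cases "snd e \<inter> ?L = {}")
    case True
    have "snd e \<inter> ball M {z} j = {}" if "j < m" "z \<in> {x, y}" for j z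
    proof -
      have "j \<le> m - 1" "{z} \<subseteq> {x, y}" using that by auto
      then have "ball M {z} j \<subseteq> ?L" by (meson ball_mono_radius ball_mono_set order_trans)
      then show ?thesis using True by blast
    qed
    then have "ball (insert e M) {z} m = ball M {z} m" if "z \<in> {x, y}" for z
      using \<open>\<And>z j. j < m \<Longrightarrow> z \<in> {x, y} \<Longrightarrow> snd e \<inter> ball M {z} j = {}\<close> that by (intro ball_insert) metis
    from this[of x] this[of y] show ?thesis using disj by simp
  next
    case False
    then obtain u where u: "u \<in> snd e" "u \<in> ?L" by auto
    obtain v where v: "snd e = {u, v}"
      using rc_board_other_endpoint[OF _ u(1)] e by blast
    have vT: "v \<notin> {x, y} \<union> \<Union> (snd ` M)"
    proof
      assume "v \<in> {x, y} \<union> \<Union> (snd ` M)"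
      then have "snd e \<subseteq> ?T" using u v ball_subset_touched[of M "{x, y}" "m - 1"] by (auto simp: touched_def)
      with dec e u show False by blast
    qed
    have "?L = ball M {x} (m - 1) \<union> ball M {y} (m - 1)"
      using ball_Un[of M "{x}" "{y}" "m - 1"] by (simp add: insert_commute)
    with u consider "u \<in> ball M {x} (m - 1)" | "u \<in> ball M {y} (m - 1)" by blast
    then show ?thesis
    proof cases
      case 1
      show ?thesis by (rule ball_insert_one_endpoint[OF v 1 vT disj m inner[OF e]])
    next
      case 2
      have "ball (insert e M) {y} m \<inter> ball (insert e M) {x} m = {}"
      proof (rule ball_insert_one_endpoint[OF v 2 _ _ m])
        show "v \<notin> {y, x} \<union> \<Union> (snd ` M)" using vT by blast
        show "ball M {y} m \<inter> ball M {x} m = {}" using disj by blast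
        show "snd e \<inter> ball M {y, x} j = {}" if "j < m - 1" for j
          using inner[OF e that] by (simp only: insert_commute)
      qed
      then show ?thesis by blast
    qed
  qed
  have "separated s n l m x y (insert e M) (Bk \<union> S)"
    if S: "S0 \<subseteq> S" "S \<subseteq> ?X - (insert e M \<union> Bk)" for S
    unfolding separated_def
  proof (intro conjI ballI allI impI)
    show "insert e M \<subseteq> ?X" using M e by auto
    show "card (ball (insert e M) {x, y} (m - 1)) \<le> l" using ball_eq L by simp
    show "ball (insert e M) {x} m \<inter> ball (insert e M) {y} m = {}" by (rule disj')
    show "snd f \<inter> ball (insert e M) {x, y} j = {}"
      if "f \<in> ?X - (insert e M \<union> (Bk \<union> S))" "j < m - 1" for f j
      using that ball_eq inner[of f j] by auto
    show "{f \<in> ?X. snd f \<subseteq> ?T' \<and> snd f \<inter> ball (insert e M) {x, y} (m - 1) \<noteq> {}}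
            \<subseteq> insert e M \<union> (Bk \<union> S)"
    proof
      fix f assume "f \<in> {f \<in> ?X. snd f \<subseteq> ?T' \<and> snd f \<inter> ball (insert e M) {x, y} (m - 1) \<noteq> {}}"
      then have f: "f \<in> ?X" "snd f \<subseteq> ?T'" "snd f \<inter> ?L \<noteq> {}" using ball_eq by auto
      show "f \<in> insert e M \<union> (Bk \<union> S)"
      proof (cases "snd f \<subseteq> ?T")
        case True
        then show ?thesis using dec f by blast
      next
        case False
        have "?T' = ?T \<union> snd e" by (auto simp: touched_def)
        with False f obtain w where w: "w \<in> snd f" "w \<in> snd e" "w \<notin> ?T" by blast
        obtain w' where "snd f = {w, w'}"
          using rc_board_other_endpoint[OF f(1) w(1)] by blast
        with f w ball_subset_touched[of M "{x, y}" "m - 1"] have "snd f \<subseteq> ?L \<union> snd e" by auto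
        with f(1) w S(1) show ?thesis unfolding S0_def by blast
      qed
    qed
  qed
  then show ?thesis by (intro exI[of _ S0] conjI S0 S0b allI impI)
qed

text \<open>Breaker's answer is \<open>N \<union> G\<close>: N decides the pairs newly spanned by
  the ends of e and the touched vertices, and G takes up to h free edges at the ball of radius i.
  The budget conjunct bounds \<open>card M\<close> by \<open>phase_end r i\<close>, hence the number
  of touched vertices and the size of N.\<close>

lemma exploring_step:
  assumes expl: "exploring s n h r x y i M Bk" and e: "e \<in> rc_board s n - (M \<union> Bk)"
    and i: "i < m - 1" and h: "h > 0" "s * n \<le> h * r" and xy: "x \<noteq> y"
    and b: "h + 4 * s * (phase_end r i + 1) \<le> b"
    and l: "2 * phase_end r i + 2 \<le> l"
  shows "\<exists>S0 \<subseteq> rc_board s n - (insert e M \<union> Bk). card S0 \<le> b \<and>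
        (\<forall>S. S0 \<subseteq> S \<longrightarrow> S \<subseteq> rc_board s n - (insert e M \<union> Bk) \<longrightarrow>
          (\<exists>j<m - 1. exploring s n h r x y j (insert e M) (Bk \<union> S)) \<or>
          separated s n l m x y (insert e M) (Bk \<union> S))"
proof -
  let ?X = "rc_board s n" and ?Z = "{x, y}" and ?M = "insert e M" and ?t = "phase_end r i"
  let ?T = "touched ?Z M" and ?T' = "touched ?Z ?M"
  note E = expl[unfolded exploring_def decided_within_def]
  have M: "M \<subseteq> ?X" by (rule E[THEN conjunct1])
  have dec: "{e \<in> ?X. snd e \<subseteq> ?T} \<subseteq> M \<union> Bk" by (rule E[THEN conjunct2, THEN conjunct1])
  note E' = E[THEN conjunct2, THEN conjunct2]
  have closed: "\<And>f j. f \<in> ?X - (M \<union> Bk) \<Longrightarrow> j < i \<Longrightarrow> snd f \<inter> ball M ?Z j = {}"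
    using E'[THEN conjunct2, THEN conjunct1] by blast
  have budget: "h * (card M + 1) + card {e \<in> ?X - (M \<union> Bk). snd e \<inter> ball M ?Z i \<noteq> {}} \<le> h * ?t"
    by (rule E'[THEN conjunct2, THEN conjunct2])
  obtain C where C: "x \<in> C" "y \<notin> C" "C \<subseteq> ?T" "\<And>e. e \<in> M \<Longrightarrow> snd e \<subseteq> C \<or> snd e \<inter> C = {}"
    using E'[THEN conjunct1] by blast
  have finM: "finite M" using M by (rule finite_subset) simp
  have M': "?M \<subseteq> ?X" "finite ?M" using M e finM by auto
  have "h * (card M + 1) \<le> h * ?t" using budget by linarith
  then have "card M + 1 \<le> ?t" using h(1) by (simp only: mult_le_cancel1)
  moreover have cardM': "card ?M = card M + 1" using e finM by (subst card_insert_disjoint) auto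
  ultimately have tM: "card ?M \<le> ?t" by simp
  have finT': "finite ?T'" using card_touched(1)[OF _ M'(2,1)] by simp
  have T': "card ?T' \<le> 2 + 2 * ?t"
    using card_touched(2)[OF _ M'(2,1), of ?Z] tM xy by simp
  have T'_eq: "?T' = ?T \<union> snd e" by (auto simp: touched_def)
  have fine: "finite (snd e)" "card (snd e) = 2"
    using e card_snd_rc_board[of e s n] by (auto elim: rc_boardE)
  have ball_eq: "ball ?M ?Z j = ball M ?Z j" if "j \<le> i" for j
    using closed[OF e] that by (intro ball_insert) auto
  define N where "N = {f \<in> ?X. snd f \<inter> snd e \<noteq> {} \<and> snd f \<subseteq> ?T'} - (?M \<union> Bk)"
  define F where "F = {f \<in> ?X - (?M \<union> Bk). snd f \<inter> ball M ?Z i \<noteq> {}}"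
  have finF: "finite F" unfolding F_def by (rule finite_subset[of _ ?X]) auto
  obtain G where G: "G \<subseteq> F" "card G = min h (card F)"
    using obtain_subset_with_card_n[of "min h (card F)" F] by auto
  have "card N \<le> card {f \<in> ?X. snd f \<inter> snd e \<noteq> {} \<and> snd f \<subseteq> ?T'}"
    unfolding N_def by (intro card_mono) auto
  also have "\<dots> \<le> s * card (snd e) * card ?T'"
    using fine finT' by (intro card_rc_board_touching) auto
  also have "\<dots> \<le> s * 2 * (2 + 2 * ?t)" using T' fine by (intro mult_mono) auto
  finally have "card (N \<union> G) \<le> s * 2 * (2 + 2 * ?t) + h"
    using card_Un_le[of N G] G(2) by linarith
  also have "\<dots> \<le> b" using b by (simp add: algebra_simps)
  finally have S0b: "card (N \<union> G) \<le> b" .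
  have S0: "N \<union> G \<subseteq> ?X - (?M \<union> Bk)" using G(1) unfolding N_def F_def by auto
  have "(\<exists>j<m - 1. exploring s n h r x y j ?M (Bk \<union> S)) \<or> separated s n l m x y ?M (Bk \<union> S)"
    if S: "N \<union> G \<subseteq> S" "S \<subseteq> ?X - (?M \<union> Bk)" for S
  proof -
    let ?free = "?X - (?M \<union> (Bk \<union> S))"
    have dec': "{f \<in> ?X. snd f \<subseteq> ?T'} \<subseteq> ?M \<union> (Bk \<union> S)"
    proof
      fix f assume f: "f \<in> {f \<in> ?X. snd f \<subseteq> ?T'}"
      show "f \<in> ?M \<union> (Bk \<union> S)"
      proof (cases "snd f \<inter> snd e = {}")
        case True
        with f have "snd f \<subseteq> ?T" unfolding T'_eq by auto
        then show ?thesis using dec f by blast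
      next
        case False
        then show ?thesis using f S(1) unfolding N_def by blast
      qed
    qed
    \<comment> \<open>All pairs of touched vertices were decided, so e has an untouched end. If the
      other end lies in C, adding the untouched one to C keeps C a union of components that omits
      y.\<close>
    have C': "\<exists>C. x \<in> C \<and> y \<notin> C \<and> C \<subseteq> ?T' \<and> (\<forall>f\<in>?M. snd f \<subseteq> C \<or> snd f \<inter> C = {})"
    proof (cases "snd e \<inter> C = {}")
      case True
      then show ?thesis using C T'_eq by (intro exI[of _ C]) auto
    next
      case False
      then obtain u where u: "u \<in> snd e" "u \<in> C" by auto
      obtain v where v: "snd e = {u, v}"
        using rc_board_other_endpoint[OF _ u(1)] e by blast
      have "v \<notin> ?T"
      proof
        assume "v \<in> ?T"
        moreover have "u \<in> ?T" using u(2) C(3) by (rule subsetD[rotated])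
        ultimately have "snd e \<subseteq> ?T" unfolding v by simp
        then show False using dec e by blast
      qed
      then have vy: "v \<noteq> y" and vM: "\<And>f. f \<in> M \<Longrightarrow> v \<notin> snd f" unfolding touched_def by blast+
      have "snd f \<subseteq> insert v C \<or> snd f \<inter> insert v C = {}" if "f \<in> M" for f
        using C(4)[OF that] vM[OF that] by blast
      then have "\<forall>f\<in>M. snd f \<subseteq> insert v C \<or> snd f \<inter> insert v C = {}" by (intro ballI)
      moreover have "snd e \<subseteq> insert v C" using u v by simp
      moreover have "insert v C \<subseteq> ?T'" using C(3) unfolding T'_eq v by blast
      moreover have "x \<in> insert v C" "y \<notin> insert v C" using C(1,2) vy by simp_all
      ultimately show ?thesis
        by (intro exI[of _ "insert v C"] conjI) simp_all
    qed
    have closed': "snd f \<inter> ball ?M ?Z j = {}" if "f \<in> ?free" "j < i" for f j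
    proof -
      have "f \<in> ?X - (M \<union> Bk)" using that(1) by blast
      from closed[OF this that(2)] show ?thesis using that(2) by (simp only: ball_eq less_imp_le)
    qed
    let ?F' = "\<lambda>i. {f \<in> ?free. snd f \<inter> ball ?M ?Z i \<noteq> {}}"
    have F': "?F' i \<subseteq> F - G" using S(1) unfolding ball_eq[OF order_refl] F_def by blast
    show ?thesis
    \<comment> \<open>If G exhausts F, the ball of radius i is closed: the next phase begins, or
      \<open>separated\<close> is reached. Otherwise the phase continues.\<close>
    proof (cases "card F \<le> h")
      case True
      then have "G = F" using G finF by (intro card_subset_eq) auto
      then have F'e: "?F' i = {}" using F' by auto
      have closed2: "snd f \<inter> ball ?M ?Z j = {}" if "f \<in> ?free" "j < Suc i" for f j
      proof (cases "j = i")
        case True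
        then show ?thesis using F'e that(1) by blast
      next
        case False
        then show ?thesis using closed'[OF that(1)] that(2) by simp
      qed
      have cardball: "card (ball ?M ?Z j) \<le> 2 + 2 * ?t" for j
        using card_mono[OF finT' ball_subset_touched[of ?M ?Z j]] T' by linarith
      show ?thesis
      proof (cases "Suc i = m - 1")
        case True
        \<comment> \<open>x and y are still in different components at the change of regime, which
          gives disjoint balls of radius m; from here on only this disjointness is
          maintained.\<close>
        have "ball ?M {x} m \<subseteq> C'" "ball ?M {y} m \<subseteq> - C'"
          if "x \<in> C'" "y \<notin> C'" "\<forall>f\<in>?M. snd f \<subseteq> C' \<or> snd f \<inter> C' = {}" for C'
          using that by (intro ball_subset_union_of_components; blast)+
        with C' have "ball ?M {x} m \<inter> ball ?M {y} m = {}" by blast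
        moreover have "card (ball ?M ?Z (m - 1)) \<le> l" using cardball[of "m - 1"] l by linarith
        moreover have "snd f \<inter> ball ?M ?Z j = {}" if "f \<in> ?free" "j < m - 1" for f j
          using closed2[of f j] that True by simp
        moreover have "{f \<in> ?X. snd f \<subseteq> ?T' \<and> snd f \<inter> ball ?M ?Z (m - 1) \<noteq> {}} \<subseteq> ?M \<union> (Bk \<union> S)"
          using dec' by blast
        ultimately have "separated s n l m x y ?M (Bk \<union> S)"
          unfolding separated_def by (intro conjI M' ballI allI impI)
        then show ?thesis ..
      next
        case False
        have "card (?F' (Suc i)) \<le> card {f \<in> ?X. snd f \<inter> ball ?M ?Z (Suc i) \<noteq> {} \<and> snd f \<subseteq> {1..n}}"
          using snd_rc_board[of _ s n] by (intro card_mono) (auto simp del: atLeastAtMost_iff)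
        also have "\<dots> \<le> s * card (ball ?M ?Z (Suc i)) * card {1..n}"
          by (intro card_rc_board_touching finite_subset[OF ball_subset_touched finT']) simp
        also have "\<dots> \<le> s * (2 + 2 * ?t) * n"
          using cardball[of "Suc i"] by (intro mult_mono) simp_all
        also have "\<dots> = (s * n) * (2 + 2 * ?t)" by (simp only: ac_simps)
        also have "\<dots> \<le> (h * r) * (2 + 2 * ?t)" using h(2) by (rule mult_right_mono) simp
        finally have "card (?F' (Suc i)) \<le> (h * r) * (2 + 2 * ?t)" .
        moreover have "h * (card ?M + 1) \<le> h * (?t + 1)" by (intro mult_le_mono2 add_le_mono1 tM)
        moreover have "h * phase_end r (Suc i) = h * (?t + 1) + (h * r) * (2 + 2 * ?t)"
          by (simp add: algebra_simps)
        ultimately have "h * (card ?M + 1) + card (?F' (Suc i)) \<le> h * phase_end r (Suc i)"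
          by linarith
        then have "exploring s n h r x y (Suc i) ?M (Bk \<union> S)"
          unfolding exploring_def decided_within_def
          by (intro conjI M' dec' C' ballI allI impI closed2)
        moreover have "Suc i < m - 1" using False i by simp
        ultimately show ?thesis by blast
      qed
    next
      case False
      have "card (?F' i) \<le> card (F - G)" using F' finF by (intro card_mono) auto
      also have "\<dots> = card F - h" using False G finF by (simp add: card_Diff_subset finite_subset)
      finally have "card (?F' i) + h \<le> card F" using False by linarith
      also have "card F \<le> card {e \<in> ?X - (M \<union> Bk). snd e \<inter> ball M ?Z i \<noteq> {}}"
        unfolding F_def by (intro card_mono) auto
      finally have "h + card (?F' i) \<le> card {e \<in> ?X - (M \<union> Bk). snd e \<inter> ball M ?Z i \<noteq> {}}" by linarith
      \<comment> \<open>One more Maker edge raises the first summand of the budget by h, and the h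
        edges of G lower the second by as much.\<close>
      moreover have "h * (card ?M + 1) = h * (card M + 1) + h" unfolding cardM' by simp
      ultimately have "h * (card ?M + 1) + card (?F' i) \<le> h * ?t" using budget by linarith
      then have "exploring s n h r x y i ?M (Bk \<union> S)"
        unfolding exploring_def decided_within_def
        by (intro conjI M' dec' C' ballI allI impI closed')
      then show ?thesis using i by blast
    qed
  qed
  then show ?thesis by (intro exI[of _ "N \<union> G"] conjI S0 S0b allI impI)
qed


text \<open>Distinct colours limit a rainbow path to \<open>s \<le> 2 * m\<close> edges, so its
  vertex at distance \<open>min m (length cs)\<close> from x is within distance m of both
  ends.\<close>

lemma not_rainbow_connected_if_disjoint_balls:
  assumes M: "M \<subseteq> rc_board s n" and s: "s \<le> 2 * m"
    and xy: "x \<noteq> y" "x \<in> {1..n}" "y \<in> {1..n}"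
    and disj: "ball M {x} m \<inter> ball M {y} m = {}"
  shows "\<not> (\<exists>A\<in>rc_winning_sets s n. A \<subseteq> M)"
proof
  assume "\<exists>A\<in>rc_winning_sets s n. A \<subseteq> M"
  then obtain A where A: "rainbow_connected n A" "A \<subseteq> M" unfolding rc_winning_sets_def by blast
  then obtain vs cs where path: "rainbow_path A vs cs" "hd vs = x" "last vs = y"
    using xy unfolding rainbow_connected_def by blast
  have path': "rainbow_path M vs cs" using path(1) A(2) unfolding rainbow_path_def by blast
  then have len: "length vs = Suc (length cs)" and dist: "distinct cs"
    and edge: "\<And>j. j < length cs \<Longrightarrow> (cs ! j, {vs ! j, vs ! Suc j}) \<in> M"
    unfolding rainbow_path_def by blast+
  have "c \<in> {1..s}" if "c \<in> set cs" for c
  proof -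
    obtain j where j: "j < length cs" "cs ! j = c" using \<open>c \<in> set cs\<close> by (auto simp: in_set_conv_nth)
    then have "(c, {vs ! j, vs ! Suc j}) \<in> rc_board s n" using edge[OF j(1)] M by auto
    then show ?thesis by (auto elim: rc_boardE)
  qed
  then have "card (set cs) \<le> card {1..s}" by (intro card_mono) auto
  then have k: "length cs \<le> 2 * m" using s dist by (simp add: distinct_card)
  let ?j = "min m (length cs)"
  have ends: "vs ! 0 = x" "vs ! length cs = y"
  proof -
    have "vs \<noteq> []" using len by auto
    then show "vs ! 0 = x" "vs ! length cs = y"
      using path(2,3) len by (simp_all add: hd_conv_nth last_conv_nth)
  qed
  have "vs ! ?j \<in> ball M {x} ?j"
    using rainbow_path_in_ball(1)[OF path', of 0 ?j] ends by simp
  also have "\<dots> \<subseteq> ball M {x} m" by (rule ball_mono_radius) simp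
  finally have 1: "vs ! ?j \<in> ball M {x} m" .
  have "vs ! ?j \<in> ball M {y} (length cs - ?j)"
    using rainbow_path_in_ball(2)[OF path', of ?j "length cs - ?j"] ends by simp
  also have "\<dots> \<subseteq> ball M {y} m" by (rule ball_mono_radius) (use k in simp)
  finally show False using 1 disj by blast
qed

lemma exploring_start:
  assumes e: "e \<in> rc_board s n" and xy: "x \<noteq> y" "x \<notin> snd e" "y \<notin> snd e"
    and h: "s * n \<le> h * r" and b: "16 * s \<le> b"
  shows "\<exists>S0 \<subseteq> rc_board s n - {e}. card S0 \<le> b \<and>
        (\<forall>S. S0 \<subseteq> S \<longrightarrow> S \<subseteq> rc_board s n - {e} \<longrightarrow> exploring s n h r x y 0 {e} S)"
proof -
  let ?X = "rc_board s n" and ?T = "touched {x, y} {e}"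
  have T: "finite ?T" "card ?T \<le> 4"
    using card_touched[of "{x, y}" "{e}" s n] e xy by simp_all
  define S0 where "S0 = {f \<in> ?X. snd f \<inter> ?T \<noteq> {} \<and> snd f \<subseteq> ?T} - {e}"
  have "card S0 \<le> card {f \<in> ?X. snd f \<inter> ?T \<noteq> {} \<and> snd f \<subseteq> ?T}"
    unfolding S0_def by (intro card_mono) auto
  also have "\<dots> \<le> s * card ?T * card ?T" using T by (intro card_rc_board_touching) auto
  also have "\<dots> \<le> s * 4 * 4" using T by (intro mult_mono) auto
  finally have S0b: "card S0 \<le> b" using b by simp
  have S0: "S0 \<subseteq> ?X - {e}" unfolding S0_def by blast
  have "exploring s n h r x y 0 {e} S" if S: "S0 \<subseteq> S" "S \<subseteq> ?X - {e}" for S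
    unfolding exploring_def
  proof (intro conjI)
    show "{e} \<subseteq> ?X" using e by simp
    have "f \<in> {e} \<union> S" if f: "f \<in> ?X" "snd f \<subseteq> ?T" for f
    proof -
      have "snd f \<noteq> {}" using card_snd_rc_board[OF f(1)] by auto
      then show ?thesis using f S(1) unfolding S0_def by blast
    qed
    then show "decided_within s n ?T {e} S" unfolding decided_within_def by blast
    show "\<exists>C. x \<in> C \<and> y \<notin> C \<and> C \<subseteq> ?T \<and> (\<forall>e\<in>{e}. snd e \<subseteq> C \<or> snd e \<inter> C = {})"
      using xy by (intro exI[of _ "{x}"]) (simp add: touched_def)
    show "\<forall>f\<in>?X - ({e} \<union> S). \<forall>j<0. snd f \<inter> ball {e} {x, y} j = {}" by simp
    have "card {f \<in> ?X - ({e} \<union> S). snd f \<inter> ball {e} {x, y} 0 \<noteq> {}}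
        \<le> card {f \<in> ?X. snd f \<inter> {x, y} \<noteq> {} \<and> snd f \<subseteq> {1..n}}"
      using snd_rc_board[of _ s n] by (intro card_mono) (auto simp del: atLeastAtMost_iff)
    also have "\<dots> \<le> s * card {x, y} * card {1..n}" by (intro card_rc_board_touching) auto
    also have "\<dots> = 2 * (s * n)" using xy by simp
    also have "\<dots> \<le> 2 * (h * r)" using h by simp
    finally show "h * (card {e} + 1) + card {f \<in> ?X - ({e} \<union> S). snd f \<inter> ball {e} {x, y} 0 \<noteq> {}}
        \<le> h * phase_end r 0" by (simp add: algebra_simps)
  qed
  then show ?thesis by (intro exI[of _ S0] conjI S0 S0b allI impI)
qed

lemma breaker_wins_rainbow_connectivity:
  assumes s: "1 \<le> s" "s \<le> 2 * m" and m: "m \<ge> 2" and n: "n \<ge> 4"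
    and h: "h > 0" "s * n \<le> h * r" and r: "r \<ge> 1"
    and b: "h + 4 * s * (phase_end r (m - 2) + 2) \<le> b"
  shows "breaker_wins (rc_board s n) (rc_winning_sets s n) b"
proof -
  let ?X = "rc_board s n"
  define l where "l = 2 * phase_end r (m - 2) + 2"
  define J where "J x y M Bk \<longleftrightarrow> x \<noteq> y \<and> x \<in> {1..n} \<and> y \<in> {1..n} \<and>
      ((\<exists>i<m - 1. exploring s n h r x y i M Bk) \<or> separated s n l m x y M Bk)" for x y M Bk
  \<comment> \<open>The empty position is treated apart because x and y are chosen only after
    Maker's first edge, so as to avoid it.\<close>
  define Inv where "Inv M Bk \<longleftrightarrow> M = {} \<and> Bk = {} \<or> (\<exists>x y. J x y M Bk)" for M Bk
  have pe: "phase_end r i \<le> phase_end r (m - 2)" if "i < m - 1" for i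
    using that by (intro phase_end_mono) auto
  have pe0: "phase_end r (m - 2) \<ge> 4" using phase_end_mono[of 0 "m - 2" r] r by simp
  have "breaker_forces ?X b (\<lambda>M. \<not> (\<exists>A\<in>rc_winning_sets s n. A \<subseteq> M)) True {} {}"
  proof (rule breaker_forces_invariant[where Inv = Inv])
    show "finite ?X" by simp
    show "Inv {} {}" unfolding Inv_def by simp
  next
    fix M Bk e assume inv: "Inv M Bk" and e: "e \<in> ?X - (M \<union> Bk)"
    from inv consider "M = {}" "Bk = {}" | x y where "J x y M Bk" unfolding Inv_def by blast
    then show "\<exists>S0\<subseteq>?X - (insert e M \<union> Bk). card S0 \<le> b \<and>
        (\<forall>S. S0 \<subseteq> S \<longrightarrow> S \<subseteq> ?X - (insert e M \<union> Bk) \<longrightarrow> Inv (insert e M) (Bk \<union> S))"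
    proof cases
      case 1
      have eX: "e \<in> ?X" using e by simp
      obtain i u v where uv: "e = (i, {u, v})" using eX by (rule rc_boardE)
      have "card ({1..n} - {u, v}) \<ge> card {1..n} - card {u, v}" by (intro diff_card_le_card_Diff) simp
      moreover have "card {u, v} \<le> 2" by (simp add: card_insert_if)
      ultimately have "2 \<le> card ({1..n} - {u, v})" using n by simp
      then obtain Z where Z: "Z \<subseteq> {1..n} - {u, v}" "card Z = 2"
        using obtain_subset_with_card_n by metis
      then obtain x y where xy: "Z = {x, y}" "x \<noteq> y" by (meson card_2_iff)
      have "16 * s \<le> 4 * s * (phase_end r (m - 2) + 2)" using pe0 s(1) by simp
      then have "16 * s \<le> b" using b by linarith
      moreover have "x \<notin> snd e" "y \<notin> snd e" using Z xy uv by auto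
      ultimately obtain S0 where S0: "S0 \<subseteq> ?X - {e}" "card S0 \<le> b"
          "\<And>S. S0 \<subseteq> S \<Longrightarrow> S \<subseteq> ?X - {e} \<Longrightarrow> exploring s n h r x y 0 {e} S"
        using exploring_start[OF eX xy(2) _ _ h(2)] by meson
      have "Inv {e} S" if "exploring s n h r x y 0 {e} S" for S
      proof -
        have "x \<in> {1..n}" "y \<in> {1..n}" "0 < m - 1" using Z xy m by auto
        then show ?thesis using that xy(2) unfolding Inv_def J_def by blast
      qed
      then have "Inv {e} S" if "S0 \<subseteq> S" "S \<subseteq> ?X - {e}" for S using S0(3)[OF that] .
      then show ?thesis unfolding 1 using S0(1,2)
        by (intro exI[of _ S0] conjI allI impI) (simp_all only: Un_empty_right Un_empty_left)
    next
      case 2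
      note J = 2[unfolded J_def]
      have xy: "x \<noteq> y" "x \<in> {1..n}" "y \<in> {1..n}"
        using J[THEN conjunct1] J[THEN conjunct2, THEN conjunct1]
          J[THEN conjunct2, THEN conjunct2, THEN conjunct1] .
      have InvI: "Inv M' Bk'"
        if "(\<exists>i<m - 1. exploring s n h r x y i M' Bk') \<or> separated s n l m x y M' Bk'" for M' Bk'
      proof -
        have "J x y M' Bk'" unfolding J_def by (intro conjI xy that)
        then show ?thesis unfolding Inv_def by (intro disjI2 exI)
      qed
      from J[THEN conjunct2, THEN conjunct2, THEN conjunct2] consider i where "i < m - 1" "exploring s n h r x y i M Bk" | "separated s n l m x y M Bk"
        by (elim disjE exE conjE)
      then show ?thesis
      proof cases
        case 1
        have "h + 4 * s * (phase_end r i + 1) \<le> h + 4 * s * (phase_end r (m - 2) + 2)"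
          using pe[OF 1(1)] by (intro add_left_mono mult_le_mono2 add_mono) simp_all
        then have A: "h + 4 * s * (phase_end r i + 1) \<le> b" using b by linarith
        have B: "2 * phase_end r i + 2 \<le> l" using pe[OF 1(1)] unfolding l_def by simp
        from exploring_step[OF 1(2) e 1(1) h xy(1) A B]
        obtain S0 where S0: "S0 \<subseteq> ?X - (insert e M \<union> Bk)" "card S0 \<le> b"
            "\<forall>S. S0 \<subseteq> S \<longrightarrow> S \<subseteq> ?X - (insert e M \<union> Bk) \<longrightarrow>
              (\<exists>i<m - 1. exploring s n h r x y i (insert e M) (Bk \<union> S)) \<or>
              separated s n l m x y (insert e M) (Bk \<union> S)"
          by (elim exE conjE)
        show ?thesis by (intro exI[of _ S0] conjI S0(1,2) allI impI InvI S0(3)[rule_format])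
      next
        case 2
        have A: "2 * s * (l + 2) \<le> b" using b unfolding l_def by (simp add: algebra_simps)
        have "0 < m" using m by simp
        from separated_step[OF 2 e this A]
        obtain S0 where S0: "S0 \<subseteq> ?X - (insert e M \<union> Bk)" "card S0 \<le> b"
            "\<forall>S. S0 \<subseteq> S \<longrightarrow> S \<subseteq> ?X - (insert e M \<union> Bk) \<longrightarrow>
              separated s n l m x y (insert e M) (Bk \<union> S)"
          by (elim exE conjE)
        show ?thesis
          by (intro exI[of _ S0] conjI S0(1,2) allI impI InvI disjI2 S0(3)[rule_format])
      qed
    qed
  next
    fix M Bk assume inv: "Inv M Bk" and free: "?X - (M \<union> Bk) = {}"
    have "(1, {1, 2}) \<in> ?X" unfolding rc_board_def using s n by force
    then have "\<not> (M = {} \<and> Bk = {})" using free by blast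
    then obtain x y where "J x y M Bk" using inv unfolding Inv_def by blast
    then have xy: "x \<noteq> y" "x \<in> {1..n}" "y \<in> {1..n}"
      and J: "(\<exists>i. exploring s n h r x y i M Bk) \<or> separated s n l m x y M Bk"
      unfolding J_def by blast+
    have M: "M \<subseteq> ?X" using J unfolding exploring_def separated_def by blast
    have "ball M {x} m \<inter> ball M {y} m = {}"
    proof (cases "separated s n l m x y M Bk")
      case True
      then show ?thesis unfolding separated_def by blast
    next
      case False
      \<comment> \<open>The board may fill up while Breaker is still exploring; then the component
        set C already separates x from y.\<close>
      then obtain i where i: "exploring s n h r x y i M Bk" using J by auto
      from i[unfolded exploring_def, THEN conjunct2, THEN conjunct2, THEN conjunct1]
      obtain C where C: "x \<in> C" "y \<notin> C" "\<And>e. e \<in> M \<Longrightarrow> snd e \<subseteq> C \<or> snd e \<inter> C = {}"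
        by blast
      have "ball M {x} m \<subseteq> C" using C by (intro ball_subset_union_of_components) simp_all
      moreover have "ball M {y} m \<subseteq> - C"
      proof (rule ball_subset_union_of_components)
        show "snd e \<subseteq> - C \<or> snd e \<inter> - C = {}" if "e \<in> M" for e using C(3)[OF that] by blast
      qed (use C in simp)
      ultimately show ?thesis by blast
    qed
    then show "\<not> (\<exists>A\<in>rc_winning_sets s n. A \<subseteq> M)"
      by (rule not_rainbow_connected_if_disjoint_balls[OF M s(2) xy])
  qed
  then show ?thesis unfolding breaker_wins_def .
qed


section \<open>Breaker's bias measured in powers of n\<close>

lemma ceiling_half: "\<lceil>real s / 2\<rceil> = int ((s + 1) div 2)"
proof (rule ceiling_unique)
  have "2 * ((s + 1) div 2) = s \<or> 2 * ((s + 1) div 2) = s + 1" by presburger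
  then have "2 * real ((s + 1) div 2) = s \<or> 2 * real ((s + 1) div 2) = s + 1"
    by (metis of_nat_1 of_nat_add of_nat_mult of_nat_numeral)
  then show "real_of_int (int ((s + 1) div 2)) - 1 < real s / 2"
    and "real s / 2 \<le> real_of_int (int ((s + 1) div 2))" by auto
qed

lemma breaker_wins_above_threshold:
  fixes s :: nat
  assumes s: "s \<ge> 3" and m: "m = (s + 1) div 2"
    and n: "real n \<ge> 20 ^ m" and b: "real b \<ge> 40 * real s * real n powr (1 - 1 / m)"
  shows "breaker_wins (rc_board s n) (rc_winning_sets s n) b"
proof -
  \<comment> \<open>Half of y is spent on exploring, half on keeping edges decided. Using y instead
    of b gives \<open>h \<le> s * n\<close>, so that rounding up to r costs at most a factor 2. The
    40 is chosen to make \<open>5 * r \<le> n powr (1 / m)\<close>, hence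
    \<open>(5 * r) ^ (m - 1) \<le> n powr (1 - 1 / m)\<close>.\<close>
  define y where "y = 40 * real s * real n powr (1 - 1 / m)"
  define h where "h = nat \<lfloor>y / 2\<rfloor>"
  define r where "r = nat \<lceil>real s * n / h\<rceil>"
  have m2: "m \<ge> 2" and sm: "s \<le> 2 * m" using s m by auto
  have "(20::real) ^ 2 \<le> 20 ^ m" using m2 by (intro power_increasing) auto
  then have n400: "real n \<ge> 400" using n by (simp only: power2_eq_square)
  have root: "real n powr (1 / m) \<ge> 20"
  proof -
    have "(20::real) = (20 ^ m) powr (1 / m)" using m2 by (simp add: powr_powr flip: powr_realpow)
    also have "\<dots> \<le> real n powr (1 / m)" using n by (intro powr_mono2) auto
    finally show ?thesis .
  qed
  have split: "real n powr (1 - 1 / m) * real n powr (1 / m) = n"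
    using n400 by (simp flip: powr_add)
  have pow_ge: "real n powr (1 - 1 / m) \<ge> 1" using n400 m2 by (intro ge_one_powr_ge_zero) auto
  have "y \<ge> 40 * 3 * 1" unfolding y_def using s pow_ge by (intro mult_mono) auto
  then have y: "y \<ge> 4" by simp
  have h_le: "real h \<le> y / 2" and h_ge: "y / 4 \<le> real h" unfolding h_def using y by linarith+
  have h0: "h > 0" using h_ge y by linarith
  have "y / 2 = 20 * real s * real n powr (1 - 1 / m)" unfolding y_def by simp
  also have "\<dots> \<le> real n powr (1 / m) * real s * real n powr (1 - 1 / m)"
    by (intro mult_right_mono root) simp_all
  also have "\<dots> = s * real n" using split by (simp add: ac_simps)
  finally have "real h \<le> real s * n" using h_le by linarith
  then have "1 \<le> real s * n / h" using h0 by simp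
  then have r1: "r \<ge> 1" and r_le: "real r \<le> 2 * (real s * n / h)" and r_ge: "real s * n / h \<le> r"
  proof -
    define z where "z = real s * n / h"
    assume "1 \<le> real s * n / h"
    then have "1 \<le> z" "real r = of_int \<lceil>z\<rceil>" unfolding r_def z_def by simp_all
    then show "r \<ge> 1" "real r \<le> 2 * (real s * n / h)" "real s * n / h \<le> r"
      unfolding z_def[symmetric] by linarith+
  qed
  have "real (s * n) \<le> real (h * r)" using r_ge h0 by (simp add: field_simps)
  then have hr: "s * n \<le> h * r" by (simp only: of_nat_le_iff)
  have "5 * real r \<le> 10 * (real s * n / h)" using r_le by simp
  also have "\<dots> \<le> 10 * (real s * n / (y / 4))"
    using h_ge y h0 by (intro mult_left_mono divide_left_mono) auto
  also have "\<dots> = real n powr (1 / m)"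
  proof -
    have "10 * (S * (P * R) / (40 * S * P / 4)) = R" if "S > 0" "P > 0" for S P R :: real
      using that by (simp add: field_simps)
    from this[of s "real n powr (1 - 1 / m)" "real n powr (1 / m)"] show ?thesis
      using pow_ge s n400 unfolding y_def split by simp
  qed
  finally have "(5 * real r) ^ (m - 1) \<le> (real n powr (1 / m)) ^ (m - 1)"
    by (intro power_mono) auto
  also have "\<dots> = real n powr (1 / m * real (m - 1))"
    using n400 by (subst powr_power) simp_all
  also have "1 / m * real (m - 1) = 1 - 1 / m" using m2 by (simp add: field_simps of_nat_diff)
  finally have pe: "(5 * real r) ^ (m - 1) \<le> real n powr (1 - 1 / m)" .
  have "phase_end r (m - 2) + 1 \<le> (5 * r) ^ Suc (m - 2)" by (rule phase_end_le[OF r1])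
  also have "Suc (m - 2) = m - 1" using m2 by simp
  finally have "real (phase_end r (m - 2) + 1) \<le> real ((5 * r) ^ (m - 1))" by (simp only: of_nat_le_iff)
  then have pe': "real (phase_end r (m - 2)) + 1 \<le> real n powr (1 - 1 / m)" using pe by simp
  have "4 * real s * (real (phase_end r (m - 2)) + 2) \<le> 4 * real s * (2 * real n powr (1 - 1 / m))"
    using pe' by (intro mult_left_mono) auto
  also have "\<dots> \<le> y / 2" unfolding y_def by simp
  finally have "real (h + 4 * s * (phase_end r (m - 2) + 2)) \<le> y" using h_le by (simp add: algebra_simps)
  also have "\<dots> \<le> b" unfolding y_def by (rule b)
  finally have "h + 4 * s * (phase_end r (m - 2) + 2) \<le> b" by (simp only: of_nat_le_iff)
  moreover have "1 \<le> s" "4 \<le> n" using s n400 by simp_all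
  ultimately show ?thesis by (intro breaker_wins_rainbow_connectivity[OF _ sm m2 _ h0 hr r1])
qed

section \<open>The potential of Maker\<close>

text \<open>The probability that Maker ends up with e if each free element independently becomes
  hers with probability p; \<open>set_weight\<close> is then the conditional probability that she
  gets all of A.\<close>

definition elem_weight :: "real \<Rightarrow> 'a set \<Rightarrow> 'a set \<Rightarrow> 'a \<Rightarrow> real" where
  "elem_weight p M Bk e = (if e \<in> M then 1 else if e \<in> Bk then 0 else p)"

definition set_weight :: "real \<Rightarrow> 'a set \<Rightarrow> 'a set \<Rightarrow> 'a set \<Rightarrow> real" where
  "set_weight p M Bk A = (\<Prod>e\<in>A. elem_weight p M Bk e)"

lemma elem_weight_nonneg: "0 \<le> p \<Longrightarrow> 0 \<le> elem_weight p M Bk e"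
  by (simp add: elem_weight_def)

lemma set_weight_nonneg: "0 \<le> p \<Longrightarrow> 0 \<le> set_weight p M Bk A"
  unfolding set_weight_def by (intro prod_nonneg ballI elem_weight_nonneg)

lemma set_weight_insert_Maker:
  assumes "finite A" "e0 \<notin> M \<union> Bk" "p > 0"
  shows "set_weight p (insert e0 M) Bk A = (if e0 \<in> A then set_weight p M Bk A / p else set_weight p M Bk A)"
proof (cases "e0 \<in> A")
  case True
  have rest: "(\<Prod>e\<in>A - {e0}. elem_weight p (insert e0 M) Bk e) = (\<Prod>e\<in>A - {e0}. elem_weight p M Bk e)"
    by (intro prod.cong) (auto simp: elem_weight_def)
  have "set_weight p (insert e0 M) Bk A = (\<Prod>e\<in>A - {e0}. elem_weight p M Bk e)"
    unfolding set_weight_def prod.remove[OF assms(1) True] rest by (simp add: elem_weight_def)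
  moreover have "set_weight p M Bk A = p * (\<Prod>e\<in>A - {e0}. elem_weight p M Bk e)"
    unfolding set_weight_def prod.remove[OF assms(1) True] using assms(2) by (simp add: elem_weight_def)
  ultimately show ?thesis using True assms(3) by simp
next
  case False
  then show ?thesis unfolding set_weight_def by (auto intro!: prod.cong simp: elem_weight_def)
qed

lemma set_weight_add_Breaker:
  assumes "finite A" "S \<inter> M = {}"
  shows "set_weight p M (Bk \<union> S) A = (if A \<inter> S = {} then set_weight p M Bk A else 0)"
proof (cases "A \<inter> S = {}")
  case True
  then show ?thesis unfolding set_weight_def by (auto intro!: prod.cong simp: elem_weight_def)
next
  case False
  then obtain e where "e \<in> A" "e \<in> S" by auto
  moreover have "elem_weight p M (Bk \<union> S) e = 0"
    using assms(2) \<open>e \<in> S\<close> by (auto simp: elem_weight_def)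
  ultimately show ?thesis unfolding set_weight_def using assms(1) False by (auto intro: prod_zero)
qed

lemma set_weight_round:
  assumes "finite A" "e0 \<notin> M \<union> Bk" "p > 0" "S \<inter> insert e0 M = {}"
  shows "set_weight p (insert e0 M) (Bk \<union> S) A =
    (if A \<inter> S = {} then if e0 \<in> A then set_weight p M Bk A / p else set_weight p M Bk A else 0)"
  using set_weight_add_Breaker[OF assms(1,4)] set_weight_insert_Maker[OF assms(1-3)] by simp

text \<open>A union bound over Breaker's answer. If A contains e0, it has weight
  \<open>w / p\<close> when Breaker answers; the cross term with \<open>1 / p\<close> removes this
  larger amount, and it is the source of the second order loss.\<close>

lemma set_weight_round_lower:
  assumes "finite A" "finite S" "e0 \<notin> M \<union> Bk" "0 < p" "p \<le> 1" "S \<inter> insert e0 M = {}"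
  defines "w \<equiv> set_weight p M Bk A"
  shows "w + (1 / p - 1) * (if e0 \<in> A then w else 0)
       - (\<Sum>e\<in>S. (if e \<in> A then w else 0) + 1 / p * (if e \<in> A \<and> e0 \<in> A then w else 0))
     \<le> set_weight p (insert e0 M) (Bk \<union> S) A"
proof -
  have w: "w \<ge> 0" unfolding w_def using assms by (intro set_weight_nonneg) auto
  let ?t = "\<lambda>e. (if e \<in> A then w else 0) + 1 / p * (if e \<in> A \<and> e0 \<in> A then w else 0)"
  have t: "?t e \<ge> 0" for e using w assms(4) by simp
  show ?thesis
  proof (cases "A \<inter> S = {}")
    case True
    then have "(\<Sum>e\<in>S. ?t e) = 0" by (intro sum.neutral) auto
    then show ?thesis using True set_weight_round[OF assms(1,3,4,6)] unfolding w_def[symmetric]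
      by (simp add: field_simps)
  next
    case False
    then obtain e where e: "e \<in> A" "e \<in> S" by auto
    have "?t e \<le> (\<Sum>e\<in>S. ?t e)" using t e assms(2) by (intro member_le_sum) auto
    moreover have "w + (1 / p - 1) * (if e0 \<in> A then w else 0) \<le> ?t e"
      using e w by (simp add: algebra_simps)
    ultimately show ?thesis using False set_weight_round[OF assms(1,3,4,6)] by simp
  qed
qed

text \<open>Breaker's elements may all lie in the same A, which costs the factor \<open>1 / R\<close>.\<close>

lemma set_weight_round_upper:
  assumes "finite A" "finite S" "e0 \<notin> M \<union> Bk" "0 < p" "p \<le> 1" "S \<inter> insert e0 M = {}"
    and R: "card A \<le> R" "R \<ge> 1"
  defines "w \<equiv> set_weight p M Bk A"
  shows "set_weight p (insert e0 M) (Bk \<union> S) A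
    \<le> w + (1 / p - 1) * (if e0 \<in> A then w else 0) - (\<Sum>e\<in>S. if e \<in> A then w else 0) / R"
proof -
  have w: "w \<ge> 0" unfolding w_def using assms by (intro set_weight_nonneg) auto
  show ?thesis
  proof (cases "A \<inter> S = {}")
    case True
    then have "(\<Sum>e\<in>S. if e \<in> A then w else 0) = 0" by (intro sum.neutral) auto
    then show ?thesis using True set_weight_round[OF assms(1,3,4,6)] unfolding w_def[symmetric]
      by (simp add: field_simps)
  next
    case False
    have "(\<Sum>e\<in>S. if e \<in> A then w else 0) = real (card (S \<inter> A)) * w"
      using assms(2) by (simp add: sum.If_cases)
    also have "\<dots> \<le> real R * w"
      using card_mono[OF assms(1), of "S \<inter> A"] R w by (intro mult_right_mono) auto
    finally have "(\<Sum>e\<in>S. if e \<in> A then w else 0) / R \<le> w" using R by (simp add: field_simps)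
    moreover have "0 \<le> (1 / p - 1) * (if e0 \<in> A then w else 0)" using w assms(4,5) by simp
    ultimately show ?thesis using False set_weight_round[OF assms(1,3,4,6)] by simp
  qed
qed

text \<open>The price of convexity: a gain u counts only 3/4, a loss l counts 3/2. The ratio 2 of
  the slopes is matched by \<open>1 / p - 1 = 2 * b\<close>.\<close>

lemma exp_gain_loss_bound:
  fixes u l :: real
  assumes "0 \<le> u" "u \<le> 1/2" "0 \<le> l" "l \<le> 1/2"
  shows "exp (l - u) \<le> 1 - 3/4 * u + 3/2 * l"
proof -
  have "exp l \<le> 1 + l + l\<^sup>2" using assms by (intro exp_bound) auto
  also have "l\<^sup>2 \<le> 1/2 * l"
    unfolding power2_eq_square using assms by (intro mult_right_mono) auto
  finally have l: "exp l \<le> 1 + 3/2 * l" by simp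
  have "1 \<le> (1 - 3/4 * u) * (1 + u + u\<^sup>2 / 2)"
  proof -
    have uu: "u * u \<le> 1/2 * u" using assms by (intro mult_right_mono) auto
    then have "u * (u * u) \<le> u * (1/2 * u)" using assms by (intro mult_left_mono) auto
    moreover have "(1 - 3/4 * u) * (1 + u + u\<^sup>2 / 2) = 1 + 1/4 * u - 1/4 * (u * u) - 3/8 * (u * (u * u))"
      by (simp add: algebra_simps power2_eq_square)
    moreover have "u * (1/2 * u) = 1/2 * (u * u)" by simp
    ultimately show ?thesis using uu assms(1) by linarith
  qed
  also have "\<dots> \<le> (1 - 3/4 * u) * exp u"
    using assms by (intro mult_left_mono exp_lower_Taylor_quadratic) auto
  finally have u: "exp (-u) \<le> 1 - 3/4 * u" by (simp add: exp_minus field_simps)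
  have "exp (l - u) = exp l * exp (-u)" by (simp flip: exp_add)
  also have "\<dots> \<le> (1 + 3/2 * l) * (1 - 3/4 * u)" using l u assms by (intro mult_mono) auto
  also have "\<dots> \<le> 1 - 3/4 * u + 3/2 * l" using assms by (simp add: algebra_simps)
  finally show ?thesis .
qed

text \<open>Breaker's elements enter the exponent with \<open>2 / b\<close>, twice the break-even
  rate; the surplus pays for convexity. What remains are slopes \<open>1 / 3\<close> and
  \<open>1 / (3 * b)\<close>, so b elements of Breaker balance one of Maker.\<close>

lemma exp_degree_bound:
  fixes a k :: nat and b :: nat
  assumes "a \<le> 1" "k \<le> b" "b \<ge> 1"
  shows "exp ((real a - 2 / b * k) / 4) \<le> 1 + a / 3 - k / (3 * b)"
proof -
  let ?v = "real k / (2 * b)"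
  have v: "0 \<le> ?v" "?v \<le> 1/2" using assms by (auto simp: field_simps)
  have "exp (real a / 4) \<le> 1 + real a / 3"
  proof (cases "a = 0")
    case False
    then have "a = 1" using assms by simp
    moreover have "exp (1/4::real) \<le> 1 + 1/4 + (1/4)\<^sup>2" by (rule exp_bound) auto
    ultimately show ?thesis by (simp add: power2_eq_square)
  qed simp
  moreover have "exp (- ?v) \<le> 1 - 3/4 * ?v" using exp_gain_loss_bound[of ?v 0] v by simp
  moreover have "1 - 3/4 * ?v \<le> 1 - 2/3 * ?v" using v(1) by linarith
  ultimately have "exp (real a / 4) * exp (- ?v) \<le> (1 + real a / 3) * (1 - 2/3 * ?v)"
    by (intro mult_mono) auto
  also have "\<dots> = 1 + real a / 3 - 2/3 * ?v - real a / 3 * (2/3 * ?v)"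
    by algebra
  also have "\<dots> \<le> 1 + real a / 3 - 2/3 * ?v" using v(1) by simp
  also have "exp (real a / 4) * exp (- ?v) = exp ((real a - 2 / b * k) / 4)"
    by (simp flip: exp_add add: field_simps)
  also have "2/3 * ?v = k / (3 * b)" by simp
  finally show ?thesis .
qed

text \<open>Three kinds of requirement: for g in G, many of the sets \<open>A g i\<close> should be
  obtained; for h in H, the set \<open>B h\<close> should preferably not be completed; for d in D,
  Maker should take few elements of \<open>St d\<close>. \<open>tau\<close> is the charge that pays
  for second order losses.\<close>

locale maker_potential =
  fixes X :: "'a set" and b R :: nat
    and G :: "'g set" and P :: "'g \<Rightarrow> 'i set" and A :: "'g \<Rightarrow> 'i \<Rightarrow> 'a set"
    and tau :: "'g \<Rightarrow> 'a set \<Rightarrow> 'a \<Rightarrow> real" and lam :: real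
    and H :: "'h set" and B :: "'h \<Rightarrow> 'a set" and c :: "'h \<Rightarrow> real"
    and D :: "'d set" and St :: "'d \<Rightarrow> 'a set" and kap :: real
  assumes finX: "finite X" and b: "b \<ge> 1" and R: "R \<ge> 1"
    and fin: "finite G" "finite H" "finite D" "\<And>g. finite (P g)"
    and finA: "\<And>g i. finite (A g i)" and B: "\<And>h. h \<in> H \<Longrightarrow> finite (B h)" "\<And>h. h \<in> H \<Longrightarrow> card (B h) \<le> R"
    and nonneg: "\<And>h. c h \<ge> 0" "lam \<ge> 0" "kap \<ge> 0"
    and tau_nonneg: "\<And>g M e. tau g M e \<ge> 0"
    and tau_mono: "\<And>g M M' e. M \<subseteq> M' \<Longrightarrow> tau g M e \<le> tau g M' e"
begin

text \<open>The values are chosen for \<open>1 / p - 1 = 2 * b\<close> and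
  \<open>1 / q - 1 = b / R\<close>. The sets \<open>B h\<close> enter linearly, so no factor for
  convexity is needed in q, but up to R elements of Breaker may hit the same set, which reduces the
  admissible gain to \<open>b / R\<close>.\<close>

definition p :: real where "p = 1 / (2 * b + 1)"
definition q :: real where "q = R / (b + R)"

lemma p: "0 < p" "p \<le> 1" "1 / p - 1 = 2 * b" "p * b \<le> 1/2"
  using b unfolding p_def by (auto simp: field_simps)

lemma q: "0 < q" "q \<le> 1" "1 / q - 1 = b / R"
  using R unfolding q_def by (auto simp: field_simps)

definition F :: "'g \<Rightarrow> 'a set \<Rightarrow> 'a set \<Rightarrow> real" where
  "F g M Bk = (\<Sum>i\<in>P g. set_weight p M Bk (A g i))"

definition through :: "'g \<Rightarrow> 'a set \<Rightarrow> 'a set \<Rightarrow> 'a set \<Rightarrow> real" where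
  "through g M Bk E = (\<Sum>i\<in>P g. if E \<subseteq> A g i then set_weight p M Bk (A g i) else 0)"

text \<open>When Maker claims e and Breaker answers with f, all paths through both are lost. This loss is
  charged to e or f; \<open>tau\<close> bounds it in terms of M alone, and \<open>Q\<close> accumulates the charges.\<close>

definition Q :: "'g \<Rightarrow> 'a set \<Rightarrow> 'a set \<Rightarrow> real" where
  "Q g M Bk = 3 * p * (\<Sum>e\<in>Bk. tau g M e)"

definition goal_potential :: "'g \<Rightarrow> 'a set \<Rightarrow> 'a set \<Rightarrow> real" where
  "goal_potential g M Bk = exp (- lam * (F g M Bk + Q g M Bk))"

definition deg_potential :: "'d \<Rightarrow> 'a set \<Rightarrow> 'a set \<Rightarrow> real" where
  "deg_potential d M Bk = kap * exp ((card (M \<inter> St d) - 2 / b * card (Bk \<inter> St d)) / 4)"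

definition Phi :: "'a set \<Rightarrow> 'a set \<Rightarrow> real" where
  "Phi M Bk = (\<Sum>g\<in>G. goal_potential g M Bk) + (\<Sum>h\<in>H. c h * set_weight q M Bk (B h))
     + (\<Sum>d\<in>D. deg_potential d M Bk)"

lemma F_round:
  assumes "finite S" "e0 \<notin> M \<union> Bk" "S \<inter> insert e0 M = {}"
  shows "F g M Bk + 2 * b * through g M Bk {e0}
       - (\<Sum>e\<in>S. through g M Bk {e} + 1 / p * through g M Bk {e, e0})
     \<le> F g (insert e0 M) (Bk \<union> S)"
proof -
  let ?w = "\<lambda>i. set_weight p M Bk (A g i)"
  have "(\<Sum>i\<in>P g. ?w i + (1 / p - 1) * (if e0 \<in> A g i then ?w i else 0)
       - (\<Sum>e\<in>S. (if e \<in> A g i then ?w i else 0) + 1 / p * (if e \<in> A g i \<and> e0 \<in> A g i then ?w i else 0)))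
     \<le> F g (insert e0 M) (Bk \<union> S)"
    unfolding F_def using assms p finA by (intro sum_mono set_weight_round_lower) auto
  also have "(\<Sum>i\<in>P g. ?w i + (1 / p - 1) * (if e0 \<in> A g i then ?w i else 0)
       - (\<Sum>e\<in>S. (if e \<in> A g i then ?w i else 0) + 1 / p * (if e \<in> A g i \<and> e0 \<in> A g i then ?w i else 0)))
     = F g M Bk + (1 / p - 1) * through g M Bk {e0}
       - (\<Sum>e\<in>S. through g M Bk {e} + 1 / p * through g M Bk {e, e0})"
    unfolding F_def through_def
    by (simp only: sum_subtractf sum.distrib sum_distrib_left sum.swap[of _ S "P g"] insert_subset
        empty_subsetI simp_thms)
  finally show ?thesis unfolding p(3) .
qed

text \<open>\<open>j e\<close> is the linearised value of e to Maker: the paths through e minus the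
  charge that claiming e may incur. The bounds by \<open>p / 4\<close> and \<open>1 / 4\<close> keep
  the exponents in the range of \<open>exp_gain_loss_bound\<close>.\<close>

lemma goal_potential_round:
  fixes j :: "'a \<Rightarrow> real"
  assumes S: "finite S" "e0 \<notin> M \<union> Bk" "S \<inter> insert e0 M = {}" "S \<inter> Bk = {}" "card S = b" "finite Bk"
    and second: "\<And>e. e \<in> S \<Longrightarrow> through g M Bk {e, e0} \<le> p\<^sup>2 * (tau g M e + tau g M e0)"
    and first: "\<And>e. e \<in> insert e0 S \<Longrightarrow> lam * through g M Bk {e} \<le> p / 4"
    and charge: "\<And>e. e \<in> insert e0 S \<Longrightarrow> lam * tau g M e \<le> 1 / 4"
  defines "j \<equiv> \<lambda>e. 3/2 * lam * goal_potential g M Bk * (through g M Bk {e} - p * tau g M e)"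
  shows "goal_potential g (insert e0 M) (Bk \<union> S) \<le> goal_potential g M Bk - b * j e0 + (\<Sum>e\<in>S. j e)"
proof -
  let ?v = "\<lambda>e. through g M Bk {e}" and ?t = "\<lambda>e. tau g M e"
  have v: "?v e \<ge> 0" for e
    unfolding through_def using p by (intro sum_nonneg) (auto intro: set_weight_nonneg)
  \<comment> \<open>u collects what raises \<open>F + Q\<close>, l what lowers it. Breaker's
    elements add \<open>3 * p * tau\<close> to Q; one p pays for the paths through e and e0, and the
    remaining \<open>2 * p\<close> becomes the p in j after the slope 3/4.\<close>
  define u where "u = lam * (2 * b * ?v e0 + 2 * p * (\<Sum>e\<in>S. ?t e))"
  define l where "l = lam * ((\<Sum>e\<in>S. ?v e) + p * b * ?t e0)"
  have "(\<Sum>e\<in>S. ?v e + 1 / p * through g M Bk {e, e0}) \<le> (\<Sum>e\<in>S. ?v e + p * (?t e + ?t e0))"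
  proof (intro sum_mono add_left_mono)
    fix e assume "e \<in> S"
    have "1 / p * through g M Bk {e, e0} \<le> 1 / p * (p\<^sup>2 * (?t e + ?t e0))"
      using second[OF \<open>e \<in> S\<close>] p by (intro mult_left_mono) auto
    then show "1 / p * through g M Bk {e, e0} \<le> p * (?t e + ?t e0)"
      using p by (simp add: power2_eq_square)
  qed
  also have "\<dots> = (\<Sum>e\<in>S. ?v e) + p * (\<Sum>e\<in>S. ?t e) + p * b * ?t e0"
    using S(5) by (simp add: sum.distrib sum_distrib_left algebra_simps)
  finally have F: "F g M Bk + 2 * b * ?v e0 - ((\<Sum>e\<in>S. ?v e) + p * (\<Sum>e\<in>S. ?t e) + p * b * ?t e0)
      \<le> F g (insert e0 M) (Bk \<union> S)" using F_round[OF S(1-3), of g] by linarith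
  have "Q g M Bk + 3 * p * (\<Sum>e\<in>S. ?t e) = 3 * p * (\<Sum>e\<in>Bk \<union> S. ?t e)"
    unfolding Q_def using S by (subst sum.union_disjoint) (auto simp: algebra_simps)
  \<comment> \<open>Old charges can only grow with M by \<open>tau_mono\<close>, so Q never
    decreases.\<close>
  also have "\<dots> \<le> Q g (insert e0 M) (Bk \<union> S)"
    unfolding Q_def using p by (intro mult_left_mono sum_mono tau_mono) auto
  finally have "F g M Bk + Q g M Bk + (2 * b * ?v e0 + 2 * p * (\<Sum>e\<in>S. ?t e))
      - ((\<Sum>e\<in>S. ?v e) + p * b * ?t e0) \<le> F g (insert e0 M) (Bk \<union> S) + Q g (insert e0 M) (Bk \<union> S)"
    using F by linarith
  then have "lam * (F g M Bk + Q g M Bk) + u - l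
      \<le> lam * (F g (insert e0 M) (Bk \<union> S) + Q g (insert e0 M) (Bk \<union> S))"
    unfolding u_def l_def
    using mult_left_mono[OF _ nonneg(2), of "F g M Bk + Q g M Bk + (2 * b * ?v e0 + 2 * p * (\<Sum>e\<in>S. ?t e))
      - ((\<Sum>e\<in>S. ?v e) + p * b * ?t e0)" "F g (insert e0 M) (Bk \<union> S) + Q g (insert e0 M) (Bk \<union> S)"]
    by (simp add: algebra_simps)
  then have "goal_potential g (insert e0 M) (Bk \<union> S) \<le> exp (- lam * (F g M Bk + Q g M Bk) + (l - u))"
    unfolding goal_potential_def by simp
  also have "\<dots> = goal_potential g M Bk * exp (l - u)" unfolding goal_potential_def exp_add ..
  also have "\<dots> \<le> goal_potential g M Bk * (1 - 3/4 * u + 3/2 * l)"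
  proof (intro mult_left_mono exp_gain_loss_bound)
    show "0 \<le> goal_potential g M Bk" unfolding goal_potential_def by simp
    show "0 \<le> u" "0 \<le> l" unfolding u_def l_def using nonneg v tau_nonneg p
      by (intro mult_nonneg_nonneg add_nonneg_nonneg sum_nonneg; simp)+
    have St: "(\<Sum>e\<in>S. lam * ?t e) \<le> real b * (1 / 4)"
      using sum_bounded_above[of S "\<lambda>e. lam * ?t e" "1/4"] charge S(5) by simp
    have Sv: "(\<Sum>e\<in>S. lam * ?v e) \<le> real b * (p / 4)"
      using sum_bounded_above[of S "\<lambda>e. lam * ?v e" "p/4"] first S(5) by simp
    have "u = 2 * b * (lam * ?v e0) + 2 * p * (\<Sum>e\<in>S. lam * ?t e)"
      unfolding u_def by (simp add: algebra_simps sum_distrib_left)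
    also have "\<dots> \<le> 2 * b * (p / 4) + 2 * p * (real b * (1 / 4))"
      using first St p by (intro add_mono mult_left_mono) auto
    also have "\<dots> \<le> 1 / 2" using p(4) by (simp add: algebra_simps)
    finally show "u \<le> 1 / 2" .
    have "l = (\<Sum>e\<in>S. lam * ?v e) + p * b * (lam * ?t e0)"
      unfolding l_def by (simp add: algebra_simps sum_distrib_left)
    also have "\<dots> \<le> real b * (p / 4) + p * b * (1 / 4)"
      using charge Sv p by (intro add_mono mult_left_mono) auto
    also have "\<dots> \<le> 1 / 2" using p(4) by (simp add: algebra_simps)
    finally show "l \<le> 1 / 2" .
  qed
  also have "\<dots> = goal_potential g M Bk - b * j e0 + (\<Sum>e\<in>S. j e)"
  proof -
    have "(\<Sum>e\<in>S. j e) = 3/2 * lam * goal_potential g M Bk * ((\<Sum>e\<in>S. ?v e) - p * (\<Sum>e\<in>S. ?t e))"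
      unfolding j_def by (simp add: sum_distrib_left sum_subtractf right_diff_distrib)
    then show ?thesis unfolding u_def l_def j_def by (simp add: field_simps)
  qed
  finally show ?thesis .
qed

lemma deg_potential_round:
  fixes j :: "'a \<Rightarrow> real" and d :: 'd
  assumes S: "finite S" "e0 \<notin> M \<union> Bk" "S \<inter> Bk = {}" "card S = b" "finite Bk" "finite M"
  defines "j \<equiv> \<lambda>e. if e \<in> St d then - deg_potential d M Bk / (3 * b) else 0"
  shows "deg_potential d (insert e0 M) (Bk \<union> S) \<le> deg_potential d M Bk - b * j e0 + (\<Sum>e\<in>S. j e)"
proof -
  define a :: nat where "a = (if e0 \<in> St d then 1 else 0)"
  define k where "k = card (S \<inter> St d)"
  have k: "k \<le> b" using S(1,4) unfolding k_def by (metis Int_lower1 card_mono)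
  have "insert e0 M \<inter> St d = (if e0 \<in> St d then insert e0 (M \<inter> St d) else M \<inter> St d)" by auto
  then have M': "card (insert e0 M \<inter> St d) = card (M \<inter> St d) + a"
    using S unfolding a_def by (auto simp: card_insert_disjoint)
  have "(Bk \<union> S) \<inter> St d = (Bk \<inter> St d) \<union> (S \<inter> St d)" by auto
  then have Bk': "card ((Bk \<union> S) \<inter> St d) = card (Bk \<inter> St d) + k"
    using S unfolding k_def by (subst card_Un_disjoint[symmetric]) auto
  have "deg_potential d (insert e0 M) (Bk \<union> S) = deg_potential d M Bk * exp ((real a - 2 / b * k) / 4)"
    unfolding deg_potential_def M' Bk' by (simp flip: exp_add add: algebra_simps add_divide_distrib diff_divide_distrib)
  also have "\<dots> \<le> deg_potential d M Bk * (1 + a / 3 - k / (3 * b))"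
    using k b nonneg(3) unfolding a_def
    by (intro mult_left_mono exp_degree_bound) (auto simp: deg_potential_def)
  also have "(\<Sum>e\<in>S. j e) = - deg_potential d M Bk * (k / (3 * b))"
    unfolding j_def k_def using S(1) by (simp add: sum.If_cases)
  then have "deg_potential d M Bk * (1 + a / 3 - k / (3 * b))
      = deg_potential d M Bk - b * j e0 + (\<Sum>e\<in>S. j e)"
    unfolding j_def a_def using b by (simp add: field_simps)
  finally show ?thesis .
qed

text \<open>Maker takes a free element e0 maximising the total linearised value J. Each term of Phi
  changes by at most \<open>- b * j e0\<close> plus the sum of its j over Breaker's b elements, all
  of which were available to her and have \<open>J e \<le> J e0\<close>.\<close>

lemma Phi_round:
  assumes M: "M \<subseteq> X" "Bk \<subseteq> X" and free: "X - (M \<union> Bk) \<noteq> {}"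
    and second: "\<And>g e f. g \<in> G \<Longrightarrow> e \<in> X - (M \<union> Bk) \<Longrightarrow> f \<in> X - (M \<union> Bk) \<Longrightarrow> e \<noteq> f \<Longrightarrow>
      through g M Bk {e, f} \<le> p\<^sup>2 * (tau g M e + tau g M f)"
    and first: "\<And>g e. g \<in> G \<Longrightarrow> e \<in> X - (M \<union> Bk) \<Longrightarrow> lam * through g M Bk {e} \<le> p / 4"
    and charge: "\<And>g e. g \<in> G \<Longrightarrow> e \<in> X - (M \<union> Bk) \<Longrightarrow> lam * tau g M e \<le> 1 / 4"
  shows "\<exists>e0 \<in> X - (M \<union> Bk). \<forall>S \<subseteq> X - (insert e0 M \<union> Bk). card S = b \<longrightarrow>
    Phi (insert e0 M) (Bk \<union> S) \<le> Phi M Bk"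
proof -
  define jg where "jg g e = 3/2 * lam * goal_potential g M Bk * (through g M Bk {e} - p * tau g M e)" for g e
  define jd where "jd d e = (if e \<in> St d then - deg_potential d M Bk / (3 * b) else 0)" for d e
  define ju where "ju h e = c h * (if e \<in> B h then - set_weight q M Bk (B h) / R else 0)" for h e
  define J where "J e = (\<Sum>g\<in>G. jg g e) + (\<Sum>h\<in>H. ju h e) + (\<Sum>d\<in>D. jd d e)" for e
  have fins: "finite M" "finite Bk" "finite (X - (M \<union> Bk))" using M finX finite_subset by auto
  have "Max (J ` (X - (M \<union> Bk))) \<in> J ` (X - (M \<union> Bk))" using fins free by (intro Max_in) simp_all
  then obtain e0 where e0: "e0 \<in> X - (M \<union> Bk)" "Max (J ` (X - (M \<union> Bk))) = J e0" by (elim imageE)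
  have max: "J e \<le> J e0" if "e \<in> X - (M \<union> Bk)" for e
    unfolding e0(2)[symmetric] using fins that by (intro Max_ge) simp_all
  have "Phi (insert e0 M) (Bk \<union> S) \<le> Phi M Bk"
    if S: "S \<subseteq> X - (insert e0 M \<union> Bk)" "card S = b" for S
  proof -
    have finS: "finite S" using S finX finite_subset by blast
    have disj: "e0 \<notin> M \<union> Bk" "S \<inter> insert e0 M = {}" "S \<inter> Bk = {}" using S(1) e0(1) by auto
    have free': "e \<in> X - (M \<union> Bk)" if "e \<in> insert e0 S" for e using that S(1) e0(1) by auto
    have g: "goal_potential g (insert e0 M) (Bk \<union> S) \<le> goal_potential g M Bk - b * jg g e0 + (\<Sum>e\<in>S. jg g e)"
      if "g \<in> G" for g
      unfolding jg_def
    proof (rule goal_potential_round[OF finS disj S(2) fins(2)])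
      show "through g M Bk {e, e0} \<le> p\<^sup>2 * (tau g M e + tau g M e0)" if "e \<in> S" for e
        using second[OF \<open>g \<in> G\<close> free' e0(1)] that disj(2) by blast
      show "lam * through g M Bk {e} \<le> p / 4" if "e \<in> insert e0 S" for e
        by (rule first[OF \<open>g \<in> G\<close> free'[OF that]])
      show "lam * tau g M e \<le> 1 / 4" if "e \<in> insert e0 S" for e
        by (rule charge[OF \<open>g \<in> G\<close> free'[OF that]])
    qed
    have d: "deg_potential d (insert e0 M) (Bk \<union> S) \<le> deg_potential d M Bk - b * jd d e0 + (\<Sum>e\<in>S. jd d e)" for d
      unfolding jd_def by (rule deg_potential_round[OF finS disj(1,3) S(2) fins(2,1)])
    have h: "c h * set_weight q (insert e0 M) (Bk \<union> S) (B h)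
        \<le> c h * set_weight q M Bk (B h) - b * ju h e0 + (\<Sum>e\<in>S. ju h e)" if "h \<in> H" for h
    proof -
      let ?w = "set_weight q M Bk (B h)"
      have "c h * set_weight q (insert e0 M) (Bk \<union> S) (B h) \<le>
        c h * (?w + (1 / q - 1) * (if e0 \<in> B h then ?w else 0) - (\<Sum>e\<in>S. if e \<in> B h then ?w else 0) / R)"
        using nonneg(1) q(1,2) disj B[OF that] finS R by (intro mult_left_mono set_weight_round_upper) auto
      also have "\<dots> = c h * ?w - b * ju h e0 + (\<Sum>e\<in>S. ju h e)"
      proof -
        have "(\<Sum>e\<in>S. ju h e) = - c h * (\<Sum>e\<in>S. if e \<in> B h then ?w else 0) / R"
          unfolding ju_def sum_distrib_left sum_divide_distrib by (intro sum.cong) auto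
        then show ?thesis unfolding q(3) ju_def by (simp add: algebra_simps)
      qed
      finally show ?thesis .
    qed
    have "Phi (insert e0 M) (Bk \<union> S) \<le> (\<Sum>g\<in>G. goal_potential g M Bk - b * jg g e0 + (\<Sum>e\<in>S. jg g e))
       + (\<Sum>h\<in>H. c h * set_weight q M Bk (B h) - b * ju h e0 + (\<Sum>e\<in>S. ju h e))
       + (\<Sum>d\<in>D. deg_potential d M Bk - b * jd d e0 + (\<Sum>e\<in>S. jd d e))"
      unfolding Phi_def by (intro add_mono sum_mono g h d)
    also have "\<dots> = Phi M Bk - b * J e0 + (\<Sum>e\<in>S. J e)"
      unfolding Phi_def J_def
      by (simp add: sum.distrib sum_subtractf sum_distrib_left sum.swap[of _ S] algebra_simps)
    also have "(\<Sum>e\<in>S. J e) \<le> (\<Sum>e\<in>S. J e0)" using free' by (intro sum_mono max) simp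
    also have "\<dots> = b * J e0" using S(2) by simp
    finally show ?thesis by simp
  qed
  then show ?thesis using e0(1) by blast
qed

end

section \<open>Weighted walks\<close>

type_synonym colored_edge = "nat \<times> nat set"

text \<open>The entry at u, v of the product of the weighted adjacency matrices of the listed
  colours. Walks may repeat vertices and the diagonal is not excluded; this can only help in upper
  bounds on path counts.\<close>

primrec walk_sum :: "nat \<Rightarrow> (colored_edge \<Rightarrow> real) \<Rightarrow> nat list \<Rightarrow> nat \<Rightarrow> nat \<Rightarrow> real" where
  "walk_sum n f [] u v = (if u = v then 1 else 0)"
| "walk_sum n f (c # cs) u v = (\<Sum>w\<in>{1..n}. f (c, {u, w}) * walk_sum n f cs w v)"

definition walks :: "nat \<Rightarrow> nat \<Rightarrow> nat \<Rightarrow> nat \<Rightarrow> nat list set" where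
  "walks n k u v = {vs. length vs = Suc k \<and> set vs \<subseteq> {1..n} \<and> hd vs = u \<and> last vs = v}"

definition path_edges :: "nat list \<Rightarrow> nat list \<Rightarrow> colored_edge set" where
  "path_edges cs vs = (\<lambda>j. (cs ! j, {vs ! j, vs ! Suc j})) ` {..<length cs}"

lemma finite_path_edges [simp]: "finite (path_edges cs vs)"
  by (simp add: path_edges_def)

lemma card_path_edges: "distinct cs \<Longrightarrow> card (path_edges cs vs) = length cs"
  unfolding path_edges_def by (subst card_image) (auto simp: inj_on_def nth_eq_iff_index_eq)

lemma prod_path_edges:
  "distinct cs \<Longrightarrow> (\<Prod>e\<in>path_edges cs vs. f e) = (\<Prod>j<length cs. f (cs ! j, {vs ! j, vs ! Suc j}))"
  unfolding path_edges_def by (subst prod.reindex) (auto simp: inj_on_def nth_eq_iff_index_eq)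

lemma finite_walks [simp]: "finite (walks n k u v)"
  unfolding walks_def by (rule finite_subset[OF _ finite_lists_length_eq[of "{1..n}" "Suc k"]]) auto

lemma walks_0: "u \<in> {1..n} \<Longrightarrow> walks n 0 u v = (if u = v then {[u]} else {})"
  unfolding walks_def by (auto simp: length_Suc_conv)

lemma walks_Suc:
  assumes "u \<in> {1..n}"
  shows "bij_betw (\<lambda>(w, vs). u # vs) (SIGMA w:{1..n}. walks n k w v) (walks n (Suc k) u v)"
proof (rule bij_betw_byWitness[where f' = "\<lambda>vs. (hd (tl vs), tl vs)"])
  show "\<forall>x\<in>SIGMA w:{1..n}. walks n k w v. (hd (tl (case x of (w, vs) \<Rightarrow> u # vs)), tl (case x of (w, vs) \<Rightarrow> u # vs)) = x"
    by (auto simp: walks_def)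
  show "\<forall>vs\<in>walks n (Suc k) u v. (case (hd (tl vs), tl vs) of (w, vs) \<Rightarrow> u # vs) = vs"
    by (auto simp: walks_def length_Suc_conv)
  show "(\<lambda>(w, vs). u # vs) ` (SIGMA w:{1..n}. walks n k w v) \<subseteq> walks n (Suc k) u v"
    using assms by (auto simp: walks_def length_Suc_conv)
  show "(\<lambda>vs. (hd (tl vs), tl vs)) ` walks n (Suc k) u v \<subseteq> (SIGMA w:{1..n}. walks n k w v)"
    by (auto simp: walks_def length_Suc_conv)
qed

lemma walk_sum_eq_sum_walks:
  assumes "u \<in> {1..n}"
  shows "walk_sum n f cs u v =
    (\<Sum>vs\<in>walks n (length cs) u v. \<Prod>j<length cs. f (cs ! j, {vs ! j, vs ! Suc j}))"
  using assms
proof (induction cs arbitrary: u)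
  case Nil
  then show ?case by (simp add: walks_0)
next
  case (Cons c cs)
  let ?g = "\<lambda>vs. \<Prod>j<length cs. f (cs ! j, {vs ! j, vs ! Suc j})"
  have "walk_sum n f (c # cs) u v =
      (\<Sum>w\<in>{1..n}. \<Sum>vs\<in>walks n (length cs) w v. f (c, {u, w}) * ?g vs)"
    using Cons.IH by (simp add: sum_distrib_left)
  also have "\<dots> = (\<Sum>(w, vs)\<in>(SIGMA w:{1..n}. walks n (length cs) w v). f (c, {u, w}) * ?g vs)"
    by (subst sum.Sigma) auto
  also have "\<dots> = (\<Sum>x\<in>(SIGMA w:{1..n}. walks n (length cs) w v).
      \<Prod>j<length (c # cs). f ((c # cs) ! j, {(case x of (w, vs) \<Rightarrow> u # vs) ! j, (case x of (w, vs) \<Rightarrow> u # vs) ! Suc j}))"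
  proof (intro sum.cong refl)
    fix x assume "x \<in> (SIGMA w:{1..n}. walks n (length cs) w v)"
    then obtain w vs where x: "x = (w, vs)" "vs \<in> walks n (length cs) w v" by blast
    then have "vs ! 0 = w" unfolding walks_def by (cases vs) auto
    then show "(case x of (w, vs) \<Rightarrow> f (c, {u, w}) * ?g vs) =
      (\<Prod>j<length (c # cs). f ((c # cs) ! j, {(case x of (w, vs) \<Rightarrow> u # vs) ! j, (case x of (w, vs) \<Rightarrow> u # vs) ! Suc j}))"
      unfolding x(1) by (simp del: prod.lessThan_Suc add: prod.lessThan_Suc_shift)
  qed
  also have "\<dots> = (\<Sum>vs\<in>walks n (Suc (length cs)) u v. \<Prod>j<length (c # cs). f ((c # cs) ! j, {vs ! j, vs ! Suc j}))"
    by (rule sum.reindex_bij_betw[OF walks_Suc[OF Cons.prems]])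
  finally show ?case by simp
qed

lemma walk_sum_nonneg: "(\<And>e. f e \<ge> 0) \<Longrightarrow> walk_sum n f cs u v \<ge> 0"
  by (induction cs arbitrary: u) (auto intro!: sum_nonneg)

lemma walk_sum_mono: "(\<And>e. 0 \<le> f e) \<Longrightarrow> (\<And>e. f e \<le> g e) \<Longrightarrow> walk_sum n f cs u v \<le> walk_sum n g cs u v"
proof (induction cs arbitrary: u)
  case (Cons c cs)
  have "0 \<le> g e" for e using Cons.prems order_trans by blast
  then show ?case using Cons by (auto intro!: sum_mono mult_mono walk_sum_nonneg)
qed simp

lemma walk_sum_append:
  "u \<in> {1..n} \<Longrightarrow> walk_sum n f (cs @ ds) u v = (\<Sum>w\<in>{1..n}. walk_sum n f cs u w * walk_sum n f ds w v)"
proof (induction cs arbitrary: u)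
  case Nil
  have "(if u = w then 1 else 0) * walk_sum n f ds w v = (if u = w then walk_sum n f ds u v else 0)" for w
    by simp
  then show ?case using Nil by simp
next
  case (Cons c cs)
  have "walk_sum n f ((c # cs) @ ds) u v
      = (\<Sum>w'\<in>{1..n}. \<Sum>w\<in>{1..n}. f (c, {u, w'}) * walk_sum n f cs w' w * walk_sum n f ds w v)"
    using Cons.IH by (simp add: sum_distrib_left mult.assoc)
  also have "\<dots> = (\<Sum>w\<in>{1..n}. \<Sum>w'\<in>{1..n}. f (c, {u, w'}) * walk_sum n f cs w' w * walk_sum n f ds w v)"
    by (rule sum.swap)
  finally show ?case by (simp add: sum_distrib_right)
qed

lemma walk_sum_row:
  assumes f: "\<And>e. f e \<ge> 0" and d: "\<And>c u. c \<in> set cs \<Longrightarrow> u \<in> {1..n} \<Longrightarrow> (\<Sum>w\<in>{1..n}. f (c, {u, w})) \<le> d"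
    and u: "u \<in> {1..n}"
  shows "(\<Sum>v\<in>{1..n}. walk_sum n f cs u v) \<le> d ^ length cs"
  using d u
proof (induction cs arbitrary: u)
  case Nil
  then show ?case by simp
next
  case (Cons c cs)
  have "0 \<le> (\<Sum>w\<in>{1..n}. f (c, {u, w}))" by (intro sum_nonneg f)
  then have d0: "0 \<le> d" using Cons.prems(1)[of c u] Cons.prems(2) by simp
  have "(\<Sum>v\<in>{1..n}. walk_sum n f (c # cs) u v) = (\<Sum>w\<in>{1..n}. f (c, {u, w}) * (\<Sum>v\<in>{1..n}. walk_sum n f cs w v))"
    by (simp add: sum_distrib_left) (rule sum.swap)
  also have "\<dots> \<le> (\<Sum>w\<in>{1..n}. f (c, {u, w}) * d ^ length cs)"
    by (intro sum_mono mult_left_mono Cons.IH f Cons.prems(1)) simp_all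
  also have "\<dots> = (\<Sum>w\<in>{1..n}. f (c, {u, w})) * d ^ length cs" by (simp add: sum_distrib_right)
  also have "\<dots> \<le> d * d ^ length cs"
    using d0 Cons.prems(2) by (intro mult_right_mono Cons.prems(1)) simp_all
  finally show ?case by simp
qed

text \<open>Edges are unordered, so each factor of the matrix product is symmetric and the bound on
  its row sums is also one on its column sums.\<close>

lemma walk_sum_column:
  assumes f: "\<And>e. f e \<ge> 0" and d: "\<And>c u. c \<in> set cs \<Longrightarrow> u \<in> {1..n} \<Longrightarrow> (\<Sum>w\<in>{1..n}. f (c, {u, w})) \<le> d"
    and v: "v \<in> {1..n}"
  shows "(\<Sum>u\<in>{1..n}. walk_sum n f cs u v) \<le> d ^ length cs"
  using d
proof (induction cs)
  case Nil
  then show ?case using v by simp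
next
  case (Cons c cs)
  have "0 \<le> (\<Sum>w\<in>{1..n}. f (c, {v, w}))" by (intro sum_nonneg f)
  then have d0: "0 \<le> d" using Cons.prems[of c v] v by simp
  have "(\<Sum>u\<in>{1..n}. walk_sum n f (c # cs) u v) = (\<Sum>w\<in>{1..n}. (\<Sum>u\<in>{1..n}. f (c, {w, u})) * walk_sum n f cs w v)"
    unfolding walk_sum.simps by (subst sum.swap) (simp add: sum_distrib_right insert_commute)
  also have "\<dots> \<le> (\<Sum>w\<in>{1..n}. d * walk_sum n f cs w v)"
    using f Cons.prems by (intro sum_mono mult_right_mono walk_sum_nonneg) auto
  also have "\<dots> = d * (\<Sum>w\<in>{1..n}. walk_sum n f cs w v)" by (simp add: sum_distrib_left)
  also have "\<dots> \<le> d * d ^ length cs"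
    using d0 by (intro mult_left_mono Cons.IH Cons.prems) simp_all
  finally show ?case by simp
qed

text \<open>Walks through the edges of E, one colour at a time: the colours on a walk are distinct, so a walk
  contains E iff it uses no other edge of these colours.\<close>

definition restrict_weight :: "colored_edge set \<Rightarrow> (colored_edge \<Rightarrow> real) \<Rightarrow> colored_edge \<Rightarrow> real" where
  "restrict_weight E f e = (if \<exists>e'\<in>E. fst e' = fst e \<and> e' \<noteq> e then 0 else f e)"

lemma restrict_weight_bounds:
  assumes "\<And>e. f e \<ge> 0"
  shows "0 \<le> restrict_weight E f e" "restrict_weight E f e \<le> f e"
  using assms by (simp_all add: restrict_weight_def)

lemma sum_walks_through_le:
  assumes f: "\<And>e. f e \<ge> 0" and P: "P \<subseteq> walks n (length cs) u v" and u: "u \<in> {1..n}" and cs: "distinct cs"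
  shows "(\<Sum>vs\<in>P. if E \<subseteq> path_edges cs vs then \<Prod>e\<in>path_edges cs vs. f e else 0)
    \<le> walk_sum n (restrict_weight E f) cs u v"
proof -
  let ?f = "restrict_weight E f"
  have f0: "0 \<le> ?f e" for e by (rule restrict_weight_bounds[OF f])
  have "(\<Sum>vs\<in>P. if E \<subseteq> path_edges cs vs then \<Prod>e\<in>path_edges cs vs. f e else 0)
      \<le> (\<Sum>vs\<in>P. \<Prod>e\<in>path_edges cs vs. ?f e)"
  proof (intro sum_mono)
    fix vs
    show "(if E \<subseteq> path_edges cs vs then \<Prod>e\<in>path_edges cs vs. f e else 0) \<le> (\<Prod>e\<in>path_edges cs vs. ?f e)"
    proof (cases "E \<subseteq> path_edges cs vs")
      case True
      have same: "e = e'" if "e \<in> path_edges cs vs" "e' \<in> E" "fst e = fst e'" for e e'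
        using that True cs unfolding path_edges_def by (auto simp: nth_eq_iff_index_eq)
      have "?f e = f e" if "e \<in> path_edges cs vs" for e
        using same[OF that] unfolding restrict_weight_def by (metis (full_types))
      then have "(\<Prod>e\<in>path_edges cs vs. f e) = (\<Prod>e\<in>path_edges cs vs. ?f e)"
        by (intro prod.cong) simp_all
      then show ?thesis using True by simp
    qed (auto intro: prod_nonneg f0)
  qed
  also have "\<dots> \<le> (\<Sum>vs\<in>walks n (length cs) u v. \<Prod>e\<in>path_edges cs vs. ?f e)"
    by (rule sum_mono2) (use P f0 in \<open>auto intro: prod_nonneg\<close>)
  also have "\<dots> = walk_sum n ?f cs u v"
    unfolding walk_sum_eq_sum_walks[OF u] prod_path_edges[OF cs] ..
  finally show ?thesis .
qed

text \<open>In colour c only the edge between t and t' survives the restriction; the two summands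
  are the two directions in which a walk can pass it.\<close>

lemma walk_sum_restrict_split:
  assumes f: "\<And>e. f e \<ge> 0" and e: "(c, {t, t'}) \<in> E" "t \<noteq> t'" "t \<in> {1..n}" "t' \<in> {1..n}" and u: "u \<in> {1..n}"
  defines "g \<equiv> restrict_weight E f"
  shows "walk_sum n g (cs @ c # ds) u v \<le> f (c, {t, t'}) *
    (walk_sum n g cs u t * walk_sum n g ds t' v + walk_sum n g cs u t' * walk_sum n g ds t v)"
proof -
  have g: "0 \<le> g e" "g e \<le> f e" for e unfolding g_def by (rule restrict_weight_bounds[OF f])+
  have g0: "g (c, {w, w'}) = 0" if "{w, w'} \<noteq> {t, t'}" for w w'
    unfolding g_def restrict_weight_def using e(1) that by (auto intro!: bexI[of _ "(c, {t, t'})"])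
  have ws: "0 \<le> walk_sum n g xs a b" for xs a b using g by (intro walk_sum_nonneg) auto
  have inner: "(\<Sum>w'\<in>{1..n}. g (c, {w, w'}) * walk_sum n g ds w' v) =
     (if w = t then g (c, {t, t'}) * walk_sum n g ds t' v else if w = t' then g (c, {t, t'}) * walk_sum n g ds t v else 0)"
    for w
  proof -
    consider "w = t" | "w = t'" "w \<noteq> t" | "w \<noteq> t" "w \<noteq> t'" by blast
    then show ?thesis
    proof cases
      case 1
      have "(\<Sum>w'\<in>{1..n}. g (c, {w, w'}) * walk_sum n g ds w' v) =
        (\<Sum>w'\<in>{1..n}. if w' = t' then g (c, {t, t'}) * walk_sum n g ds t' v else 0)"
        using 1 g0 e(2) by (intro sum.cong) (auto simp: doubleton_eq_iff)
      then show ?thesis using 1 e by simp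
    next
      case 2
      have "(\<Sum>w'\<in>{1..n}. g (c, {w, w'}) * walk_sum n g ds w' v) =
        (\<Sum>w'\<in>{1..n}. if w' = t then g (c, {t, t'}) * walk_sum n g ds t v else 0)"
        using 2 g0 e(2) by (intro sum.cong) (auto simp: doubleton_eq_iff insert_commute)
      then show ?thesis using 2 e by simp
    next
      case 3
      have "(\<Sum>w'\<in>{1..n}. g (c, {w, w'}) * walk_sum n g ds w' v) = 0"
        using 3 g0 by (intro sum.neutral) (auto simp: doubleton_eq_iff)
      then show ?thesis using 3 by simp
    qed
  qed
  have "walk_sum n g (cs @ c # ds) u v = (\<Sum>w\<in>{1..n}. walk_sum n g cs u w *
     (if w = t then g (c, {t, t'}) * walk_sum n g ds t' v else if w = t' then g (c, {t, t'}) * walk_sum n g ds t v else 0))"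
    unfolding walk_sum_append[OF u] walk_sum.simps inner ..
  also have "\<dots> = (\<Sum>w\<in>{t, t'}. walk_sum n g cs u w *
     (if w = t then g (c, {t, t'}) * walk_sum n g ds t' v else if w = t' then g (c, {t, t'}) * walk_sum n g ds t v else 0))"
    using e by (intro sum.mono_neutral_right) auto
  also have "\<dots> = g (c, {t, t'}) *
    (walk_sum n g cs u t * walk_sum n g ds t' v + walk_sum n g cs u t' * walk_sum n g ds t v)"
    using e(2) by (simp add: algebra_simps)
  also have "\<dots> \<le> f (c, {t, t'}) *
    (walk_sum n g cs u t * walk_sum n g ds t' v + walk_sum n g cs u t' * walk_sum n g ds t v)"
    using g ws by (intro mult_right_mono) auto
  finally show ?thesis .
qed

lemma walk_sum_restrict_one:
  assumes f: "\<And>e. f e \<ge> 0" and e: "(c, {t, t'}) \<in> E" "t \<noteq> t'" "t \<in> {1..n}" "t' \<in> {1..n}"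
    and u: "u \<in> {1..n}"
  shows "walk_sum n (restrict_weight E f) (cs @ c # ds) u v \<le> f (c, {t, t'}) *
    (walk_sum n f cs u t * walk_sum n f ds t' v + walk_sum n f cs u t' * walk_sum n f ds t v)"
proof -
  let ?g = "restrict_weight E f"
  have g: "0 \<le> ?g e" "?g e \<le> f e" for e by (rule restrict_weight_bounds[OF f])+
  have ws: "walk_sum n ?g xs a b \<le> walk_sum n f xs a b" "0 \<le> walk_sum n ?g xs a b" "0 \<le> walk_sum n f xs a b"
    for xs a b using g f by (auto intro: walk_sum_nonneg walk_sum_mono)
  show ?thesis
    by (rule order_trans[OF walk_sum_restrict_split[OF f e u]])
       (intro mult_left_mono add_mono mult_mono ws f)
qed

lemma walk_sum_restrict_two:
  assumes f: "\<And>e. f e \<ge> 0"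
    and e: "(c, {t, t'}) \<in> E" "t \<noteq> t'" "t \<in> {1..n}" "t' \<in> {1..n}"
    and e': "(d, {r, r'}) \<in> E" "r \<noteq> r'" "r \<in> {1..n}" "r' \<in> {1..n}"
    and u: "u \<in> {1..n}"
  defines "W \<equiv> walk_sum n f"
  shows "walk_sum n (restrict_weight E f) (cs @ c # ds @ d # es) u v \<le> f (c, {t, t'}) * f (d, {r, r'}) *
    (W cs u t * (W ds t' r * W es r' v + W ds t' r' * W es r v) +
     W cs u t' * (W ds t r * W es r' v + W ds t r' * W es r v))"
proof -
  let ?g = "restrict_weight E f"
  have g: "0 \<le> ?g e" "?g e \<le> f e" for e by (rule restrict_weight_bounds[OF f])+
  have ws: "walk_sum n ?g xs a b \<le> W xs a b" "0 \<le> walk_sum n ?g xs a b" "0 \<le> W xs a b"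
    for xs a b unfolding W_def using g f by (auto intro: walk_sum_nonneg walk_sum_mono)
  have tail: "walk_sum n ?g (ds @ d # es) w v \<le> f (d, {r, r'}) * (W ds w r * W es r' v + W ds w r' * W es r v)"
    if "w \<in> {1..n}" for w
    unfolding W_def by (rule walk_sum_restrict_one[OF f e' that])
  have "walk_sum n ?g (cs @ c # ds @ d # es) u v \<le> f (c, {t, t'}) *
      (walk_sum n ?g cs u t * walk_sum n ?g (ds @ d # es) t' v + walk_sum n ?g cs u t' * walk_sum n ?g (ds @ d # es) t v)"
    by (rule walk_sum_restrict_split[OF f e u])
  also have "\<dots> \<le> f (c, {t, t'}) *
      (W cs u t * (f (d, {r, r'}) * (W ds t' r * W es r' v + W ds t' r' * W es r v)) +
       W cs u t' * (f (d, {r, r'}) * (W ds t r * W es r' v + W ds t r' * W es r v)))"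
    by (intro mult_left_mono add_mono mult_mono ws f tail e)
  also have "\<dots> = f (c, {t, t'}) * f (d, {r, r'}) *
    (W cs u t * (W ds t' r * W es r' v + W ds t' r' * W es r v) +
     W cs u t' * (W ds t r * W es r' v + W ds t r' * W es r v))"
    by (simp add: algebra_simps)
  finally show ?thesis .
qed

lemma sum_star_indicator:
  assumes M: "M \<subseteq> rc_board s n"
  shows "(\<Sum>w\<in>{1..n}. elem_weight 0 M {} (c, {u, w})) \<le> real (card (M \<inter> {e. fst e = c \<and> u \<in> snd e}))"
proof -
  have "(\<Sum>w\<in>{1..n}. elem_weight 0 M {} (c, {u, w})) = real (card {w\<in>{1..n}. (c, {u, w}) \<in> M})"
    by (simp add: elem_weight_def sum.If_cases Int_def)
  also have "card {w\<in>{1..n}. (c, {u, w}) \<in> M} \<le> card (M \<inter> {e. fst e = c \<and> u \<in> snd e})"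
  proof (rule card_inj_on_le)
    show "inj_on (\<lambda>w. (c, {u, w})) {w\<in>{1..n}. (c, {u, w}) \<in> M}"
      by (auto simp: inj_on_def doubleton_eq_iff)
    show "finite (M \<inter> {e. fst e = c \<and> u \<in> snd e})"
      using finite_subset[OF M finite_rc_board] by simp
  qed auto
  finally show ?thesis by simp
qed

lemma elem_weight_le: "0 \<le> p \<Longrightarrow> elem_weight p M {} e \<le> elem_weight 0 M {} e + p"
  by (simp add: elem_weight_def)

lemma sum_star_weight:
  assumes "M \<subseteq> rc_board s n" "0 \<le> p" "real (card (M \<inter> {e. fst e = c \<and> u \<in> snd e})) \<le> d"
  shows "(\<Sum>w\<in>{1..n}. elem_weight p M {} (c, {u, w})) \<le> d + n * p"
proof -
  have "(\<Sum>w\<in>{1..n}. elem_weight p M {} (c, {u, w})) \<le> (\<Sum>w\<in>{1..n}. elem_weight 0 M {} (c, {u, w}) + p)"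
    by (intro sum_mono elem_weight_le assms)
  also have "\<dots> = (\<Sum>w\<in>{1..n}. elem_weight 0 M {} (c, {u, w})) + n * p" by (simp add: sum.distrib)
  finally show ?thesis using sum_star_indicator[OF assms(1), of c u] assms(3) by linarith
qed

section \<open>Counting walks in Maker's graph\<close>

definition maker_walks :: "nat \<Rightarrow> colored_edge set \<Rightarrow> nat list \<Rightarrow> nat \<Rightarrow> nat \<Rightarrow> nat list set" where
  "maker_walks n M ds u v = {vs \<in> walks n (length ds) u v. path_edges ds vs \<subseteq> M}"

abbreviation edge_disjoint :: "nat list \<Rightarrow> nat list set \<Rightarrow> bool" where
  "edge_disjoint ds \<equiv> pairwise (\<lambda>vs vs'. path_edges ds vs \<inter> path_edges ds vs' = {})"

lemma finite_maker_walks [simp]: "finite (maker_walks n M ds u v)"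
  by (simp add: maker_walks_def)

lemma prod_indicator: "finite A \<Longrightarrow> (\<Prod>e\<in>A. elem_weight 0 M {} e) = (if A \<subseteq> M then 1 else 0)"
  by (auto simp: elem_weight_def intro!: prod.neutral prod_zero)

lemma card_maker_walks:
  assumes "u \<in> {1..n}" "distinct ds"
  shows "real (card (maker_walks n M ds u v)) = walk_sum n (elem_weight 0 M {}) ds u v"
  unfolding walk_sum_eq_sum_walks[OF assms(1)] prod_path_edges[OF assms(2), symmetric] maker_walks_def
  by (simp add: prod_indicator sum.If_cases Int_def)

text \<open>Each Maker walk from u to v meets a maximal disjoint family, and few walks pass through a given
  edge.\<close>

lemma walk_sum_le_of_disjoint_families:
  assumes M: "M \<subseteq> rc_board s n" and uv: "u \<in> {1..n}" and ds: "distinct ds" "ds \<noteq> []"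
    and N: "\<And>P. P \<subseteq> maker_walks n M ds u v \<Longrightarrow>
        edge_disjoint ds P \<Longrightarrow> real (card P) \<le> N"
    and Y: "\<And>i a a'. i < length ds \<Longrightarrow> a \<in> {1..n} \<Longrightarrow> a' \<in> {1..n} \<Longrightarrow>
        walk_sum n (elem_weight 0 M {}) (take i ds) u a * walk_sum n (elem_weight 0 M {}) (drop (Suc i) ds) a' v \<le> Y"
  shows "walk_sum n (elem_weight 0 M {}) ds u v \<le> N * length ds * (2 * Y)"
proof -
  let ?f = "elem_weight 0 M {}" and ?W = "maker_walks n M ds u v" and ?E = "path_edges ds"
  let ?dis = "edge_disjoint ds"
  have f: "?f e \<ge> 0" for e by (simp add: elem_weight_def)
  have "0 \<le> walk_sum n ?f (take 0 ds) u u * walk_sum n ?f (drop (Suc 0) ds) u v"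
    by (intro mult_nonneg_nonneg walk_sum_nonneg f)
  also have "\<dots> \<le> Y" using ds(2) uv by (intro Y) auto
  finally have Y0: "0 \<le> Y" .
  obtain P where P: "P \<subseteq> ?W" "?dis P" and max: "\<And>P'. P' \<subseteq> ?W \<Longrightarrow> ?dis P' \<Longrightarrow> card P' \<le> card P"
  proof -
    let ?F = "{P. P \<subseteq> ?W \<and> ?dis P}"
    have "finite ?F" by (rule finite_subset[of _ "Pow ?W"]) auto
    moreover have "{} \<in> ?F" by (simp add: pairwise_empty)
    ultimately have "Max (card ` ?F) \<in> card ` ?F" by (intro Max_in) auto
    then obtain P where "P \<in> ?F" "Max (card ` ?F) = card P" by (elim imageE)
    then show ?thesis using \<open>finite ?F\<close> that[of P] by (metis (no_types, lifting) Max_ge finite_imageI imageI mem_Collect_eq)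
  qed
  have finP: "finite P" using P(1) by (rule finite_subset) simp
  have cover: "?W \<subseteq> (\<Union>e\<in>\<Union> (?E ` P). {vs \<in> ?W. e \<in> ?E vs})"
  proof
    fix vs assume vs: "vs \<in> ?W"
    have ne: "?E vs \<noteq> {}" using ds(2) by (simp add: path_edges_def lessThan_empty_iff)
    have "\<exists>vs'\<in>P. ?E vs \<inter> ?E vs' \<noteq> {}"
    proof (rule ccontr)
      assume no: "\<not> ?thesis"
      then have "vs \<notin> P" using ne by auto
      have "?dis (insert vs P)" using P(2) no by (auto simp: pairwise_insert)
      moreover have "insert vs P \<subseteq> ?W" using vs P(1) by simp
      ultimately have "card (insert vs P) \<le> card P" by (intro max)
      then show False using card_insert_disjoint[OF finP \<open>vs \<notin> P\<close>] by linarith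
    qed
    then show "vs \<in> (\<Union>e\<in>\<Union> (?E ` P). {vs \<in> ?W. e \<in> ?E vs})" using vs by blast
  qed
  \<comment> \<open>Y bounds the choices before the edge times those after it; the 2 stands for the
    direction in which it is passed.\<close>
  have thr: "real (card {vs \<in> ?W. e \<in> ?E vs}) \<le> 2 * Y" if e0: "e \<in> ?E vs0" and vs0: "vs0 \<in> ?W" for e vs0
  proof -
    obtain i where i: "i < length ds" "e = (ds ! i, {vs0 ! i, vs0 ! Suc i})"
      using e0 unfolding path_edges_def by auto
    have "e \<in> rc_board s n" using e0 vs0 M unfolding maker_walks_def by auto
    then obtain c t t' where e: "e = (c, {t, t'})" "t \<in> {1..n}" "t' \<in> {1..n}" "t \<noteq> t'"
      by (rule rc_boardE)
    have c: "c = ds ! i" using i e by simp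
    have split: "ds = take i ds @ c # drop (Suc i) ds" unfolding c by (rule id_take_nth_drop[OF i(1)])
    have "real (card {vs \<in> ?W. e \<in> ?E vs}) = (\<Sum>vs\<in>walks n (length ds) u v. if {e} \<subseteq> ?E vs then \<Prod>e\<in>?E vs. ?f e else 0)"
    proof -
      have "(\<Sum>vs\<in>walks n (length ds) u v. if {e} \<subseteq> ?E vs then \<Prod>e\<in>?E vs. ?f e else 0)
          = (\<Sum>vs\<in>walks n (length ds) u v. if vs \<in> {vs \<in> ?W. e \<in> ?E vs} then 1 else 0)"
        by (intro sum.cong) (auto simp: prod_indicator maker_walks_def)
      also have "\<dots> = real (card (walks n (length ds) u v \<inter> {vs \<in> ?W. e \<in> ?E vs}))"
        by (subst sum.If_cases) auto
      also have "walks n (length ds) u v \<inter> {vs \<in> ?W. e \<in> ?E vs} = {vs \<in> ?W. e \<in> ?E vs}"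
        unfolding maker_walks_def by blast
      finally show ?thesis ..
    qed
    also have "\<dots> \<le> walk_sum n (restrict_weight {e} ?f) ds u v"
      by (rule sum_walks_through_le[OF f order_refl uv ds(1)])
    also have "\<dots> \<le> ?f (c, {t, t'}) *
        (walk_sum n ?f (take i ds) u t * walk_sum n ?f (drop (Suc i) ds) t' v +
         walk_sum n ?f (take i ds) u t' * walk_sum n ?f (drop (Suc i) ds) t v)"
      by (subst (1) split) (rule walk_sum_restrict_one[OF f _ e(4,2,3) uv], simp add: e(1))
    also have "\<dots> \<le> 1 * (Y + Y)"
      using Y[OF i(1)] e Y0 f by (intro mult_mono add_mono add_nonneg_nonneg mult_nonneg_nonneg walk_sum_nonneg)
        (auto simp: elem_weight_def)
    finally show ?thesis by simp
  qed
  have "real (card ?W) \<le> real (card (\<Union>e\<in>\<Union> (?E ` P). {vs \<in> ?W. e \<in> ?E vs}))"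
    using cover finP by (intro of_nat_mono card_mono) auto
  also have "\<dots> \<le> real (\<Sum>e\<in>\<Union> (?E ` P). card {vs \<in> ?W. e \<in> ?E vs})"
    using finP by (intro of_nat_mono card_UN_le) auto
  also have "\<dots> = (\<Sum>e\<in>\<Union> (?E ` P). real (card {vs \<in> ?W. e \<in> ?E vs}))" by simp
  also have "\<dots> \<le> (\<Sum>e\<in>\<Union> (?E ` P). 2 * Y)" using thr P(1) by (intro sum_mono) auto
  also have "\<dots> = real (card (\<Union> (?E ` P))) * (2 * Y)" by simp
  also have "\<dots> \<le> (real (card P) * length ds) * (2 * Y)"
  proof (intro mult_right_mono)
    have "card (\<Union> (?E ` P)) \<le> (\<Sum>vs\<in>P. card (?E vs))" by (rule card_UN_le[OF finP])
    also have "\<dots> = card P * length ds" using ds(1) by (simp add: card_path_edges)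
    finally show "real (card (\<Union> (?E ` P))) \<le> real (card P) * length ds" by (metis of_nat_le_iff of_nat_mult)
  qed (use Y0 in simp)
  also have "\<dots> \<le> (N * length ds) * (2 * Y)"
    using N[OF P] Y0 by (intro mult_right_mono) auto
  finally show ?thesis unfolding card_maker_walks[OF uv ds(1)] .
qed

text \<open>The first summand is the cost of passing to a maximal disjoint family, the second the
  cost of one more step along degrees at most \<open>3 * D\<close>; the sum serves both cases of
  \<open>maker_walk_bound\<close>.\<close>

primrec walk_const :: "nat \<Rightarrow> nat \<Rightarrow> real" where
  "walk_const r 0 = 1"
| "walk_const r (Suc k) = 2 * r * (k + 1) * (walk_const r k)\<^sup>2 + 3 * walk_const r k"

lemma walk_const_ge_1: "walk_const r k \<ge> 1"
proof (induction k)
  case (Suc k)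
  have "0 \<le> 2 * real r * (real k + 1) * (walk_const r k)\<^sup>2" by simp
  with Suc show ?case unfolding walk_const.simps by linarith
qed simp

lemma walk_const_mono: "i \<le> j \<Longrightarrow> walk_const r i \<le> walk_const r j"
proof (rule lift_Suc_mono_le[of "walk_const r"])
  show "walk_const r k \<le> walk_const r (Suc k)" for k
    using walk_const_ge_1[of r k] by (auto intro: add_increasing)
qed

text \<open>Let k be the length minus one. If \<open>D ^ k * \<alpha> \<le> 1\<close>, all shorter
  walk counts are constant, so few walks share an edge and the bound on disjoint families suffices.
  Otherwise the bound for k is already proportional to \<open>D ^ k\<close>, and prepending an edge
  multiplies it by the degree.\<close>

lemma maker_walk_bound:
  fixes \<alpha> D :: real
  assumes M: "M \<subseteq> rc_board s n" and D: "D \<ge> 1" "\<alpha> \<ge> 0"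
    and deg: "\<And>c u. c \<in> {1..s} \<Longrightarrow> u \<in> {1..n} \<Longrightarrow> real (card (M \<inter> {e. fst e = c \<and> u \<in> snd e})) \<le> 3 * D"
    and N: "\<And>u v ds P. u \<in> {1..n} \<Longrightarrow> v \<in> {1..n} \<Longrightarrow> distinct ds \<Longrightarrow> set ds \<subseteq> {1..s} \<Longrightarrow> ds \<noteq> [] \<Longrightarrow>
        P \<subseteq> maker_walks n M ds u v \<Longrightarrow>
        edge_disjoint ds P \<Longrightarrow>
        real (card P) \<le> r * max 1 (D ^ length ds * \<alpha>)"
  shows "u \<in> {1..n} \<Longrightarrow> v \<in> {1..n} \<Longrightarrow> distinct ds \<Longrightarrow> set ds \<subseteq> {1..s} \<Longrightarrow>
    walk_sum n (elem_weight 0 M {}) ds u v \<le> walk_const r (length ds) * max 1 (D ^ length ds * \<alpha>)"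
proof (induction "length ds" arbitrary: ds u v rule: less_induct)
  case less
  let ?W = "walk_sum n (elem_weight 0 M {})" and ?B = "\<lambda>k. max 1 (D ^ k * \<alpha>)"
  have f: "elem_weight 0 M {} e \<ge> 0" for e by (simp add: elem_weight_def)
  show ?case
  proof (cases ds)
    case Nil
    then show ?thesis by (auto simp: le_max_iff_disj)
  next
    case (Cons c ds')
    let ?k = "length ds'"
    let ?K = "walk_const r ?k"
    have K: "?K \<ge> 1" by (rule walk_const_ge_1)
    show ?thesis
    proof (cases "D ^ ?k * \<alpha> \<le> 1")
      case True
      have B1: "?B j = 1" if "j \<le> ?k" for j
      proof -
        have "D ^ j * \<alpha> \<le> D ^ ?k * \<alpha>" using D that by (intro mult_right_mono power_increasing) auto
        then show ?thesis using True by simp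
      qed
      have IH: "?W es a a' \<le> ?K" if "length es \<le> ?k" "a \<in> {1..n}" "a' \<in> {1..n}" "distinct es" "set es \<subseteq> {1..s}" for es a a'
      proof -
        have "?W es a a' \<le> walk_const r (length es) * ?B (length es)"
          using that Cons by (intro less.hyps) auto
        also have "\<dots> \<le> ?K" using B1[OF that(1)] walk_const_mono[OF that(1), of r] by simp
        finally show ?thesis .
      qed
      have "?W ds u v \<le> (r * ?B (length ds)) * length ds * (2 * (?K * ?K))"
      proof (rule walk_sum_le_of_disjoint_families[OF M less.prems(1,3)])
        show "ds \<noteq> []" using Cons by simp
        show "real (card P) \<le> r * ?B (length ds)" if "P \<subseteq> maker_walks n M ds u v"
          "edge_disjoint ds P" for P
          using that Cons less.prems by (intro N) auto
        show "?W (take i ds) u a * ?W (drop (Suc i) ds) a' v \<le> ?K * ?K"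
          if "i < length ds" "a \<in> {1..n}" "a' \<in> {1..n}" for i a a'
        proof (intro mult_mono)
          show "?W (take i ds) u a \<le> ?K"
            using that Cons less.prems set_take_subset[of i ds] by (intro IH) auto
          show "?W (drop (Suc i) ds) a' v \<le> ?K"
            using that Cons less.prems set_drop_subset[of "Suc i" ds] by (intro IH) auto
        qed (use K f in \<open>auto intro: walk_sum_nonneg\<close>)
      qed
      also have "\<dots> = 2 * r * (?k + 1) * ?K\<^sup>2 * ?B (length ds)"
        using Cons by (simp add: power2_eq_square algebra_simps)
      also have "\<dots> \<le> walk_const r (length ds) * ?B (length ds)"
        using Cons K by (intro mult_right_mono) (auto simp: algebra_simps)
      finally show ?thesis .
    next
      case False
      then have B: "?B ?k = D ^ ?k * \<alpha>" by simp
      have "?W ds u v = (\<Sum>w\<in>{1..n}. elem_weight 0 M {} (c, {u, w}) * ?W ds' w v)" using Cons by simp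
      also have "\<dots> \<le> (\<Sum>w\<in>{1..n}. elem_weight 0 M {} (c, {u, w}) * (?K * ?B ?k))"
        using less.prems Cons f by (intro sum_mono mult_left_mono less.hyps) auto
      also have "\<dots> = (\<Sum>w\<in>{1..n}. elem_weight 0 M {} (c, {u, w})) * (?K * ?B ?k)"
        by (simp add: sum_distrib_right)
      also have "\<dots> \<le> (3 * D) * (?K * ?B ?k)"
        using sum_star_indicator[OF M, of c u] deg[of c u] less.prems Cons K
        by (intro mult_right_mono) auto
      also have "\<dots> = 3 * ?K * (D ^ length ds * \<alpha>)" unfolding B using Cons by simp
      also have "\<dots> \<le> walk_const r (length ds) * ?B (length ds)"
        using Cons K D by (intro mult_mono) auto
      finally show ?thesis .
    qed
  qed
qed

text \<open>A walk is determined by its first edge outside M and the two pieces around it, so giving weight p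
  to the edges outside M costs at most the expected number of walks.\<close>

lemma weighted_walk_bound:
  fixes p D :: real
  assumes M: "M \<subseteq> rc_board s n" and p: "0 \<le> p" "n * p \<le> D"
    and deg: "\<And>c u. c \<in> {1..s} \<Longrightarrow> u \<in> {1..n} \<Longrightarrow> real (card (M \<inter> {e. fst e = c \<and> u \<in> snd e})) \<le> 3 * D"
  shows "u \<in> {1..n} \<Longrightarrow> v \<in> {1..n} \<Longrightarrow> set ds \<subseteq> {1..s} \<Longrightarrow>
    walk_sum n (elem_weight p M {}) ds u v
      \<le> walk_sum n (elem_weight 0 M {}) ds u v + length ds * p * (4 * D) ^ (length ds - 1)"
proof (induction ds arbitrary: u)
  case Nil
  then show ?case by simp
next
  case (Cons c ds)
  let ?f = "elem_weight p M {}" and ?g = "elem_weight 0 M {}" and ?k = "length ds"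
  have f: "?f e \<ge> 0" "?g e \<ge> 0" for e using p by (simp_all add: elem_weight_def)
  have D: "0 \<le> D" using p by (intro order_trans[OF _ p(2)]) simp
  have cf: "(\<Sum>w\<in>{1..n}. ?f (c, {u, w})) \<le> 4 * D" if "c \<in> {1..s}" "u \<in> {1..n}" for c u
    using sum_star_weight[OF M p(1) deg[OF that]] p(2) by simp
  have "walk_sum n ?f (c # ds) u v \<le> (\<Sum>w\<in>{1..n}. (?g (c, {u, w}) + p) * walk_sum n ?f ds w v)"
    using f p(1) by (auto intro!: sum_mono mult_right_mono walk_sum_nonneg elem_weight_le)
  also have "\<dots> = (\<Sum>w\<in>{1..n}. ?g (c, {u, w}) * walk_sum n ?f ds w v) + p * (\<Sum>w\<in>{1..n}. walk_sum n ?f ds w v)"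
    by (simp add: algebra_simps sum.distrib sum_distrib_left)
  also have "\<dots> \<le> (\<Sum>w\<in>{1..n}. ?g (c, {u, w}) * (walk_sum n ?g ds w v + ?k * p * (4 * D) ^ (?k - 1)))
      + p * (4 * D) ^ ?k"
  proof (intro add_mono sum_mono mult_left_mono)
    show "(\<Sum>w\<in>{1..n}. walk_sum n ?f ds w v) \<le> (4 * D) ^ ?k"
      using Cons.prems f by (intro walk_sum_column cf) auto
  qed (use Cons f p in auto)
  also have "\<dots> = walk_sum n ?g (c # ds) u v + (\<Sum>w\<in>{1..n}. ?g (c, {u, w})) * (?k * p * (4 * D) ^ (?k - 1))
      + p * (4 * D) ^ ?k"
    by (simp add: algebra_simps sum.distrib sum_distrib_left)
  also have "(\<Sum>w\<in>{1..n}. ?g (c, {u, w})) * (?k * p * (4 * D) ^ (?k - 1)) \<le> (4 * D) * (?k * p * (4 * D) ^ (?k - 1))"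
    using sum_star_indicator[OF M, of c u] deg[of c u] Cons.prems D p by (intro mult_right_mono) auto
  also have "(4 * D) * (?k * p * (4 * D) ^ (?k - 1)) = ?k * p * (4 * D) ^ ?k"
    by (cases ?k) simp_all
  finally show ?case by (simp add: algebra_simps)
qed


section \<open>Cardinality estimates and products of walk bounds\<close>

lemma walk_sum_const_one: "walk_sum n (\<lambda>_. 1) (c # cs) u v \<le> real n ^ length cs"
proof (induction cs arbitrary: c u)
  case Nil
  have "(\<Sum>w\<in>{1..n}. if w = v then 1 else 0) \<le> (1::real)" by simp
  then show ?case by simp
next
  case (Cons c' cs)
  have "walk_sum n (\<lambda>_. 1) (c # c' # cs) u v = (\<Sum>w\<in>{1..n}. walk_sum n (\<lambda>_. 1) (c' # cs) w v)" by simp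
  also have "\<dots> \<le> (\<Sum>w\<in>{1..n}. real n ^ length cs)" by (intro sum_mono Cons.IH)
  finally show ?case by simp
qed

lemma card_walks_le:
  assumes "u \<in> {1..n}" "k \<ge> 1"
  shows "card (walks n k u v) \<le> n ^ (k - 1)"
proof -
  have "real (card (walks n k u v)) = walk_sum n (\<lambda>_. 1) (replicate k 0) u v"
    using walk_sum_eq_sum_walks[OF assms(1), of "\<lambda>_. 1" "replicate k 0" v] by simp
  also have "replicate k (0::nat) = 0 # replicate (k - 1) 0" using assms(2) by (cases k) auto
  also have "walk_sum n (\<lambda>_. 1) \<dots> u v \<le> real n ^ (k - 1)"
    using walk_sum_const_one[of n 0 "replicate (k - 1) 0" u v] by simp
  finally show ?thesis by (simp flip: of_nat_power)
qed

lemma card_subfamilies_le: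
  assumes "finite W"
  shows "finite {P. P \<subseteq> W \<and> card P = r \<and> Q P}" "card {P. P \<subseteq> W \<and> card P = r \<and> Q P} \<le> card W ^ r"
proof -
  have fin: "finite {P. P \<subseteq> W \<and> card P = r}"
    by (rule finite_subset[of _ "Pow W"]) (use assms in auto)
  then show "finite {P. P \<subseteq> W \<and> card P = r \<and> Q P}" by (rule rev_finite_subset) blast
  have "card {P. P \<subseteq> W \<and> card P = r \<and> Q P} \<le> card {P. P \<subseteq> W \<and> card P = r}"
    by (rule card_mono[OF fin]) blast
  also have "\<dots> = card W choose r" by (rule n_subsets[OF assms])
  also have "\<dots> \<le> card W ^ r"
    by (cases "r \<le> card W") (auto intro: binomial_le_pow simp: binomial_eq_0)
  finally show "card {P. P \<subseteq> W \<and> card P = r \<and> Q P} \<le> card W ^ r" .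
qed

lemma card_edges_of_disjoint_family:
  assumes "finite P" "distinct ds" "edge_disjoint ds P"
  shows "card (\<Union> (path_edges ds ` P)) = card P * length ds"
proof -
  have "card (\<Union> (path_edges ds ` P)) = (\<Sum>vs\<in>P. card (path_edges ds vs))"
    using assms by (intro card_UN_disjoint) (auto simp: pairwise_def)
  then show ?thesis using assms(2) by (simp add: card_path_edges)
qed

lemma set_weight_empty: "set_weight p {} {} A = p ^ card A"
  by (simp add: set_weight_def elem_weight_def)

lemma set_weight_subset: "finite A \<Longrightarrow> A \<subseteq> M \<Longrightarrow> set_weight p M Bk A = 1"
  unfolding set_weight_def by (intro prod.neutral) (auto simp: elem_weight_def)

text \<open>\<open>max 1 (D ^ a * (\<nu> / N))\<close> will bound the number of walks of length a between two vertices. Two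
  edges split a path into three walks; one of them is paid for by the charge, the other two by these
  products.\<close>

lemma walk_threshold_products:
  fixes D \<nu> \<gamma> N :: real and m a c :: nat
  assumes \<nu>: "\<nu> \<ge> 1" "\<nu> ^ (2 * m) = N" and m: "m \<ge> 1" and \<gamma>: "0 < \<gamma>" "\<gamma> \<le> 1" and D: "\<nu>\<^sup>2 \<le> \<gamma> * D"
  defines "B \<equiv> \<lambda>k. max 1 (D ^ k * (\<nu> / N))"
  shows "m \<le> Suc (a + c) \<Longrightarrow> B a * B c \<le> \<gamma> * D ^ Suc (a + c) / N"
    and "m \<le> a + c \<Longrightarrow> B a * B c \<le> D ^ Suc (a + c) / N / \<nu>"
proof -
  have \<nu>2: "1 \<le> \<nu>\<^sup>2" using \<nu>(1) by (rule one_le_power)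
  have D1: "1 \<le> D"
  proof (rule ccontr)
    assume "\<not> 1 \<le> D"
    then have "\<gamma> * D < \<gamma> * 1" using \<gamma> by (intro mult_strict_left_mono) auto
    then show False using D \<nu>2 \<gamma> by linarith
  qed
  have D\<nu>: "\<nu>\<^sup>2 \<le> D" using D \<gamma> D1 by (meson mult_left_le_one_le order_trans less_imp_le zero_le_one)
  have N: "N > 0" "\<nu> \<le> N"
    using \<nu> m by (auto simp flip: \<nu>(2) intro!: self_le_power)
  \<comment> \<open>This turns the upper bound on b into the statement that balls of radius m are
    large compared with N. Using \<open>\<gamma> ^ m \<le> \<gamma>\<close> keeps one factor
    \<gamma>, which later makes the total charge small.\<close>
  have "N \<le> (\<gamma> * D) ^ m" unfolding \<nu>(2)[symmetric] power_mult using D \<nu> by (intro power_mono) auto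
  also have "\<dots> = \<gamma> ^ m * D ^ m" by (rule power_mult_distrib)
  also have "\<dots> \<le> \<gamma> * D ^ m"
    using \<gamma> m D1 power_decreasing[of 1 m \<gamma>] by (intro mult_right_mono) auto
  finally have Dm: "N \<le> \<gamma> * D ^ m" .
  have mono: "D ^ i \<le> D ^ j" if "i \<le> j" for i j using D1 that by (rule power_increasing[rotated])
  \<comment> \<open>A product of two maxima is one of four terms. The hypotheses on
    \<open>a + c\<close> are needed only for the term 1.\<close>
  have prod: "B a * B c \<le> T" if "1 \<le> T" "D ^ a * (\<nu> / N) \<le> T" "D ^ c * (\<nu> / N) \<le> T"
    "D ^ a * (\<nu> / N) * (D ^ c * (\<nu> / N)) \<le> T" for T
    using that unfolding B_def by (auto simp: max_def)
  have "\<nu> \<le> \<nu>\<^sup>2" using \<nu>(1) by (simp add: power2_eq_square)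
  then have \<nu>\<gamma>: "\<nu> \<le> \<gamma> * D" using D by linarith
  have sq: "D ^ a * (\<nu> / N) * (D ^ c * (\<nu> / N)) = D ^ (a + c) * \<nu>\<^sup>2 / N / N"
    by (simp add: power_add power2_eq_square)
  show "B a * B c \<le> \<gamma> * D ^ Suc (a + c) / N" if "m \<le> Suc (a + c)"
  proof (rule prod)
    show "1 \<le> \<gamma> * D ^ Suc (a + c) / N"
    proof -
      have "\<gamma> * D ^ m \<le> \<gamma> * D ^ Suc (a + c)" using \<gamma> by (intro mult_left_mono mono that) auto
      then have "N \<le> \<gamma> * D ^ Suc (a + c)" using Dm by linarith
      then show ?thesis using N(1) by (simp only: pos_le_divide_eq mult_1)
    qed
    have "D ^ k * (\<nu> / N) \<le> \<gamma> * D ^ Suc (a + c) / N" if "k = a \<or> k = c" for k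
    proof -
      have "D ^ k * \<nu> \<le> D ^ (a + c) * (\<gamma> * D)" using that \<nu> \<nu>\<gamma> D1 by (intro mult_mono mono) auto
      then show ?thesis using N by (simp add: field_simps)
    qed
    from this[of a] this[of c] show "D ^ a * (\<nu> / N) \<le> \<gamma> * D ^ Suc (a + c) / N" "D ^ c * (\<nu> / N) \<le> \<gamma> * D ^ Suc (a + c) / N"
      by simp_all
    have "D ^ (a + c) * \<nu>\<^sup>2 / N / N \<le> D ^ (a + c) * (\<gamma> * D) / N / 1"
      using D N D1 \<gamma> \<nu> by (intro frac_le divide_right_mono mult_left_mono) auto
    then show "D ^ a * (\<nu> / N) * (D ^ c * (\<nu> / N)) \<le> \<gamma> * D ^ Suc (a + c) / N"
      unfolding sq by (simp add: algebra_simps)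
  qed
  show "B a * B c \<le> D ^ Suc (a + c) / N / \<nu>" if "m \<le> a + c"
  proof (rule prod)
    have "\<gamma> * D ^ m \<le> 1 * D ^ m" using \<gamma> D1 by (intro mult_right_mono) auto
    then have "N \<le> 1 * D ^ m" using Dm by linarith
    then have Dac: "N \<le> D ^ (a + c)" using mono[OF that] by simp
    have "\<nu> \<le> \<nu>\<^sup>2" using \<nu>(1) by (simp add: power2_eq_square)
    then have "N * \<nu> \<le> D ^ (a + c) * D" using Dac D\<nu> N \<nu> D1 by (intro mult_mono) auto
    then show "1 \<le> D ^ Suc (a + c) / N / \<nu>" using N \<nu> by (simp add: field_simps)
    have "D ^ k * (\<nu> / N) \<le> D ^ Suc (a + c) / N / \<nu>" if "k = a \<or> k = c" for k
    proof -
      have "D ^ k * \<nu>\<^sup>2 \<le> D ^ (a + c) * D" using that D\<nu> D1 by (intro mult_mono mono) auto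
      then show ?thesis using N \<nu> by (simp add: field_simps power2_eq_square)
    qed
    from this[of a] this[of c] show "D ^ a * (\<nu> / N) \<le> D ^ Suc (a + c) / N / \<nu>" "D ^ c * (\<nu> / N) \<le> D ^ Suc (a + c) / N / \<nu>"
      by simp_all
    have "D ^ (a + c) * \<nu>\<^sup>2 / N / N \<le> D ^ (a + c) * D / N / \<nu>"
      using D\<nu> N D1 \<nu> by (intro frac_le divide_right_mono mult_left_mono) auto
    then show "D ^ a * (\<nu> / N) * (D ^ c * (\<nu> / N)) \<le> D ^ Suc (a + c) / N / \<nu>"
      unfolding sq by (simp add: algebra_simps)
  qed
qed

section \<open>Maker connects all pairs in all colour orders\<close>

definition color_orders :: "nat \<Rightarrow> nat list set" where
  "color_orders s = {cs. distinct cs \<and> set cs = {1..s}}"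

definition color_lists :: "nat \<Rightarrow> nat list set" where
  "color_lists s = {ds. distinct ds \<and> set ds \<subseteq> {1..s} \<and> ds \<noteq> []}"

lemma finite_color_lists: "finite (color_lists s)" "finite (color_orders s)"
proof -
  have len: "length ds \<le> s" if "distinct ds" "set ds \<subseteq> {1..s}" for ds
    using card_mono[OF _ that(2)] that(1) by (simp add: distinct_card)
  have "color_lists s \<union> color_orders s \<subseteq> {ds. set ds \<subseteq> {1..s} \<and> length ds \<le> s}"
    using len unfolding color_lists_def color_orders_def by auto
  then have "finite (color_lists s \<union> color_orders s)"
    by (rule finite_subset) (rule finite_lists_length_le, simp)
  then show "finite (color_lists s)" "finite (color_orders s)" by auto
qed

lemma length_color_order: "cs \<in> color_orders s \<Longrightarrow> length cs = s"
  unfolding color_orders_def by (metis (mono_tags, lifting) card_atLeastAtMost diff_Suc_1 distinct_card mem_Collect_eq)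

lemma length_color_list: "ds \<in> color_lists s \<Longrightarrow> length ds \<le> s"
  unfolding color_lists_def using card_mono[of "{1..s}" "set ds"] by (auto simp: distinct_card)

lemma sum_over_edges_of_color:
  fixes h :: "nat \<Rightarrow> real"
  assumes h: "\<And>t. h t \<ge> 0"
  shows "(\<Sum>e\<in>{e\<in>rc_board s n. fst e = c}. \<Sum>t\<in>snd e. h t) \<le> n * (\<Sum>t\<in>{1..n}. h t)"
proof -
  let ?E = "{e\<in>rc_board s n. fst e = c}"
  have "(\<Sum>e\<in>?E. \<Sum>t\<in>snd e. h t) = (\<Sum>e\<in>?E. \<Sum>t\<in>{1..n}. if t \<in> snd e then h t else 0)"
  proof (rule sum.cong[OF refl])
    fix e assume "e \<in> ?E"
    then have "snd e \<subseteq> {1..n}" using snd_rc_board by blast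
    then have "{1..n} \<inter> {t. t \<in> snd e} = snd e" by blast
    then show "(\<Sum>t\<in>snd e. h t) = (\<Sum>t\<in>{1..n}. if t \<in> snd e then h t else 0)"
      by (simp add: sum.If_cases)
  qed
  also have "\<dots> = (\<Sum>t\<in>{1..n}. \<Sum>e\<in>?E. if t \<in> snd e then h t else 0)" by (rule sum.swap)
  also have "\<dots> \<le> (\<Sum>t\<in>{1..n}. n * h t)"
  proof (intro sum_mono)
    fix t assume t: "t \<in> {1..n}"
    have "(\<Sum>e\<in>?E. if t \<in> snd e then h t else 0) = real (card (?E \<inter> {e. t \<in> snd e})) * h t"
      by (subst sum.If_cases) auto
    also have "?E \<inter> {e. t \<in> snd e} \<subseteq> (\<lambda>w. (c, {t, w})) ` {1..n}"
    proof
      fix e assume e: "e \<in> ?E \<inter> {e. t \<in> snd e}"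
      then obtain w where w: "snd e = {t, w}" using rc_board_other_endpoint[of e s n t] by blast
      then have "w \<in> {1..n}" using snd_rc_board[of e s n] e by blast
      moreover have "e = (c, {t, w})" using w e by (cases e) auto
      ultimately show "e \<in> (\<lambda>w. (c, {t, w})) ` {1..n}" by blast
    qed
    then have "card (?E \<inter> {e. t \<in> snd e}) \<le> n"
      using surj_card_le[of "{1..n}" "?E \<inter> {e. t \<in> snd e}"] by simp
    then have "real (card (?E \<inter> {e. t \<in> snd e})) * h t \<le> n * h t" using h by (intro mult_right_mono) auto
    finally show "(\<Sum>e\<in>?E. if t \<in> snd e then h t else 0) \<le> n * h t" .
  qed
  finally show ?thesis by (simp add: sum_distrib_left)
qed

text \<open>The \<open>s - 1\<close> inner vertices are chosen in a falling factorial whose factors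
  are all at least \<open>n - s \<ge> n / 2\<close>.\<close>

lemma card_paths_ge:
  assumes xy: "x \<in> {1..n}" "y \<in> {1..n}" "x \<noteq> y" and s: "s \<ge> 1" "2 * s \<le> n"
  shows "(real n / 2) ^ (s - 1) \<le> real (card {vs \<in> walks n s x y. distinct vs})"
proof -
  let ?A = "{1..n} - {x, y}"
  let ?L = "{ws. length ws = s - 1 \<and> distinct ws \<and> set ws \<subseteq> ?A}"
  have cA: "card ?A = n - 2" using xy by (simp add: card_Diff_subset)
  have "card {n - 2 - (s - 1) + 1..n - 2} = s - 1" using s unfolding card_atLeastAtMost by linarith
  then have "(real n / 2) ^ (s - 1) = (\<Prod>i\<in>{n - 2 - (s - 1) + 1..n - 2}. real n / 2)"
    by (simp only: prod_constant)
  also have "\<dots> \<le> (\<Prod>i\<in>{n - 2 - (s - 1) + 1..n - 2}. real i)"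
    using s by (intro prod_mono) auto
  also have "\<dots> = real (card ?L)"
    using card_lists_distinct_length_eq[of ?A "s - 1"] s unfolding cA by simp
  also have "card ?L \<le> card {vs \<in> walks n s x y. distinct vs}"
  proof (rule card_inj_on_le)
    show "inj_on (\<lambda>ws. x # ws @ [y]) ?L" by (auto simp: inj_on_def)
    show "(\<lambda>ws. x # ws @ [y]) ` ?L \<subseteq> {vs \<in> walks n s x y. distinct vs}"
      using xy s by (auto simp: walks_def)
    show "finite {vs \<in> walks n s x y. distinct vs}" by simp
  qed
  finally show ?thesis by simp
qed

text \<open>\<nu> is the 2m-th root of n, and \<open>\<gamma>b\<close> is the bound on b written
  without powers. \<open>\<gamma>_small\<close> keeps the total charge below \<open>F0 / 16\<close>,
  \<open>n_large\<close> keeps each single edge negligible against F0 even after multiplication by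
  \<open>ln n\<close>, and \<open>n_init\<close> makes the initial potential at most
  \<open>1 / n\<close>.\<close>

locale rainbow_maker =
  fixes s n b m r :: nat and \<gamma> \<nu> :: real
  assumes s3: "s \<ge> 3" and m: "m = (s + 1) div 2" and r: "r = 8 * m" and b1: "b \<ge> 1"
    and \<gamma>: "0 < \<gamma>" "\<gamma> \<le> 1"
    and \<nu>: "\<nu> \<ge> 1" "\<nu> ^ (2 * m) = n" and \<gamma>b: "\<nu>\<^sup>2 * b \<le> \<gamma> * n"
    and \<gamma>_small: "96 * s * 4 ^ s * (walk_const r s + s * 4 ^ s)\<^sup>2 * \<gamma> \<le> 1 / (2 ^ (s - 1) * 3 ^ s)"
    and n2s: "n \<ge> 2 * s"
    and n_large: "128 * (walk_const r s + s * 4 ^ s) ^ 3 * ln n \<le> \<nu> / (2 ^ (s - 1) * 3 ^ s)"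
    and n_init: "card (color_orders s) + card (color_lists s) * (real (r * s) ^ s) ^ r + s \<le> n"
begin

definition D :: real where "D = n / b"
definition K :: real where "K = walk_const r s + s * 4 ^ s"
definition cF :: real where "cF = 1 / (2 ^ (s - 1) * 3 ^ s)"
text \<open>A lower bound for the initial expected number of paths of a goal: at least
  \<open>(n / 2) ^ (s - 1)\<close> paths of weight \<open>p ^ s \<ge> (1 / (3 * b)) ^ s\<close>
  each, see \<open>F0_eq\<close>.\<close>

definition F0 :: real where "F0 = cF * (D ^ s / n)"
definition thr :: "nat \<Rightarrow> real" where "thr k = max 1 (D ^ k * (\<nu> / n))"

definition goals :: "(nat \<times> nat \<times> nat list) set" where
  "goals = {(x, y, cs). x \<in> {1..n} \<and> y \<in> {1..n} \<and> x \<noteq> y \<and> cs \<in> color_orders s}"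

definition paths :: "nat \<times> nat \<times> nat list \<Rightarrow> nat list set" where
  "paths g = {vs \<in> walks n s (fst g) (fst (snd g)). distinct vs}"

definition edges_of :: "nat \<times> nat \<times> nat list \<Rightarrow> nat list \<Rightarrow> colored_edge set" where
  "edges_of g vs = path_edges (snd (snd g)) vs"

text \<open>Breaker's set is replaced by the empty set. This gives an upper bound that depends on M
  only and grows with M, as the charge has to by \<open>tau_mono\<close>.\<close>

abbreviation wt :: "colored_edge set \<Rightarrow> colored_edge \<Rightarrow> real" where
  "wt M \<equiv> elem_weight (1 / (2 * real b + 1)) M {}"

abbreviation wsum :: "colored_edge set \<Rightarrow> nat list \<Rightarrow> nat \<Rightarrow> nat \<Rightarrow> real" where
  "wsum M \<equiv> walk_sum n (wt M)"

text \<open>An edge among the first half of the colours is charged the walks leading to it from x, an edge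
  among the second half the walks from it to y. Two edges of a path cannot both be in the middle
  position, the only one without charge when s is odd.\<close>

definition charge_at :: "nat list \<Rightarrow> nat list \<Rightarrow> nat \<Rightarrow> nat \<Rightarrow> colored_edge set \<Rightarrow> nat set \<Rightarrow> real" where
  "charge_at cs1 cs2 x y M V =
     (if length cs1 < s - m then 2 * K\<^sup>2 * \<gamma> * D ^ (s - 1 - length cs1) / n * (\<Sum>t\<in>V. wsum M cs1 x t) else 0)
   + (if m \<le> length cs1 then 2 * K\<^sup>2 * \<gamma> * D ^ length cs1 / n * (\<Sum>t\<in>V. wsum M cs2 t y) else 0)"

definition charge :: "nat \<times> nat \<times> nat list \<Rightarrow> colored_edge set \<Rightarrow> colored_edge \<Rightarrow> real" where
  "charge g M e = (case g of (x, y, cs) \<Rightarrow>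
     charge_at (takeWhile (\<lambda>c. c \<noteq> fst e) cs) (tl (dropWhile (\<lambda>c. c \<noteq> fst e) cs)) x y M (snd e))"

lemma charge_eq:
  assumes "distinct (cs1 @ c # cs2)"
  shows "charge (x, y, cs1 @ c # cs2) M (c, V) = charge_at cs1 cs2 x y M V"
proof -
  have "takeWhile (\<lambda>c'. c' \<noteq> c) (cs1 @ c # cs2) = cs1" "dropWhile (\<lambda>c'. c' \<noteq> c) (cs1 @ c # cs2) = c # cs2"
    using assms by (auto simp: takeWhile_append2 dropWhile_append2 takeWhile_tail dropWhile_append)
  then show ?thesis by (simp add: charge_def)
qed

text \<open>Families of constant size r suffice, as many disjoint walks contain very many of them; large ones
  would spoil \<open>Phi_round\<close>, which loses a factor \<open>r * s\<close>. For \<open>r = 8 * m\<close> their total initial weight is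
  of order \<open>1 / n\<^sup>2\<close>.\<close>

definition families :: "((nat \<times> nat \<times> nat list) \<times> nat list set) set" where
  "families = (SIGMA g:{1..n} \<times> {1..n} \<times> color_lists s.
     {P. P \<subseteq> walks n (length (snd (snd g))) (fst g) (fst (snd g)) \<and> card P = r \<and>
       edge_disjoint (snd (snd g)) P})"

definition family_edges :: "(nat \<times> nat \<times> nat list) \<times> nat list set \<Rightarrow> colored_edge set" where
  "family_edges h = \<Union> (edges_of (fst h) ` snd h)"

text \<open>Normalised so that more than \<open>r * thr k\<close> disjoint Maker walks of length k
  between two vertices would by themselves bring the sum over families to at least 1.\<close>

definition family_weight :: "(nat \<times> nat \<times> nat list) \<times> nat list set \<Rightarrow> real" where
  "family_weight h = (1 / thr (length (snd (snd (fst h))))) ^ r"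

definition star :: "nat \<times> nat \<Rightarrow> colored_edge set" where
  "star d = {e. fst e = fst d \<and> snd d \<in> snd e}"

lemma m2: "m \<ge> 2" "s \<le> 2 * m" "2 * m \<le> s + 1" using s3 m by auto

lemma r1: "r \<ge> 1" using r m2 by simp

lemma n0: "real n \<ge> 6" using n2s s3 by simp

lemma D\<nu>: "\<nu>\<^sup>2 \<le> \<gamma> * D"
  unfolding D_def using \<gamma>b b1 by (simp add: field_simps)

lemma D1: "D \<ge> 1" "\<nu> \<le> D" "\<nu>\<^sup>2 \<le> D"
proof -
  have 1: "1 \<le> \<nu>\<^sup>2" using \<nu>(1) by (rule one_le_power)
  have D0: "0 \<le> D" unfolding D_def by simp
  have "\<gamma> * D \<le> 1 * D" using \<gamma> D0 by (intro mult_right_mono) auto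
  then show 2: "\<nu>\<^sup>2 \<le> D" using D\<nu> by linarith
  then show "D \<ge> 1" using 1 by linarith
  have "\<nu> \<le> \<nu>\<^sup>2" using \<nu>(1) by (simp add: power2_eq_square)
  then show "\<nu> \<le> D" using 2 by linarith
qed

lemma K1: "K \<ge> 1" unfolding K_def using walk_const_ge_1[of r s] by (simp add: add_increasing2)

lemma cF0: "cF > 0" unfolding cF_def by simp

lemma F0_pos: "F0 > 0" unfolding F0_def using cF0 D1 n0 by simp

lemma ln_n: "ln n \<ge> 1"
proof -
  have "exp 1 \<le> real n" using n0 exp_le by linarith
  then show ?thesis using n0 by (subst ln_ge_iff) auto
qed

lemma thr1: "thr k \<ge> 1" unfolding thr_def by simp

lemma p_bounds: "0 < 1 / (2 * real b + 1)" "1 / (2 * real b + 1) \<le> 1" "real n * (1 / (2 * real b + 1)) \<le> D / 2"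
  using b1 unfolding D_def by (auto simp: field_simps)

lemma wt_nonneg: "wt M e \<ge> 0" by (simp add: elem_weight_def)

lemma walk_wt_nonneg: "wsum M cs u v \<ge> 0"
  by (intro walk_sum_nonneg wt_nonneg)

lemma wt_mono: "M \<subseteq> M' \<Longrightarrow> wsum M cs u v \<le> wsum M' cs u v"
  using p_bounds by (intro walk_sum_mono wt_nonneg) (auto simp: elem_weight_def)

lemma charge_at_nonneg: "charge_at cs1 cs2 x y M V \<ge> 0"
  unfolding charge_at_def using \<gamma> D1(1)
  by (intro add_nonneg_nonneg) (auto intro!: mult_nonneg_nonneg divide_nonneg_nonneg sum_nonneg walk_wt_nonneg)

lemma charge_at_mono: "M \<subseteq> M' \<Longrightarrow> charge_at cs1 cs2 x y M V \<le> charge_at cs1 cs2 x y M' V"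
  unfolding charge_at_def using \<gamma> D1(1)
  by (intro add_mono) (auto intro!: mult_left_mono divide_right_mono sum_mono wt_mono)

lemma edges_of_family:
  assumes "h \<in> families"
  shows "finite (snd h)" "card (family_edges h) = r * length (snd (snd (fst h)))"
proof -
  obtain g P where h: "h = (g, P)" by (cases h)
  have g: "snd (snd g) \<in> color_lists s" and P: "P \<subseteq> walks n (length (snd (snd g))) (fst g) (fst (snd g))" "card P = r"
      "edge_disjoint (snd (snd g)) P"
    using assms unfolding h families_def by auto
  show "finite (snd h)" unfolding h snd_conv by (rule finite_subset[OF P(1) finite_walks])
  then show "card (family_edges h) = r * length (snd (snd (fst h)))"
    using card_edges_of_disjoint_family[of P "snd (snd g)"] P g
    unfolding h family_edges_def edges_of_def color_lists_def by auto
qed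

lemma finite_families: "finite families"
  unfolding families_def using finite_color_lists(1)[of s] card_subfamilies_le(1)
  by (intro finite_SigmaI) auto

lemma finite_goals: "finite goals"
proof (rule finite_subset)
  show "goals \<subseteq> {1..n} \<times> {1..n} \<times> color_orders s" unfolding goals_def by auto
qed (use finite_color_lists(2)[of s] in auto)

lemma card_goals: "card goals \<le> n\<^sup>2 * card (color_orders s)"
proof -
  have "card goals \<le> card ({1..n} \<times> {1..n} \<times> color_orders s)"
    using finite_color_lists(2)[of s] by (intro card_mono) (auto simp: goals_def)
  then show ?thesis by (simp add: card_cartesian_product power2_eq_square mult.assoc)
qed

text \<open>\<open>4 * ln n / F0\<close> makes each goal potential start at no more than
  \<open>1 / n ^ 4\<close>, because F starts at no less than F0; \<open>1 / n ^ 4\<close> is taken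
  for the degrees likewise. The number of goals and degree conditions is only of order
  \<open>n ^ 2\<close>.\<close>

sublocale maker_potential "rc_board s n" b "r * s" goals paths edges_of charge "4 * ln n / F0"
  families family_edges family_weight "{1..s} \<times> {1..n}" star "1 / real n ^ 4"
proof
  show "finite (rc_board s n)" "b \<ge> 1" "finite goals" "finite families" "finite ({1..s} \<times> {1..n})"
    using b1 finite_goals finite_families by auto
  show "1 \<le> r * s" using r1 s3 by simp
  show "finite (paths g)" for g unfolding paths_def by simp
  show "finite (edges_of g vs)" for g vs unfolding edges_of_def by simp
  show "finite (family_edges h)" if "h \<in> families" for h
    using edges_of_family(1)[OF that] unfolding family_edges_def edges_of_def by auto
  show "card (family_edges h) \<le> r * s" if "h \<in> families" for h
    unfolding edges_of_family(2)[OF that] using that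
    by (intro mult_left_mono length_color_list) (auto simp: families_def)
  show "family_weight h \<ge> 0" for h
    unfolding family_weight_def using thr1[of "length (snd (snd (fst h)))"] by simp
  show "0 \<le> 4 * ln n / F0" using F0_pos ln_n by simp
  show "0 \<le> 1 / real n ^ 4" by simp
  show "charge g M e \<ge> 0" for g M e
    unfolding charge_def by (auto split: prod.split intro: charge_at_nonneg)
  show "charge g M e \<le> charge g M' e" if "M \<subseteq> M'" for g M M' e
    unfolding charge_def using that by (auto split: prod.split intro: charge_at_mono)
qed

lemma p_eq: "1 / (2 * real b + 1) = p" unfolding p_def by simp

end

lemma fst_rc_board: "e \<in> rc_board s n \<Longrightarrow> fst e \<in> {1..s}"
  by (auto elim: rc_boardE)

context rainbow_maker
begin

lemma goal_potential_nonneg: "goal_potential g M Bk \<ge> 0"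
  by (simp add: goal_potential_def)

lemma family_potential_nonneg: "family_weight h * set_weight q M Bk (family_edges h) \<ge> 0"
  using q by (intro mult_nonneg_nonneg nonneg set_weight_nonneg) simp

lemma deg_potential_nonneg: "deg_potential d M Bk \<ge> 0"
  by (simp add: deg_potential_def)

lemma Phi_ge:
  shows "g \<in> goals \<Longrightarrow> goal_potential g M Bk \<le> Phi M Bk"
    and "d \<in> {1..s} \<times> {1..n} \<Longrightarrow> deg_potential d M Bk \<le> Phi M Bk"
    and "(\<Sum>h\<in>families. family_weight h * set_weight q M Bk (family_edges h)) \<le> Phi M Bk"
proof -
  have sums: "0 \<le> (\<Sum>g\<in>goals. goal_potential g M Bk)"
    "0 \<le> (\<Sum>h\<in>families. family_weight h * set_weight q M Bk (family_edges h))"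
    "0 \<le> (\<Sum>d\<in>{1..s} \<times> {1..n}. deg_potential d M Bk)"
    by (intro sum_nonneg goal_potential_nonneg family_potential_nonneg deg_potential_nonneg)+
  show "goal_potential g M Bk \<le> Phi M Bk" if "g \<in> goals"
    using member_le_sum[OF that, of "\<lambda>g. goal_potential g M Bk"] sums finite_goals goal_potential_nonneg
    unfolding Phi_def by auto
  show "deg_potential d M Bk \<le> Phi M Bk" if "d \<in> {1..s} \<times> {1..n}"
    using member_le_sum[OF that, of "\<lambda>d. deg_potential d M Bk"] sums deg_potential_nonneg
    unfolding Phi_def by (auto simp del: atLeastAtMost_iff)
  show "(\<Sum>h\<in>families. family_weight h * set_weight q M Bk (family_edges h)) \<le> Phi M Bk"
    using sums unfolding Phi_def by linarith
qed

section \<open>Consequences of a potential of at most 1 / n\<close>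

context
  fixes M Bk :: "colored_edge set"
  assumes MX: "M \<subseteq> rc_board s n" and BX: "Bk \<subseteq> rc_board s n" and small: "Phi M Bk \<le> 1 / n"
begin

text \<open>A small potential leaves Maker's degree at most \<open>2 / b\<close> times Breaker's
  plus \<open>16 * ln n\<close>. The first part is at most \<open>2 * D\<close> and the second at
  most D, since even \<nu> exceeds \<open>16 * ln n\<close>.\<close>

lemma degree_bound:
  assumes "c \<in> {1..s}" "u \<in> {1..n}"
  shows "real (card (M \<inter> {e. fst e = c \<and> u \<in> snd e})) \<le> 3 * D"
proof -
  let ?dM = "real (card (M \<inter> star (c, u)))" and ?dB = "real (card (Bk \<inter> star (c, u)))"
  have "deg_potential (c, u) M Bk \<le> 1 / n" using Phi_ge(2)[of "(c, u)" M Bk] small assms by simp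
  also have "\<dots> \<le> 1" using n0 by simp
  finally have "exp ((?dM - 2 / b * ?dB) / 4) \<le> real n ^ 4"
    unfolding deg_potential_def using n0 by (simp add: field_simps)
  also have "\<dots> = exp (4 * ln n)" using n0 by (simp add: exp_of_nat_mult[of 4, simplified])
  finally have "?dM \<le> 2 / b * ?dB + 16 * ln n" by simp
  moreover have "?dB \<le> n"
  proof -
    have "Bk \<inter> star (c, u) \<subseteq> (\<lambda>w. (c, {u, w})) ` {1..n}"
    proof
      fix e assume e: "e \<in> Bk \<inter> star (c, u)"
      then have eX: "e \<in> rc_board s n" "u \<in> snd e" "fst e = c" using BX by (auto simp: star_def)
      then obtain w where w: "snd e = {u, w}" using rc_board_other_endpoint by blast
      then have "w \<in> {1..n}" using snd_rc_board[OF eX(1)] by blast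
      moreover have "e = (c, {u, w})" using w eX by (cases e) auto
      ultimately show "e \<in> (\<lambda>w. (c, {u, w})) ` {1..n}" by blast
    qed
    then show ?thesis using surj_card_le[of "{1..n}" "Bk \<inter> star (c, u)"] by simp
  qed
  then have "2 / b * ?dB \<le> 2 * D" unfolding D_def using b1 by (simp add: field_simps)
  moreover have "16 * ln n \<le> D"
  proof -
    have "1 \<le> K ^ 3" using K1 by (rule one_le_power)
    then have "16 * ln n \<le> 128 * K ^ 3 * ln n" using ln_n by (intro mult_right_mono) auto
    also have "\<dots> \<le> \<nu> / (2 ^ (s - 1) * 3 ^ s)" using n_large unfolding K_def .
    also have "\<dots> \<le> \<nu> / 1"
    proof (rule divide_left_mono)
      have "(1::real) * 1 \<le> 2 ^ (s - 1) * 3 ^ s" by (intro mult_mono one_le_power) auto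
      then show "(1::real) \<le> 2 ^ (s - 1) * 3 ^ s" by simp
    qed (use \<nu> in auto)
    finally show ?thesis using D1 by simp
  qed
  ultimately show ?thesis by (simp add: star_def)
qed

lemma disjoint_family_bound:
  assumes uv: "u \<in> {1..n}" "v \<in> {1..n}" and ds: "distinct ds" "set ds \<subseteq> {1..s}" "ds \<noteq> []"
    and P: "P \<subseteq> maker_walks n M ds u v" "edge_disjoint ds P"
  shows "real (card P) \<le> r * max 1 (D ^ length ds * (\<nu> / n))"
proof (rule ccontr)
  assume "\<not> ?thesis"
  then have big: "r * thr (length ds) < real (card P)" unfolding thr_def by simp
  let ?g = "(u, v, ds)" and ?t = "thr (length ds)"
  let ?S = "{P'. P' \<subseteq> P \<and> card P' = r}"
  have finP: "finite P" using P(1) by (rule finite_subset) simp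
  have "real r * 1 \<le> r * ?t" using thr1 by (intro mult_left_mono) auto
  then have rP: "r \<le> card P" using big by simp
  have sub: "(\<lambda>P'. (?g, P')) ` ?S \<subseteq> families"
  proof
    fix h assume "h \<in> (\<lambda>P'. (?g, P')) ` ?S"
    then obtain P' where h: "h = (?g, P')" and P': "P' \<subseteq> P" "card P' = r" by blast
    have "edge_disjoint ds P'"
      by (rule pairwise_subset[OF P(2) P'(1)])
    moreover have "P' \<subseteq> walks n (length ds) u v" using P' P(1) unfolding maker_walks_def by blast
    ultimately show "h \<in> families"
      using uv ds P'(2) unfolding h families_def color_lists_def edges_of_def by simp
  qed
  have weight: "family_weight (?g, P') * set_weight q M Bk (family_edges (?g, P')) = (1 / ?t) ^ r"
    if "P' \<in> ?S" for P'
  proof -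
    have "finite P'" using that finP finite_subset by blast
    moreover have "path_edges ds vs \<subseteq> M" if "vs \<in> P'" for vs
      using that \<open>P' \<in> ?S\<close> P(1) unfolding maker_walks_def by blast
    ultimately have "set_weight q M Bk (family_edges (?g, P')) = 1"
      unfolding family_edges_def edges_of_def by (intro set_weight_subset) auto
    then show ?thesis unfolding family_weight_def by simp
  qed
  \<comment> \<open>t disjoint walks contain at least \<open>(t / r) ^ r\<close> subfamilies of size
    r, each completed by Maker and hence of full weight.\<close>
  have "1 \<le> (real (card P) / r / ?t) ^ r"
    using big r1 thr1[of "length ds"] by (intro one_le_power) (simp add: field_simps)
  also have "\<dots> = (real (card P) / real r) ^ r * (1 / ?t) ^ r" by (simp add: power_mult_distrib[symmetric])
  also have "\<dots> \<le> real (card P choose r) * (1 / ?t) ^ r"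
    using binomial_ge_n_over_k_pow_k[OF rP, where 'a = real] thr1[of "length ds"] by (intro mult_right_mono) auto
  also have "\<dots> = (\<Sum>P'\<in>?S. (1 / ?t) ^ r)" using n_subsets[OF finP, of r] by simp
  also have "\<dots> = (\<Sum>P'\<in>?S. family_weight (?g, P') * set_weight q M Bk (family_edges (?g, P')))"
    using weight by simp
  also have "\<dots> = (\<Sum>h\<in>(\<lambda>P'. (?g, P')) ` ?S. family_weight h * set_weight q M Bk (family_edges h))"
    by (subst sum.reindex) (auto simp: inj_on_def)
  also have "\<dots> \<le> (\<Sum>h\<in>families. family_weight h * set_weight q M Bk (family_edges h))"
    by (intro sum_mono2 finite_families sub family_potential_nonneg)
  also have "\<dots> \<le> 1 / n" using Phi_ge(3)[of M Bk] small by linarith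
  also have "\<dots> < 1" using n0 by simp
  finally show False by simp
qed

lemma walk_wt_bound:
  assumes "u \<in> {1..n}" "v \<in> {1..n}" "distinct ds" "set ds \<subseteq> {1..s}"
  shows "wsum M ds u v \<le> K * thr (length ds)"
proof -
  let ?k = "length ds" and ?p = "1 / (2 * real b + 1)"
  have ks: "?k \<le> s" using card_mono[OF _ assms(4)] assms(3) by (simp add: distinct_card)
  have np: "n * ?p \<le> D" using p_bounds(3) D1 by linarith
  have "walk_sum n (elem_weight 0 M {}) ds u v \<le> walk_const r ?k * thr ?k"
    unfolding thr_def using D1 \<nu> assms n0
    by (intro maker_walk_bound[OF MX _ _ degree_bound disjoint_family_bound]) auto
  also have "\<dots> \<le> walk_const r s * thr ?k"
    using walk_const_mono[OF ks] thr1[of ?k] by (intro mult_right_mono) auto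
  finally have 1: "walk_sum n (elem_weight 0 M {}) ds u v \<le> walk_const r s * thr ?k" .
  \<comment> \<open>The walks using edges outside M fit under the same threshold, because
    \<open>p \<le> D / n\<close> bounds their number by a constant times
    \<open>D ^ k / n\<close>.\<close>
  have 2: "?k * ?p * (4 * D) ^ (?k - 1) \<le> s * 4 ^ s * thr ?k"
  proof (cases ?k)
    case 0
    then show ?thesis using thr1[of ?k] by simp
  next
    case (Suc j)
    have "?p \<le> D / n" using np n0 by (simp add: field_simps)
    then have "?p * (4 * D) ^ j \<le> D / n * (4 * D) ^ j" using D1 by (intro mult_right_mono) auto
    also have "\<dots> = 4 ^ j * (D ^ Suc j * (1 / n))" by (simp add: power_mult_distrib)
    also have "\<dots> \<le> 4 ^ s * (D ^ Suc j * (\<nu> / n))"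
      using Suc ks D1 \<nu>(1) n0 by (intro mult_mono divide_right_mono power_increasing) auto
    also have "\<dots> \<le> 4 ^ s * thr ?k" unfolding thr_def Suc by (intro mult_left_mono) auto
    finally have "real ?k * (?p * (4 * D) ^ j) \<le> real s * (4 ^ s * thr ?k)"
      by (rule mult_mono[rotated]) (use ks D1 p_bounds(1) in auto)
    then show ?thesis using Suc by (simp add: mult.assoc)
  qed
  have "wsum M ds u v \<le> walk_sum n (elem_weight 0 M {}) ds u v + ?k * ?p * (4 * D) ^ (?k - 1)"
    using p_bounds assms by (intro weighted_walk_bound[OF MX _ np degree_bound]) auto
  then show ?thesis using 1 2 unfolding K_def by (simp add: algebra_simps)
qed

lemma walk_wt_product_bound:
  assumes "u \<in> {1..n}" "v \<in> {1..n}" "u' \<in> {1..n}" "v' \<in> {1..n}"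
    and "distinct ds" "set ds \<subseteq> {1..s}" "distinct es" "set es \<subseteq> {1..s}"
  shows "m \<le> Suc (length ds + length es) \<Longrightarrow> wsum M ds u v * wsum M es u' v'
      \<le> K\<^sup>2 * (\<gamma> * D ^ Suc (length ds + length es) / n)"
    and "m \<le> length ds + length es \<Longrightarrow> wsum M ds u v * wsum M es u' v'
      \<le> K\<^sup>2 * (D ^ Suc (length ds + length es) / n / \<nu>)"
proof -
  have "wsum M ds u v * wsum M es u' v' \<le> (K * thr (length ds)) * (K * thr (length es))"
    using K1 thr1[of "length ds"] assms by (intro mult_mono walk_wt_bound walk_wt_nonneg) auto
  also have "\<dots> = K\<^sup>2 * (thr (length ds) * thr (length es))" by (simp add: power2_eq_square)
  finally have 1: "wsum M ds u v * wsum M es u' v' \<le> K\<^sup>2 * (thr (length ds) * thr (length es))" .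
  have m1: "1 \<le> m" using m2 by simp
  note thr = walk_threshold_products[OF \<nu> m1 \<gamma> D\<nu>, of "length ds" "length es", folded thr_def]
  show "wsum M ds u v * wsum M es u' v' \<le> K\<^sup>2 * (\<gamma> * D ^ Suc (length ds + length es) / n)"
    if "m \<le> Suc (length ds + length es)"
    by (rule order_trans[OF 1 mult_left_mono[OF thr(1)[OF that]]]) simp
  show "wsum M ds u v * wsum M es u' v' \<le> K\<^sup>2 * (D ^ Suc (length ds + length es) / n / \<nu>)"
    if "m \<le> length ds + length es"
    by (rule order_trans[OF 1 mult_left_mono[OF thr(2)[OF that]]]) simp
qed

lemma through_le_walk_sum:
  assumes "(x, y, cs) \<in> goals"
  shows "through (x, y, cs) M Bk E \<le> walk_sum n (restrict_weight E (wt M)) cs x y"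
proof -
  have x: "x \<in> {1..n}" and cs: "distinct cs" "length cs = s"
    using assms length_color_order unfolding goals_def color_orders_def by auto
  have "through (x, y, cs) M Bk E
      \<le> (\<Sum>vs\<in>paths (x, y, cs). if E \<subseteq> path_edges cs vs then \<Prod>e\<in>path_edges cs vs. wt M e else 0)"
    unfolding through_def edges_of_def set_weight_def p_eq[symmetric] snd_conv
  proof (rule sum_mono)
    fix vs
    have "(\<Prod>e\<in>path_edges cs vs. elem_weight (1 / (2 * real b + 1)) M Bk e) \<le> (\<Prod>e\<in>path_edges cs vs. wt M e)"
      by (intro prod_mono conjI) (auto simp: elem_weight_def)
    then show "(if E \<subseteq> path_edges cs vs then \<Prod>e\<in>path_edges cs vs. elem_weight (1 / (2 * real b + 1)) M Bk e else 0)
      \<le> (if E \<subseteq> path_edges cs vs then \<Prod>e\<in>path_edges cs vs. wt M e else 0)" by simp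
  qed
  also have "\<dots> \<le> walk_sum n (restrict_weight E (wt M)) cs x y"
    by (rule sum_walks_through_le[OF wt_nonneg _ x cs(1)]) (auto simp: paths_def cs(2))
  finally show ?thesis .
qed

text \<open>An edge cuts the colour order into two walks of total length
  \<open>s - 1 \<ge> m\<close>, so the second product bound applies and saves a factor \<nu> against
  \<open>D ^ s / n\<close>.\<close>

lemma through_edge_bound:
  assumes g: "g \<in> goals" and e: "e \<in> rc_board s n - (M \<union> Bk)"
  shows "through g M Bk {e} \<le> p * (2 * (K\<^sup>2 * (D ^ s / n / \<nu>)))"
proof -
  obtain x y cs where gd: "g = (x, y, cs)" by (cases g)
  have xy: "x \<in> {1..n}" "y \<in> {1..n}" and cs: "distinct cs" "set cs = {1..s}" "length cs = s"
    using g length_color_order unfolding gd goals_def color_orders_def by auto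
  have eX: "e \<in> rc_board s n" using e by simp
  obtain c t t' where ed: "e = (c, {t, t'})" "c \<in> {1..s}" "t \<in> {1..n}" "t' \<in> {1..n}" "t \<noteq> t'"
    using eX by (rule rc_boardE)
  obtain cs1 cs2 where split: "cs = cs1 @ c # cs2" using ed(2) cs(2) by (metis split_list)
  have len: "Suc (length cs1 + length cs2) = s" using cs(3) split by simp
  have m_le: "m \<le> length cs1 + length cs2" using len m2 s3 m by linarith
  have lists: "distinct cs1" "set cs1 \<subseteq> {1..s}" "distinct cs2" "set cs2 \<subseteq> {1..s}"
    using cs(1,2) split by auto
  have "through g M Bk {e} \<le> walk_sum n (restrict_weight {e} (wt M)) (cs1 @ c # cs2) x y"
    using through_le_walk_sum g unfolding gd split by blast
  also have "\<dots> \<le> wt M (c, {t, t'}) * (wsum M cs1 x t * wsum M cs2 t' y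
      + wsum M cs1 x t' * wsum M cs2 t y)"
    by (rule walk_sum_restrict_one[OF wt_nonneg _ ed(5,3,4) xy(1)]) (simp add: ed(1))
  also have "\<dots> \<le> p * (K\<^sup>2 * (D ^ s / n / \<nu>) + K\<^sup>2 * (D ^ s / n / \<nu>))"
  proof (rule mult_mono[OF _ add_mono])
    show "wt M (c, {t, t'}) \<le> p" using e ed(1) unfolding p_eq by (simp add: elem_weight_def)
    show "wsum M cs1 x t * wsum M cs2 t' y \<le> K\<^sup>2 * (D ^ s / n / \<nu>)"
      "wsum M cs1 x t' * wsum M cs2 t y \<le> K\<^sup>2 * (D ^ s / n / \<nu>)"
      using walk_wt_product_bound(2)[OF _ _ _ _ lists m_le] xy ed unfolding len by blast+
    show "0 \<le> wsum M cs1 x t * wsum M cs2 t' y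
      + wsum M cs1 x t' * wsum M cs2 t y"
      by (intro add_nonneg_nonneg mult_nonneg_nonneg walk_wt_nonneg)
  qed (use p in simp)
  finally show ?thesis by (simp only: mult_2)
qed

text \<open>The two edges cut a path into three walks. If the first edge is early, the walk leading
  to it from x is kept as its charge and the two later walks are bounded by a product; otherwise the
  same is done from y at the second edge.\<close>

lemma through_two_edges_ordered:
  assumes g: "(x, y, cs1 @ c # cs2 @ d # cs3) \<in> goals"
    and e: "(c, {t, t'}) \<in> rc_board s n - (M \<union> Bk)" "t \<noteq> t'" "t \<in> {1..n}" "t' \<in> {1..n}"
    and f: "(d, {w, w'}) \<in> rc_board s n - (M \<union> Bk)" "w \<noteq> w'" "w \<in> {1..n}" "w' \<in> {1..n}"
  defines "g \<equiv> (x, y, cs1 @ c # cs2 @ d # cs3)"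
  shows "through g M Bk {(c, {t, t'}), (d, {w, w'})} \<le> p\<^sup>2 * (charge g M (c, {t, t'}) + charge g M (d, {w, w'}))"
proof -
  let ?W = "wsum M"
  let ?S = "?W cs1 x t * (?W cs2 t' w * ?W cs3 w' y + ?W cs2 t' w' * ?W cs3 w y) +
     ?W cs1 x t' * (?W cs2 t w * ?W cs3 w' y + ?W cs2 t w' * ?W cs3 w y)" and ?E = "{(c, {t, t'}), (d, {w, w'})}"
  have xy: "x \<in> {1..n}" "y \<in> {1..n}" and order: "cs1 @ c # cs2 @ d # cs3 \<in> color_orders s"
    using g unfolding goals_def by simp_all
  have len': "length (cs1 @ c # cs2 @ d # cs3) = s" by (rule length_color_order[OF order])
  have dist: "distinct (cs1 @ c # cs2 @ d # cs3)" and set: "set (cs1 @ c # cs2 @ d # cs3) = {1..s}"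
    using order unfolding color_orders_def by blast+
  have len: "length cs1 + length cs2 + length cs3 + 2 = s" using len' by simp
  have lists: "distinct cs1" "set cs1 \<subseteq> {1..s}" "distinct cs2" "set cs2 \<subseteq> {1..s}" "distinct cs3" "set cs3 \<subseteq> {1..s}"
    using dist set by auto
  have W0: "0 \<le> ?W zs a a'" for zs a a' by (rule walk_wt_nonneg)
  have wtp: "wt M (c, {t, t'}) = p" "wt M (d, {w, w'}) = p"
    using e(1) f(1) unfolding p_eq by (simp_all add: elem_weight_def)
  have "through g M Bk ?E \<le> walk_sum n (restrict_weight ?E (wt M)) (cs1 @ c # cs2 @ d # cs3) x y"
    using through_le_walk_sum g unfolding g_def by blast
  also have "\<dots> \<le> wt M (c, {t, t'}) * wt M (d, {w, w'}) *
    ?S"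
    by (rule walk_sum_restrict_two[OF wt_nonneg _ e(2-4) _ f(2-4) xy(1)]) auto
  also have "\<dots> = p\<^sup>2 *
    ?S"
    unfolding wtp by (simp add: power2_eq_square)
  finally have thr: "through g M Bk ?E \<le> p\<^sup>2 *
    ?S" .
  have ch_e: "charge g M (c, {t, t'}) = charge_at cs1 (cs2 @ d # cs3) x y M {t, t'}"
    unfolding g_def by (rule charge_eq[OF dist])
  have ch_f: "charge g M (d, {w, w'}) = charge_at (cs1 @ c # cs2) cs3 x y M {w, w'}"
    unfolding g_def using charge_eq[of "cs1 @ c # cs2" d cs3 x y M] dist by simp
  have "?S
    \<le> charge_at cs1 (cs2 @ d # cs3) x y M {t, t'} + charge_at (cs1 @ c # cs2) cs3 x y M {w, w'}"
  proof (cases "length cs1 < s - m")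
    case True
    define Z where "Z = K\<^sup>2 * (\<gamma> * D ^ Suc (length cs2 + length cs3) / n)"
    have l: "Suc (length cs2 + length cs3) = s - 1 - length cs1" using len by linarith
    have ml: "m \<le> Suc (length cs2 + length cs3)" using True unfolding l by linarith
    have Z: "?W cs2 a a' * ?W cs3 a'' y \<le> Z" if "a \<in> {1..n}" "a' \<in> {1..n}" "a'' \<in> {1..n}" for a a' a''
      unfolding Z_def by (rule walk_wt_product_bound(1)[OF that xy(2) lists(3-6) ml])
    have "?S
      \<le> ?W cs1 x t * (Z + Z) + ?W cs1 x t' * (Z + Z)"
      by (intro add_mono mult_left_mono Z e f W0)
    also have "\<dots> = 2 * K\<^sup>2 * \<gamma> * D ^ (s - 1 - length cs1) / n * (\<Sum>a\<in>{t, t'}. ?W cs1 x a)"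
      unfolding Z_def l using e(2) by (simp add: algebra_simps)
    also have "\<dots> \<le> charge_at cs1 (cs2 @ d # cs3) x y M {t, t'}"
      unfolding charge_at_def using True \<gamma> D1(1)
      by (auto intro!: mult_nonneg_nonneg divide_nonneg_nonneg sum_nonneg W0)
    finally show ?thesis using charge_at_nonneg[of "cs1 @ c # cs2" cs3 x y M "{w, w'}"] by linarith
  next
    case False
    define Z where "Z = K\<^sup>2 * (\<gamma> * D ^ Suc (length cs1 + length cs2) / n)"
    have l: "Suc (length cs1 + length cs2) = length (cs1 @ c # cs2)" by simp
    \<comment> \<open>Here \<open>length cs1 \<ge> s - m \<ge> m - 1\<close>, so the second edge has
      position at least m and does carry a charge from the side of y.\<close>
    have ml: "m \<le> Suc (length cs1 + length cs2)" using False m2 by linarith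
    have Z: "?W cs1 x a * ?W cs2 a' a'' \<le> Z" if "a \<in> {1..n}" "a' \<in> {1..n}" "a'' \<in> {1..n}" for a a' a''
      unfolding Z_def by (rule walk_wt_product_bound(1)[OF xy(1) that lists(1-4) ml])
    have "?S
      = (?W cs1 x t * ?W cs2 t' w + ?W cs1 x t' * ?W cs2 t w) * ?W cs3 w' y +
        (?W cs1 x t * ?W cs2 t' w' + ?W cs1 x t' * ?W cs2 t w') * ?W cs3 w y"
      by (simp add: algebra_simps)
    also have "\<dots> \<le> (Z + Z) * ?W cs3 w' y + (Z + Z) * ?W cs3 w y"
      by (intro add_mono mult_right_mono Z e f W0)
    also have "\<dots> = 2 * K\<^sup>2 * \<gamma> * D ^ length (cs1 @ c # cs2) / n * (\<Sum>a\<in>{w, w'}. ?W cs3 a y)"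
      unfolding Z_def l using f(2) by (simp add: algebra_simps)
    also have "\<dots> \<le> charge_at (cs1 @ c # cs2) cs3 x y M {w, w'}"
      unfolding charge_at_def using ml \<gamma> D1(1)
      by (auto intro!: mult_nonneg_nonneg divide_nonneg_nonneg sum_nonneg W0)
    finally show ?thesis using charge_at_nonneg[of cs1 "cs2 @ d # cs3" x y M "{t, t'}"] by linarith
  qed
  then have "p\<^sup>2 * ?S
     \<le> p\<^sup>2 * (charge g M (c, {t, t'}) + charge g M (d, {w, w'}))"
    unfolding ch_e ch_f by (rule mult_left_mono) simp
  with thr show ?thesis by linarith
qed

lemma through_two_edges:
  assumes g: "g \<in> goals" and e: "e \<in> rc_board s n - (M \<union> Bk)" and f: "f \<in> rc_board s n - (M \<union> Bk)" and "e \<noteq> f"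
  shows "through g M Bk {e, f} \<le> p\<^sup>2 * (charge g M e + charge g M f)"
proof -
  obtain x y cs where gd: "g = (x, y, cs)" by (cases g)
  have order: "cs \<in> color_orders s" using g unfolding gd goals_def by simp
  have cs: "distinct cs" "set cs = {1..s}" using order unfolding color_orders_def by blast+
  have eX: "e \<in> rc_board s n" and fX: "f \<in> rc_board s n" using e f by simp_all
  obtain c t t' where ed: "e = (c, {t, t'})" "c \<in> {1..s}" "t \<in> {1..n}" "t' \<in> {1..n}" "t \<noteq> t'"
    using eX by (rule rc_boardE)
  obtain d w w' where fd: "f = (d, {w, w'})" "d \<in> {1..s}" "w \<in> {1..n}" "w' \<in> {1..n}" "w \<noteq> w'"
    using fX by (rule rc_boardE)
  show ?thesis
  proof (cases "c = d")
    case True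
    \<comment> \<open>A rainbow path has one edge of each colour, so it cannot contain two different
      ones of colour c.\<close>
    have no: "\<not> {e, f} \<subseteq> edges_of g vs" for vs
    proof
      assume "{e, f} \<subseteq> edges_of g vs"
      then obtain i j where "i < length cs" "j < length cs" "cs ! i = c" "cs ! j = d"
          "e = (cs ! i, {vs ! i, vs ! Suc i})" "f = (cs ! j, {vs ! j, vs ! Suc j})"
        unfolding gd edges_of_def path_edges_def using ed(1) fd(1) by auto
      then show False using True cs(1) \<open>e \<noteq> f\<close> by (metis nth_eq_iff_index_eq)
    qed
    then have "through g M Bk {e, f} = 0"
      unfolding through_def by (intro sum.neutral ballI) (simp only: no if_False)
    then show ?thesis using tau_nonneg[of g M e] tau_nonneg[of g M f] by simp
  next
    case False
    have cd: "c \<in> set cs" "d \<in> set cs" using ed(2) fd(2) cs(2) by blast+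
    obtain as bs where ab: "cs = as @ c # bs" using cd(1) by (metis split_list)
    consider "d \<in> set bs" | "d \<in> set as" using cd(2) False unfolding ab by auto
    then show ?thesis
    proof cases
      case 1
      then obtain cs2 cs3 where "bs = cs2 @ d # cs3" by (metis split_list)
      then have cs': "cs = as @ c # cs2 @ d # cs3" using ab by simp
      show ?thesis
        using through_two_edges_ordered[OF _ e[unfolded ed(1)] ed(5,3,4) f[unfolded fd(1)] fd(5,3,4), of x y as cs2 cs3]
          g unfolding gd cs' ed(1) fd(1) by blast
    next
      case 2
      then obtain cs1 cs2 where "as = cs1 @ d # cs2" by (metis split_list)
      then have cs': "cs = cs1 @ d # cs2 @ c # bs" using ab by simp
      have "through g M Bk {f, e} \<le> p\<^sup>2 * (charge g M f + charge g M e)"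
        using through_two_edges_ordered[OF _ f[unfolded fd(1)] fd(5,3,4) e[unfolded ed(1)] ed(5,3,4), of x y cs1 cs2 bs]
          g unfolding gd cs' ed(1) fd(1) by blast
      then show ?thesis by (simp only: insert_commute add.commute)
    qed
  qed
qed

lemma ln_K_bound: "128 * K ^ 3 * ln n \<le> cF * \<nu>"
  using n_large unfolding K_def cF_def by simp

lemma lam_mult: "4 * ln n / F0 * (a * (D ^ s / n / \<nu>)) = 4 * ln n * a / (cF * \<nu>)"
  unfolding F0_def using D1 n0 by simp

lemma through_edge_small:
  assumes "g \<in> goals" "e \<in> rc_board s n - (M \<union> Bk)"
  shows "4 * ln n / F0 * through g M Bk {e} \<le> p / 4"
proof -
  have "4 * ln n / F0 * through g M Bk {e} \<le> 4 * ln n / F0 * (p * (2 * (K\<^sup>2 * (D ^ s / n / \<nu>))))"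
    using F0_pos ln_n by (intro mult_left_mono through_edge_bound assms) auto
  also have "\<dots> = 4 * ln n * (p * 2 * K\<^sup>2) / (cF * \<nu>)" using lam_mult[of "p * 2 * K\<^sup>2"] by (simp only: mult.assoc)
  also have "\<dots> = p * ((8 * K\<^sup>2 * ln n) / (cF * \<nu>))" by simp
  also have "\<dots> \<le> p * (1 / 4)"
  proof (intro mult_left_mono)
    have "K\<^sup>2 \<le> K ^ 3" using K1 by (intro power_increasing) auto
    then have "32 * K\<^sup>2 \<le> 128 * K ^ 3" using zero_le_power2[of K] by linarith
    then have "32 * K\<^sup>2 * ln n \<le> 128 * K ^ 3 * ln n" using ln_n by (intro mult_right_mono) auto
    also have "\<dots> \<le> cF * \<nu>" by (rule ln_K_bound)
    finally show "8 * K\<^sup>2 * ln n / (cF * \<nu>) \<le> 1 / 4" using cF0 \<nu> by (simp add: pos_divide_le_eq)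
  qed (use p in simp)
  finally show ?thesis by simp
qed

lemma goalE:
  assumes "g \<in> goals" "c \<in> {1..s}"
  obtains x y cs1 cs2 where "g = (x, y, cs1 @ c # cs2)" "x \<in> {1..n}" "y \<in> {1..n}"
    "distinct (cs1 @ c # cs2)" "set cs1 \<subseteq> {1..s}" "set cs2 \<subseteq> {1..s}" "Suc (length cs1 + length cs2) = s"
proof -
  obtain x y cs where gd: "g = (x, y, cs)" by (cases g)
  have xy: "x \<in> {1..n}" "y \<in> {1..n}" and order: "cs \<in> color_orders s" using assms unfolding gd goals_def by simp_all
  have cs: "distinct cs" "set cs = {1..s}" using order unfolding color_orders_def by blast+
  obtain cs1 cs2 where split: "cs = cs1 @ c # cs2" using assms(2) cs(2) by (metis split_list)
  have "Suc (length cs1 + length cs2) = s" using length_color_order[OF order] split by simp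
  then show ?thesis using that[of x y cs1 cs2] xy cs unfolding gd split by auto
qed

lemma thr_times_power: "i + j = s - 1 \<Longrightarrow> D ^ j * thr i \<le> D ^ (s - 1)"
proof -
  assume ij: "i + j = s - 1"
  have n\<nu>: "\<nu> \<le> n"
    using self_le_power[OF \<nu>(1), of "2 * m"] m2 unfolding \<nu>(2) by simp
  have "D ^ j * (D ^ i * (\<nu> / n)) \<le> D ^ j * (D ^ i * 1)"
    using n\<nu> n0 D1 by (intro mult_left_mono) (auto simp: field_simps)
  also have "\<dots> = D ^ (s - 1)" unfolding ij[symmetric] by (simp add: power_add)
  finally have "D ^ j * (D ^ i * (\<nu> / n)) \<le> D ^ (s - 1)" .
  moreover have "D ^ j \<le> D ^ (s - 1)" using ij D1 by (intro power_increasing) auto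
  ultimately show "D ^ j * thr i \<le> D ^ (s - 1)" unfolding thr_def by (simp add: max_def)
qed

lemma Ds: "D ^ (s - 1) * D = D ^ s"
  using s3 by (cases s) auto

text \<open>A charge contains one power of D less than F0, and \<open>D \<ge> \<nu>\<close>
  outweighs \<open>ln n\<close>.\<close>

lemma charge_small:
  assumes g: "g \<in> goals" and e: "e \<in> rc_board s n"
  shows "4 * ln n / F0 * charge g M e \<le> 1 / 4"
proof -
  obtain c t t' where ed: "e = (c, {t, t'})" "c \<in> {1..s}" "t \<in> {1..n}" "t' \<in> {1..n}" "t \<noteq> t'"
    using e by (rule rc_boardE)
  obtain x y cs1 cs2 where gd: "g = (x, y, cs1 @ c # cs2)" and xy: "x \<in> {1..n}" "y \<in> {1..n}"
    and cs: "distinct (cs1 @ c # cs2)" "set cs1 \<subseteq> {1..s}" "set cs2 \<subseteq> {1..s}" and len: "Suc (length cs1 + length cs2) = s"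
    using g ed(2) by (rule goalE)
  have dist: "distinct cs1" "distinct cs2" using cs(1) by auto
  let ?i = "length cs1" and ?j = "length cs2"
  have ij: "?i + ?j = s - 1" "?j + ?i = s - 1" "s - 1 - ?i = ?j" using len by auto
  have part: "2 * K\<^sup>2 * \<gamma> * D ^ l / n * z \<le> 4 * K ^ 3 * (D ^ (s - 1) / n)"
    if z: "z \<le> 2 * (K * thr k)" and k: "k + l = s - 1" for z k l
  proof -
    have "2 * K\<^sup>2 * \<gamma> * D ^ l / n * z \<le> 2 * K\<^sup>2 * 1 * D ^ l / n * (2 * (K * thr k))"
    proof (rule order_trans[OF mult_left_mono[OF z]])
      show "2 * K\<^sup>2 * \<gamma> * D ^ l / n * (2 * (K * thr k)) \<le> 2 * K\<^sup>2 * 1 * D ^ l / n * (2 * (K * thr k))"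
        using \<gamma> D1 K1 thr1[of k] by (intro mult_right_mono divide_right_mono mult_left_mono) auto
    qed (use \<gamma> D1 in simp)
    also have "\<dots> = 4 * K ^ 3 * (D ^ l * thr k / n)" by (simp add: power2_eq_square power3_eq_cube)
    also have "\<dots> \<le> 4 * K ^ 3 * (D ^ (s - 1) / n)"
      using thr_times_power[OF k] K1 by (intro mult_left_mono divide_right_mono) auto
    finally show ?thesis .
  qed
  have pos: "0 \<le> 4 * K ^ 3 * (D ^ (s - 1) / n)" using K1 D1 by simp
  have sums: "(\<Sum>a\<in>{t, t'}. wsum M cs1 x a) \<le> 2 * (K * thr ?i)"
    "(\<Sum>a\<in>{t, t'}. wsum M cs2 a y) \<le> 2 * (K * thr ?j)"
    using walk_wt_bound[OF xy(1) ed(3) dist(1) cs(2)] walk_wt_bound[OF xy(1) ed(4) dist(1) cs(2)]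
      walk_wt_bound[OF ed(3) xy(2) dist(2) cs(3)] walk_wt_bound[OF ed(4) xy(2) dist(2) cs(3)] ed(5)
    by simp_all
  have "charge g M e = charge_at cs1 cs2 x y M {t, t'}" unfolding gd ed(1) by (rule charge_eq[OF cs(1)])
  also have "\<dots> \<le> 4 * K ^ 3 * (D ^ (s - 1) / n) + 4 * K ^ 3 * (D ^ (s - 1) / n)"
    unfolding charge_at_def ij(3) using part[OF sums(1) ij(1)] part[OF sums(2) ij(2)] pos
    by (intro add_mono) simp_all
  finally have "charge g M e \<le> 8 * K ^ 3 * (D ^ (s - 1) / n)" by simp
  also have "D ^ (s - 1) / n \<le> D ^ s / n / \<nu>"
  proof -
    have "D ^ (s - 1) * \<nu> \<le> D ^ s" unfolding Ds[symmetric] using D1 by (intro mult_left_mono) auto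
    then show ?thesis using n0 \<nu> by (simp add: field_simps)
  qed
  finally have "charge g M e \<le> 8 * K ^ 3 * (D ^ s / n / \<nu>)" using K1 by simp
  then have "4 * ln n / F0 * charge g M e \<le> 4 * ln n / F0 * (8 * K ^ 3 * (D ^ s / n / \<nu>))"
    using F0_pos ln_n by (intro mult_left_mono) auto
  also have "\<dots> = (32 * K ^ 3 * ln n) / (cF * \<nu>)" unfolding lam_mult by simp
  also have "\<dots> \<le> 1 / 4" using ln_K_bound cF0 \<nu> by (simp add: pos_divide_le_eq)
  finally show ?thesis .
qed

text \<open>Adding up the bound behind \<open>charge_small\<close> would lose a factor of order n.
  Instead the sum over the edges becomes a sum over their ends, where row or column sums of the walk
  matrices give the correct order \<open>D ^ (s - 1)\<close>.\<close>

lemma charge_sum_color: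
  assumes g: "g \<in> goals" and c: "c \<in> {1..s}"
  shows "(\<Sum>e\<in>{e\<in>rc_board s n. fst e = c}. charge g M e) \<le> 4 * K\<^sup>2 * \<gamma> * 4 ^ s * D ^ (s - 1)"
proof -
  obtain x y cs1 cs2 where gd: "g = (x, y, cs1 @ c # cs2)" and xy: "x \<in> {1..n}" "y \<in> {1..n}"
    and cs: "distinct (cs1 @ c # cs2)" "set cs1 \<subseteq> {1..s}" "set cs2 \<subseteq> {1..s}" and len: "Suc (length cs1 + length cs2) = s"
    using g c by (rule goalE)
  let ?i = "length cs1" and ?j = "length cs2" and ?E = "{e\<in>rc_board s n. fst e = c}"
  have ij: "s - 1 - ?i = ?j" using len by auto
  have star: "(\<Sum>w\<in>{1..n}. wt M (c', {u, w})) \<le> 4 * D" if "c' \<in> {1..s}" "u \<in> {1..n}" for c' u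
  proof -
    have "0 \<le> 1 / (2 * real b + 1)" using p_bounds(1) by simp
    from sum_star_weight[OF MX this degree_bound[OF that]] show ?thesis using p_bounds(3) D1(1) by linarith
  qed
  have part: "(\<Sum>e\<in>?E. 2 * K\<^sup>2 * \<gamma> * D ^ l / n * (\<Sum>t\<in>snd e. h t)) \<le> 2 * K\<^sup>2 * \<gamma> * 4 ^ s * D ^ (s - 1)"
    if h: "\<And>t. 0 \<le> h t" "(\<Sum>t\<in>{1..n}. h t) \<le> (4 * D) ^ k" and k: "k + l = s - 1" for h k l
  proof -
    have "(\<Sum>e\<in>?E. 2 * K\<^sup>2 * \<gamma> * D ^ l / n * (\<Sum>t\<in>snd e. h t)) = 2 * K\<^sup>2 * \<gamma> * D ^ l / n * (\<Sum>e\<in>?E. \<Sum>t\<in>snd e. h t)"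
      by (rule sum_distrib_left[symmetric])
    also have "\<dots> \<le> 2 * K\<^sup>2 * \<gamma> * D ^ l / n * (n * (4 * D) ^ k)"
    proof (rule mult_left_mono)
      have "n * (\<Sum>t\<in>{1..n}. h t) \<le> n * (4 * D) ^ k" using h(2) by (intro mult_left_mono) auto
      moreover have "(\<Sum>e\<in>?E. \<Sum>t\<in>snd e. h t) \<le> n * (\<Sum>t\<in>{1..n}. h t)"
        by (rule sum_over_edges_of_color) (rule h(1))
      ultimately show "(\<Sum>e\<in>?E. \<Sum>t\<in>snd e. h t) \<le> n * (4 * D) ^ k" by linarith
    qed (use \<gamma> D1 in simp)
    also have "\<dots> = 2 * K\<^sup>2 * \<gamma> * (4 ^ k * D ^ (s - 1))"
      unfolding k[symmetric] using n0 by (simp add: power_mult_distrib power_add)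
    also have "\<dots> \<le> 2 * K\<^sup>2 * \<gamma> * (4 ^ s * D ^ (s - 1))"
      using k \<gamma> D1 by (intro mult_left_mono mult_right_mono power_increasing) auto
    finally show ?thesis by (simp add: mult.assoc)
  qed
  have pos: "0 \<le> 2 * K\<^sup>2 * \<gamma> * 4 ^ s * D ^ (s - 1)" using \<gamma> D1 by simp
  have 1: "(\<Sum>e\<in>?E. if ?i < s - m then 2 * K\<^sup>2 * \<gamma> * D ^ ?j / n * (\<Sum>t\<in>snd e. wsum M cs1 x t) else 0)
      \<le> 2 * K\<^sup>2 * \<gamma> * 4 ^ s * D ^ (s - 1)"
  proof (cases "?i < s - m")
    case True
    have "(\<Sum>t\<in>{1..n}. wsum M cs1 x t) \<le> (4 * D) ^ ?i"
      by (rule walk_sum_row[OF wt_nonneg star xy(1)]) (use cs(2) in \<open>simp_all only: subset_iff\<close>)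
    then show ?thesis unfolding if_P[OF True] by (rule part[OF walk_wt_nonneg]) (use len in simp)
  next
    case False
    show ?thesis unfolding if_not_P[OF False] using pos by simp
  qed
  have 2: "(\<Sum>e\<in>?E. if m \<le> ?i then 2 * K\<^sup>2 * \<gamma> * D ^ ?i / n * (\<Sum>t\<in>snd e. wsum M cs2 t y) else 0)
      \<le> 2 * K\<^sup>2 * \<gamma> * 4 ^ s * D ^ (s - 1)"
  proof (cases "m \<le> ?i")
    case True
    have "(\<Sum>t\<in>{1..n}. wsum M cs2 t y) \<le> (4 * D) ^ ?j"
      by (rule walk_sum_column[OF wt_nonneg star xy(2)]) (use cs(3) in \<open>simp_all only: subset_iff\<close>)
    then show ?thesis unfolding if_P[OF True] by (rule part[OF walk_wt_nonneg]) (use len in simp)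
  next
    case False
    show ?thesis unfolding if_not_P[OF False] using pos by simp
  qed
  have "(\<Sum>e\<in>?E. charge g M e) = (\<Sum>e\<in>?E. charge_at cs1 cs2 x y M (snd e))"
  proof (rule sum.cong[OF refl])
    fix e assume "e \<in> ?E"
    then obtain V where e: "e = (c, V)" by (cases e) auto
    show "charge g M e = charge_at cs1 cs2 x y M (snd e)"
      unfolding gd e snd_conv by (rule charge_eq[OF cs(1)])
  qed
  also have "\<dots> = (\<Sum>e\<in>?E. if ?i < s - m then 2 * K\<^sup>2 * \<gamma> * D ^ ?j / n * (\<Sum>t\<in>snd e. wsum M cs1 x t) else 0)
     + (\<Sum>e\<in>?E. if m \<le> ?i then 2 * K\<^sup>2 * \<gamma> * D ^ ?i / n * (\<Sum>t\<in>snd e. wsum M cs2 t y) else 0)"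
    unfolding charge_at_def ij by (rule sum.distrib)
  finally show ?thesis using 1 2 by simp
qed

text \<open>Even if Breaker claimed the whole board, the charges would add up to a multiple of
  \<open>\<gamma> * D ^ s / n\<close>. This is the place that decides how small \<gamma> must
  be.\<close>

lemma Q_small:
  assumes g: "g \<in> goals"
  shows "Q g M Bk \<le> F0 / 16"
proof -
  let ?E = "\<lambda>c. {e\<in>rc_board s n. fst e = c}"
  have "(\<Sum>e\<in>Bk. charge g M e) \<le> (\<Sum>e\<in>rc_board s n. charge g M e)"
    using BX tau_nonneg by (intro sum_mono2) auto
  also have "rc_board s n = (\<Union>c\<in>{1..s}. ?E c)" using fst_rc_board[of _ s n] by blast
  also have "(\<Sum>e\<in>(\<Union>c\<in>{1..s}. ?E c). charge g M e) = (\<Sum>c\<in>{1..s}. \<Sum>e\<in>?E c. charge g M e)"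
    by (intro sum.UNION_disjoint) auto
  also have "\<dots> \<le> (\<Sum>c\<in>{1..s}. 4 * K\<^sup>2 * \<gamma> * 4 ^ s * D ^ (s - 1))"
    by (intro sum_mono charge_sum_color g)
  also have "\<dots> = s * (4 * K\<^sup>2 * \<gamma> * 4 ^ s * D ^ (s - 1))" by simp
  finally have "Q g M Bk \<le> 3 * p * (s * (4 * K\<^sup>2 * \<gamma> * 4 ^ s * D ^ (s - 1)))"
    unfolding Q_def using p by (intro mult_left_mono) auto
  also have "\<dots> \<le> 3 * (D / (2 * n)) * (s * (4 * K\<^sup>2 * \<gamma> * 4 ^ s * D ^ (s - 1)))"
  proof (intro mult_right_mono mult_left_mono)
    show "p \<le> D / (2 * n)" using p_bounds(3) n0 unfolding p_eq by (simp add: field_simps)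
  qed (use \<gamma> D1 in auto)
  also have "\<dots> = (6 * s * 4 ^ s * K\<^sup>2 * \<gamma>) * (D ^ s / n)"
    unfolding Ds[symmetric] using n0 by (simp add: field_simps)
  also have "\<dots> \<le> (cF / 16) * (D ^ s / n)"
  proof (rule mult_right_mono)
    have "96 * s * 4 ^ s * K\<^sup>2 * \<gamma> \<le> cF" using \<gamma>_small unfolding K_def cF_def .
    then show "6 * s * 4 ^ s * K\<^sup>2 * \<gamma> \<le> cF / 16" by linarith
  qed (use D1 in simp)
  finally show ?thesis unfolding F0_def by simp
qed

text \<open>A path of positive weight uses no edge of Breaker, so it is complete or is counted by
  \<open>through\<close> at one of its free edges.\<close>

lemma F_le_complete:
  "F g M Bk \<le> card {vs\<in>paths g. edges_of g vs \<subseteq> M} + (\<Sum>e\<in>rc_board s n - (M \<union> Bk). through g M Bk {e})"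
  if g: "g \<in> goals"
proof -
  let ?free = "rc_board s n - (M \<union> Bk)" and ?w = "\<lambda>vs. set_weight p M Bk (edges_of g vs)"
  have w: "?w vs \<ge> 0" for vs using p by (intro set_weight_nonneg) simp
  obtain x y cs where gd: "g = (x, y, cs)" by (cases g)
  have order: "cs \<in> color_orders s" using g unfolding gd goals_def by simp
  have cs: "set cs = {1..s}" "length cs = s"
    using order length_color_order[OF order] unfolding color_orders_def by blast+
  have pt: "?w vs \<le> (if edges_of g vs \<subseteq> M then 1 else 0) + (\<Sum>e\<in>?free. if {e} \<subseteq> edges_of g vs then ?w vs else 0)"
    if vs: "vs \<in> paths g" for vs
  proof -
    have sum0: "0 \<le> (\<Sum>e\<in>?free. if {e} \<subseteq> edges_of g vs then ?w vs else 0)" using w by (intro sum_nonneg) simp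
    have fin: "finite (edges_of g vs)" unfolding edges_of_def by simp
    consider "edges_of g vs \<subseteq> M" | e where "e \<in> edges_of g vs" "e \<notin> M" "e \<in> Bk" | e where "e \<in> edges_of g vs" "e \<notin> M" "e \<notin> Bk"
      by blast
    then show ?thesis
    proof cases
      case 1
      then show ?thesis using sum0 set_weight_subset[OF fin 1] by simp
    next
      case 2
      have "?w vs = 0" unfolding set_weight_def using 2 fin by (intro prod_zero) (auto simp: elem_weight_def)
      then show ?thesis using sum0 by simp
    next
      case 3
      obtain j where j: "j < s" "e = (cs ! j, {vs ! j, vs ! Suc j})"
        using 3(1) cs(2) unfolding gd edges_of_def path_edges_def by auto
      have len: "length vs = Suc s" "distinct vs" "set vs \<subseteq> {1..n}"
        using vs unfolding paths_def walks_def by auto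
      have "cs ! j \<in> {1..s}" using cs j nth_mem by blast
      moreover have "vs ! j \<in> {1..n}" "vs ! Suc j \<in> {1..n}"
      proof -
        have "vs ! j \<in> set vs" "vs ! Suc j \<in> set vs" using len(1) j(1) by simp_all
        then show "vs ! j \<in> {1..n}" "vs ! Suc j \<in> {1..n}" using len(3) by blast+
      qed
      moreover have "vs ! j \<noteq> vs ! Suc j" using len j by (simp add: nth_eq_iff_index_eq)
      ultimately have "e \<in> rc_board s n" unfolding j(2) rc_board_def by blast
      then have "e \<in> ?free" using 3 by simp
      then have "(if {e} \<subseteq> edges_of g vs then ?w vs else 0) \<le> (\<Sum>e\<in>?free. if {e} \<subseteq> edges_of g vs then ?w vs else 0)"
        using w by (intro member_le_sum) auto
      then show ?thesis using 3(1) by simp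
    qed
  qed
  have "F g M Bk \<le> (\<Sum>vs\<in>paths g. (if edges_of g vs \<subseteq> M then 1 else 0) + (\<Sum>e\<in>?free. if {e} \<subseteq> edges_of g vs then ?w vs else 0))"
    unfolding F_def by (intro sum_mono pt)
  also have "\<dots> = (\<Sum>vs\<in>paths g. if edges_of g vs \<subseteq> M then 1 else 0) + (\<Sum>e\<in>?free. through g M Bk {e})"
    unfolding through_def sum.distrib by (simp only: sum.swap[of _ ?free])
  also have "(\<Sum>vs\<in>paths g. if edges_of g vs \<subseteq> M then 1 else 0) = real (card {vs\<in>paths g. edges_of g vs \<subseteq> M})"
    using fin(4)[of g] by (simp add: sum.If_cases Int_def)
  finally show ?thesis .
qed

text \<open>The potential forces \<open>F + Q \<ge> F0 / 4\<close>. The charge Q and the paths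
  through the at most b free edges account for at most \<open>F0 / 16\<close> each, which leaves
  \<open>F0 / 8\<close>.\<close>

lemma many_complete_paths:
  assumes g: "g \<in> goals" and free: "card (rc_board s n - (M \<union> Bk)) \<le> b"
  shows "F0 / 8 \<le> card {vs\<in>paths g. edges_of g vs \<subseteq> M}"
proof -
  let ?free = "rc_board s n - (M \<union> Bk)"
  have "goal_potential g M Bk \<le> 1 / n" using Phi_ge(1)[OF g, of M Bk] small by linarith
  also have "\<dots> = exp (- ln n)" using n0 by (simp add: exp_minus inverse_eq_divide)
  finally have "ln n \<le> 4 * ln n / F0 * (F g M Bk + Q g M Bk)" unfolding goal_potential_def by simp
  then have "1 * ln n \<le> (4 / F0 * (F g M Bk + Q g M Bk)) * ln n" by (simp add: algebra_simps)
  then have "1 \<le> 4 / F0 * (F g M Bk + Q g M Bk)" by (rule mult_right_le_imp_le) (use ln_n in linarith)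
  then have "F0 / 4 \<le> F g M Bk + Q g M Bk" using F0_pos by (simp add: field_simps)
  moreover have "(\<Sum>e\<in>?free. through g M Bk {e}) \<le> F0 / 16"
  proof -
    have "(\<Sum>e\<in>?free. through g M Bk {e}) \<le> real (card ?free) * (p * (2 * (K\<^sup>2 * (D ^ s / n / \<nu>))))"
      by (intro sum_bounded_above through_edge_bound g)
    also have "\<dots> \<le> real b * (p * (2 * (K\<^sup>2 * (D ^ s / n / \<nu>))))"
      using free p \<nu> D1 by (intro mult_right_mono) auto
    also have "\<dots> = (p * b) * (2 * (K\<^sup>2 * (D ^ s / n / \<nu>)))" by simp
    also have "\<dots> \<le> (1 / 2) * (2 * (K\<^sup>2 * (D ^ s / n / \<nu>)))"
      using p(4) \<nu> D1 by (intro mult_right_mono) auto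
    also have "\<dots> = (K\<^sup>2 / \<nu>) * (D ^ s / n)" by simp
    also have "\<dots> \<le> (cF / 16) * (D ^ s / n)"
    proof (rule mult_right_mono)
      have "K\<^sup>2 \<le> K ^ 3" using K1 by (intro power_increasing) auto
      then have "16 * K\<^sup>2 * 1 \<le> 128 * K ^ 3 * ln n" using ln_n K1 by (intro mult_mono) auto
      then have "16 * K\<^sup>2 \<le> cF * \<nu>" using ln_K_bound by linarith
      then show "K\<^sup>2 / \<nu> \<le> cF / 16" using \<nu>(1) by (simp add: pos_divide_le_eq)
    qed (use D1 in simp)
    finally show ?thesis unfolding F0_def by simp
  qed
  ultimately show ?thesis using F_le_complete[OF g] Q_small[OF g] by linarith
qed

end

section \<open>The initial potential\<close>

lemma F0_eq: "F0 = (real n / 2) ^ (s - 1) * (1 / (3 * real b)) ^ s"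
proof -
  have "real n ^ s = real n ^ (s - 1) * n" using s3 by (cases s) auto
  then have "D ^ s / n = real n ^ (s - 1) / real b ^ s" unfolding D_def using n0 by (simp add: power_divide)
  then show ?thesis unfolding F0_def cF_def by (simp add: power_divide power_mult_distrib)
qed

lemma goal_potential_initial:
  assumes g: "g \<in> goals"
  shows "goal_potential g {} {} \<le> 1 / real n ^ 4"
proof -
  obtain x y cs where gd: "g = (x, y, cs)" by (cases g)
  have xy: "x \<in> {1..n}" "y \<in> {1..n}" "x \<noteq> y" and order: "cs \<in> color_orders s"
    using g unfolding gd goals_def by simp_all
  have cs: "distinct cs" "length cs = s"
    using order length_color_order[OF order] unfolding color_orders_def by blast+
  have s1: "s \<ge> 1" using s3 by simp
  have "F0 \<le> real (card (paths g)) * p ^ s"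
    unfolding F0_eq
  proof (rule mult_mono)
    show "(real n / 2) ^ (s - 1) \<le> real (card (paths g))"
      using card_paths_ge[OF xy s1 n2s] unfolding gd paths_def by simp
    show "(1 / (3 * real b)) ^ s \<le> p ^ s"
      unfolding p_def using b1 by (intro power_mono) (auto simp: field_simps)
  qed auto
  also have "\<dots> = F g {} {}"
    unfolding F_def set_weight_empty gd edges_of_def using cs by (simp add: card_path_edges)
  finally have "1 \<le> F g {} {} / F0" using F0_pos by simp
  then have "4 * ln n * 1 \<le> 4 * ln n * (F g {} {} / F0)" using ln_n by (intro mult_left_mono) auto
  then have "goal_potential g {} {} \<le> exp (- (4 * ln n))"
    unfolding goal_potential_def Q_def by simp
  also have "\<dots> = 1 / real n ^ 4"
  proof -
    have "exp (4 * ln n) = real n ^ 4" using exp_of_nat_mult[of 4 "ln n"] n0 by simp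
    then show ?thesis by (simp add: exp_minus inverse_eq_divide)
  qed
  finally show ?thesis .
qed

text \<open>The expected number of walks of length k is of order \<open>D ^ k / n\<close>, below
  \<open>thr k\<close> by the factor \<nu>. Each of the r disjoint walks contributes this factor,
  and \<open>\<nu> ^ r = n ^ 4\<close> because \<open>r = 8 * m\<close>.\<close>

lemma family_potential_initial:
  assumes g: "g \<in> {1..n} \<times> {1..n} \<times> color_lists s"
  defines "W \<equiv> walks n (length (snd (snd g))) (fst g) (fst (snd g))"
  defines "S \<equiv> {P. P \<subseteq> W \<and> card P = r \<and> edge_disjoint (snd (snd g)) P}"
  shows "(\<Sum>P\<in>S. family_weight (g, P) * set_weight q {} {} (family_edges (g, P))) \<le> (real (r * s) ^ s) ^ r / real n ^ 4"
proof -
  define k where "k = length (snd (snd g))"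
  have ds: "snd (snd g) \<in> color_lists s" and u: "fst g \<in> {1..n}" using g by auto
  have k: "k \<le> s" "k \<ge> 1"
    using length_color_list[OF ds] ds unfolding k_def color_lists_def by (auto simp: Suc_le_eq)
  have b0: "real b > 0" using b1 by simp
  have "family_weight (g, P) * set_weight q {} {} (family_edges (g, P)) = (q ^ k / thr k) ^ r" if "P \<in> S" for P
  proof -
    have "(g, P) \<in> families" using that g unfolding families_def S_def W_def by blast
    from edges_of_family(2)[OF this] show ?thesis
      unfolding family_weight_def set_weight_empty k_def fst_conv
      by (simp add: power_mult[symmetric] mult.commute power_divide)
  qed
  then have "(\<Sum>P\<in>S. family_weight (g, P) * set_weight q {} {} (family_edges (g, P))) = real (card S) * (q ^ k / thr k) ^ r"
    by simp
  also have "\<dots> \<le> (real n ^ (k - 1)) ^ r * (q ^ k / thr k) ^ r"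
  proof (rule mult_right_mono)
    have "card S \<le> card W ^ r" unfolding S_def by (rule card_subfamilies_le(2)) (simp add: W_def)
    also have "\<dots> \<le> (n ^ (k - 1)) ^ r"
      using card_walks_le[OF u k(2)] unfolding W_def k_def by (intro power_mono) auto
    finally show "real (card S) \<le> (real n ^ (k - 1)) ^ r" by (metis of_nat_le_iff of_nat_power)
  qed (use q thr1[of k] in simp)
  also have "\<dots> = (real n ^ (k - 1) * q ^ k / thr k) ^ r" by (simp add: power_mult_distrib power_divide)
  also have "\<dots> \<le> (real (r * s) ^ s / \<nu>) ^ r"
  proof (rule power_mono)
    have "real (r * s) / (b + real (r * s)) \<le> real (r * s) / b"
    proof (intro divide_left_mono mult_pos_pos b0)
      show "0 < real b + real (r * s)" using b0 of_nat_0_le_iff[of "r * s"] by linarith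
    qed simp_all
    then have "q ^ k \<le> (real (r * s) / b) ^ k"
      using q(1) unfolding q_def by (intro power_mono) auto
    then have "real n ^ (k - 1) * q ^ k \<le> real n ^ (k - 1) * (real (r * s) / b) ^ k"
      by (intro mult_left_mono) auto
    also have "\<dots> = real (r * s) ^ k * (D ^ k / n)"
    proof -
      have "real n ^ k = real n ^ (k - 1) * n" using k by (cases k) auto
      then have "D ^ k / n = real n ^ (k - 1) / real b ^ k" unfolding D_def using n0 by (simp add: power_divide)
      then show ?thesis by (simp add: power_divide power_mult_distrib)
    qed
    also have "\<dots> \<le> real (r * s) ^ s * (thr k / \<nu>)"
    proof (rule mult_mono)
      have "1 \<le> r * s" using r1 s3 by simp
      then have "real 1 \<le> real (r * s)" by (rule of_nat_mono)
      then have "1 \<le> real (r * s)" by (simp only: of_nat_1)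
      then show "real (r * s) ^ k \<le> real (r * s) ^ s" by (rule power_increasing[OF k(1)])
      have "D ^ k / n * \<nu> = D ^ k * (\<nu> / n)" by simp
      also have "\<dots> \<le> thr k" unfolding thr_def by (rule max.cobounded2)
      finally show "D ^ k / n \<le> thr k / \<nu>" using \<nu>(1) by (subst pos_le_divide_eq) simp_all
    qed (use D1 in auto)
    finally have "real n ^ (k - 1) * q ^ k / thr k \<le> real (r * s) ^ s * (thr k / \<nu>) / thr k"
      using thr1[of k] by (intro divide_right_mono) auto
    also have "\<dots> = real (r * s) ^ s / \<nu>" using thr1[of k] by simp
    finally show "real n ^ (k - 1) * q ^ k / thr k \<le> real (r * s) ^ s / \<nu>" .
  qed (use q thr1[of k] in simp)
  also have "\<dots> = (real (r * s) ^ s) ^ r / \<nu> ^ r" by (rule power_divide)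
  also have "\<nu> ^ r = real n ^ 4"
  proof -
    have "\<nu> ^ (2 * m * 4) = (\<nu> ^ (2 * m)) ^ 4" by (rule power_mult)
    moreover have "2 * m * 4 = r" unfolding r by simp
    ultimately show ?thesis unfolding \<nu>(2) by simp
  qed
  finally show ?thesis .
qed

lemma Phi_initial: "Phi {} {} \<le> 1 / n"
proof -
  let ?CO = "real (card (color_orders s))" and ?CL = "real (card (color_lists s))" and ?B = "(real (r * s) ^ s) ^ r"
  let ?n4 = "1 / real n ^ 4"
  have "(\<Sum>g\<in>goals. goal_potential g {} {}) \<le> real (card goals) * ?n4"
    by (intro sum_bounded_above goal_potential_initial)
  also have "\<dots> \<le> (real n ^ 2 * ?CO) * ?n4"
  proof (rule mult_right_mono)
    show "real (card goals) \<le> real n ^ 2 * ?CO"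
      using card_goals by (metis of_nat_le_iff of_nat_mult of_nat_power)
  qed simp
  finally have 1: "(\<Sum>g\<in>goals. goal_potential g {} {}) \<le> (real n ^ 2 * ?CO) * ?n4" .
  have "(\<Sum>h\<in>families. family_weight h * set_weight q {} {} (family_edges h)) =
     (\<Sum>g\<in>{1..n} \<times> {1..n} \<times> color_lists s. \<Sum>P\<in>{P. P \<subseteq> walks n (length (snd (snd g))) (fst g) (fst (snd g)) \<and> card P = r \<and>
       edge_disjoint (snd (snd g)) P}. family_weight (g, P) * set_weight q {} {} (family_edges (g, P)))"
    unfolding families_def using finite_color_lists(1)[of s] card_subfamilies_le(1)[OF finite_walks]
    by (subst sum.Sigma) (auto simp: case_prod_unfold)
  also have "\<dots> \<le> real (card ({1..n} \<times> {1..n} \<times> color_lists s)) * (?B / real n ^ 4)"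
    by (intro sum_bounded_above family_potential_initial)
  also have "\<dots> = (real n ^ 2 * (?CL * ?B)) * ?n4"
    by (simp add: card_cartesian_product power2_eq_square)
  finally have 2: "(\<Sum>h\<in>families. family_weight h * set_weight q {} {} (family_edges h)) \<le> (real n ^ 2 * (?CL * ?B)) * ?n4" .
  have "(\<Sum>d\<in>{1..s} \<times> {1..n}. deg_potential d {} {}) = (real n * s) * ?n4"
    unfolding deg_potential_def by (simp add: card_cartesian_product)
  also have "\<dots> \<le> (real n ^ 2 * s) * ?n4"
    using n0 by (intro mult_right_mono) (auto simp: power2_eq_square)
  finally have 3: "(\<Sum>d\<in>{1..s} \<times> {1..n}. deg_potential d {} {}) \<le> (real n ^ 2 * s) * ?n4" .
  have "Phi {} {} \<le> (real n ^ 2 * ?CO) * ?n4 + (real n ^ 2 * (?CL * ?B)) * ?n4 + (real n ^ 2 * s) * ?n4"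
    unfolding Phi_def by (intro add_mono 1 2 3)
  also have "\<dots> = (?CO + ?CL * ?B + s) * (real n ^ 2 * ?n4)" by (simp add: algebra_simps)
  also have "\<dots> \<le> n * (real n ^ 2 * ?n4)" using n_init by (intro mult_right_mono) auto
  also have "\<dots> = 1 / n" using n0 by (simp add: power2_eq_square power4_eq_xxxx)
  finally show ?thesis .
qed

section \<open>Maker's strategy and the number of paths\<close>

definition many_paths :: "colored_edge set \<Rightarrow> bool" where
  "many_paths M \<longleftrightarrow> (\<forall>g\<in>goals. F0 / 8 \<le> card {vs\<in>paths g. edges_of g vs \<subseteq> M})"

lemma many_paths_mono:
  assumes "many_paths M" "M \<subseteq> M'"
  shows "many_paths M'"
  unfolding many_paths_def
proof
  fix g assume "g \<in> goals"
  have "card {vs\<in>paths g. edges_of g vs \<subseteq> M} \<le> card {vs\<in>paths g. edges_of g vs \<subseteq> M'}"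
    using assms(2) by (intro card_mono) (auto simp: fin(4))
  then show "F0 / 8 \<le> card {vs\<in>paths g. edges_of g vs \<subseteq> M'}"
    using assms(1) \<open>g \<in> goals\<close> unfolding many_paths_def by fastforce
qed

text \<open>\<open>Phi_round\<close> covers full rounds only. The disjunction in the invariant
  handles the end of the game: once at most b elements are free, enough paths are already complete,
  and any further moves preserve that.\<close>

lemma maker_forces_many_paths:
  "maker_forces (rc_board s n) b (\<lambda>M. M \<subseteq> rc_board s n \<and> many_paths M) True {} {}"
proof -
  let ?X = "rc_board s n"
  define Inv where "Inv M Bk \<longleftrightarrow> M \<subseteq> ?X \<and> Bk \<subseteq> ?X \<and>
    (Phi M Bk \<le> 1 / n \<or> many_paths M)" for M Bk
  have late: "many_paths M" if "M \<subseteq> ?X" "Bk \<subseteq> ?X" "Phi M Bk \<le> 1 / n" "card (?X - (M \<union> Bk)) \<le> b" for M Bk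
    unfolding many_paths_def using many_complete_paths[OF that(1-3) _ that(4)] by blast
  show ?thesis
  proof (rule maker_forces_invariant[where Inv = Inv])
    show "finite ?X" by simp
    show "Inv {} {}" unfolding Inv_def using Phi_initial by simp
    show "M \<subseteq> ?X \<and> many_paths M" if "Inv M Bk" "?X - (M \<union> Bk) = {}" for M Bk
    proof -
      have "card (?X - (M \<union> Bk)) \<le> b" unfolding that(2) by simp
      then show ?thesis using late[of M Bk] that(1) unfolding Inv_def by blast
    qed
    show "\<exists>e\<in>?X - (M \<union> Bk). \<forall>S\<subseteq>?X - (insert e M \<union> Bk).
        card S = min b (card (?X - (insert e M \<union> Bk))) \<longrightarrow> Inv (insert e M) (Bk \<union> S)"
      if inv: "Inv M Bk" and free: "?X - (M \<union> Bk) \<noteq> {}" for M Bk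
    proof -
      have sub: "M \<subseteq> ?X" "Bk \<subseteq> ?X" using inv unfolding Inv_def by simp_all
      show ?thesis
      proof (cases "many_paths M")
        case True
        obtain e where e: "e \<in> ?X - (M \<union> Bk)" using free by blast
        have "many_paths (insert e M)" by (rule many_paths_mono[OF True]) blast
        then show ?thesis using e sub unfolding Inv_def by (intro bexI[OF _ e]) blast
      next
        case False
        have small: "Phi M Bk \<le> 1 / n" using inv False unfolding Inv_def by simp
        \<comment> \<open>More than b free elements before Maker's move leave at least b after it,
          so Breaker's answer has exactly b elements.\<close>
        have big: "b < card (?X - (M \<union> Bk))" using late[OF sub small] False by linarith
        obtain e where e: "e \<in> ?X - (M \<union> Bk)"
          and step: "\<And>S. S \<subseteq> ?X - (insert e M \<union> Bk) \<Longrightarrow> card S = b \<Longrightarrow> Phi (insert e M) (Bk \<union> S) \<le> Phi M Bk"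
          using Phi_round[OF sub free through_two_edges[OF sub small] through_edge_small[OF sub small] charge_small[OF sub small]]
          by blast
        have "?X - (insert e M \<union> Bk) = (?X - (M \<union> Bk)) - {e}" by blast
        then have "card (?X - (insert e M \<union> Bk)) = card (?X - (M \<union> Bk)) - 1"
          using e by (simp only: card_Diff_singleton)
        then have bmin: "min b (card (?X - (insert e M \<union> Bk))) = b" using big by linarith
        have "Inv (insert e M) (Bk \<union> S)" if S: "S \<subseteq> ?X - (insert e M \<union> Bk)" "card S = b" for S
        proof -
          have "Phi (insert e M) (Bk \<union> S) \<le> 1 / n" using step[OF S] small by linarith
          moreover have "insert e M \<subseteq> ?X" "Bk \<union> S \<subseteq> ?X" using e sub S(1) by blast+
          ultimately show ?thesis unfolding Inv_def by simp
        qed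
        then show ?thesis by (intro bexI[OF _ e] allI impI) (simp only: bmin)
      qed
    qed
  qed
qed

lemma num_ordered_paths_ge:
  assumes M: "M \<subseteq> rc_board s n" and many: "many_paths M"
    and xy: "x \<in> {1..n}" "y \<in> {1..n}" "x \<noteq> y" and cs: "distinct cs" "set cs = {1..s}"
  shows "cF / 8 * real n ^ (s - 1) / real b ^ s \<le> real (num_ordered_paths M x y cs)"
proof -
  let ?R = "{vs. rainbow_path M vs cs \<and> hd vs = x \<and> last vs = y}"
  have g: "(x, y, cs) \<in> goals" using xy cs unfolding goals_def color_orders_def by simp
  have len: "length cs = s" using length_color_order cs unfolding color_orders_def by blast
  \<comment> \<open>Finiteness matters: \<open>num_ordered_paths\<close> is a \<open>card\<close>,
    which would be 0 for an infinite set. All vertices lie in [n] since they are on edges of the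
    board.\<close>
  have "?R \<subseteq> {vs. set vs \<subseteq> {1..n} \<and> length vs = Suc s}"
  proof
    fix vs assume "vs \<in> ?R"
    then have vs: "length vs = Suc s" and edge: "\<And>j. j < s \<Longrightarrow> (cs ! j, {vs ! j, vs ! Suc j}) \<in> M"
      unfolding rainbow_path_def using len by auto
    have step: "vs ! j \<in> {1..n} \<and> vs ! Suc j \<in> {1..n}" if "j < s" for j
      using snd_rc_board[of "(cs ! j, {vs ! j, vs ! Suc j})" s n] edge[OF that] M by auto
    have "vs ! j \<in> {1..n}" if "j < Suc s" for j
    proof (cases "j < s")
      case False
      then have "j = Suc (s - 1)" using that s3 by simp
      then show ?thesis using step[of "s - 1"] s3 by simp
    qed (use step in blast)
    then have "set vs \<subseteq> {1..n}" using vs by (metis in_set_conv_nth subsetI)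
    then show "vs \<in> {vs. set vs \<subseteq> {1..n} \<and> length vs = Suc s}" using vs by simp
  qed
  then have finR: "finite ?R" by (rule finite_subset) (rule finite_lists_length_eq, simp)
  have "{vs\<in>paths (x, y, cs). edges_of (x, y, cs) vs \<subseteq> M} \<subseteq> ?R"
    unfolding paths_def walks_def edges_of_def path_edges_def rainbow_path_def using len cs(1) by auto
  then have "card {vs\<in>paths (x, y, cs). edges_of (x, y, cs) vs \<subseteq> M} \<le> num_ordered_paths M x y cs"
    unfolding num_ordered_paths_def by (rule card_mono[OF finR])
  moreover have "F0 / 8 \<le> card {vs\<in>paths (x, y, cs). edges_of (x, y, cs) vs \<subseteq> M}"
    using many g unfolding many_paths_def by blast
  moreover have "F0 / 8 = cF / 8 * real n ^ (s - 1) / real b ^ s"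
    unfolding F0_eq cF_def by (simp add: power_divide power_mult_distrib)
  ultimately show ?thesis by linarith
qed

lemma rainbow_connected_if_many_paths:
  assumes "M \<subseteq> rc_board s n" "many_paths M"
  shows "rainbow_connected n M"
  unfolding rainbow_connected_def
proof (intro ballI impI)
  fix x y assume xy: "x \<in> {1..n}" "y \<in> {1..n}" "x \<noteq> y"
  have "0 < cF / 8 * real n ^ (s - 1) / real b ^ s" using cF0 n0 b1 by simp
  also have "\<dots> \<le> real (num_ordered_paths M x y [1..<Suc s])"
    by (rule num_ordered_paths_ge[OF assms xy]) auto
  finally have "0 < num_ordered_paths M x y [1..<Suc s]" by (simp only: of_nat_0_less_iff)
  then have "{vs. rainbow_path M vs [1..<Suc s] \<and> hd vs = x \<and> last vs = y} \<noteq> {}"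
    unfolding num_ordered_paths_def card_gt_0_iff by (rule conjunct1)
  then show "\<exists>vs cs. rainbow_path M vs cs \<and> hd vs = x \<and> last vs = y" by blast
qed

end

section \<open>Choice of the constants\<close>

lemma eventually_large:
  fixes a A c \<delta> :: real
  assumes "\<delta> > 0" "c > 0" "A > 0"
  shows "\<exists>N. \<forall>n\<ge>N. a \<le> real n \<and> A * ln n \<le> c * real n powr \<delta>"
proof -
  define E where "E = A * (2 / \<delta>) / c"
  have E: "E > 0" unfolding E_def using assms by simp
  obtain N :: nat where N: "real N \<ge> max 1 (max a (E powr (2 / \<delta>)))" using real_arch_simple by blast
  have "a \<le> real n \<and> A * ln n \<le> c * real n powr \<delta>" if "n \<ge> N" for n
  proof
    have n: "1 \<le> real n" "a \<le> real n" "E powr (2 / \<delta>) \<le> real n" using N that by linarith+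
    show "a \<le> real n" by (rule n(2))
    \<comment> \<open>Half of the exponent beats the constants, the other half beats the
      logarithm.\<close>
    have "E = (E powr (2 / \<delta>)) powr (\<delta> / 2)" using E assms by (simp add: powr_powr)
    also have "\<dots> \<le> real n powr (\<delta> / 2)" using n assms by (intro powr_mono2) auto
    finally have "A * (2 / \<delta>) \<le> c * real n powr (\<delta> / 2)" unfolding E_def using assms by (simp add: field_simps)
    then have "A * (2 / \<delta>) * real n powr (\<delta> / 2) \<le> c * real n powr (\<delta> / 2) * real n powr (\<delta> / 2)"
      by (intro mult_right_mono) auto
    also have "\<dots> = c * real n powr \<delta>" using n by (simp add: mult.assoc flip: powr_add)
    finally have "A * (real n powr (\<delta> / 2) / (\<delta> / 2)) \<le> c * real n powr \<delta>" by (simp add: algebra_simps)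
    moreover have "A * ln n \<le> A * (real n powr (\<delta> / 2) / (\<delta> / 2))"
      using ln_powr_bound[OF n(1), of "\<delta> / 2"] assms by (intro mult_left_mono) auto
    ultimately show "A * ln n \<le> c * real n powr \<delta>" by linarith
  qed
  then show ?thesis by blast
qed

theorem theorem1p4:
  fixes s :: nat
  assumes "s \<ge> 3"
  shows "\<exists>C \<beta> \<gamma> :: real. C > 0 \<and> \<beta> > 0 \<and> \<gamma> > 0 \<and> (\<exists>N. \<forall>n \<ge> N.
     (\<forall>b::nat. real b \<ge> C * real n powr (1 - 1 / real_of_int \<lceil>real s / 2\<rceil>)
        \<longrightarrow> breaker_wins (rc_board s n) (rc_winning_sets s n) b) \<and>
     (\<forall>b::nat. b \<ge> 1 \<and> real b \<le> \<gamma> * real n powr (1 - 1 / real_of_int \<lceil>real s / 2\<rceil>)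
        \<longrightarrow> maker_wins (rc_board s n) (rc_winning_sets s n) b \<and>
            maker_forces (rc_board s n) b
              (\<lambda>M. rainbow_connected n M \<and>
                 (\<forall>x \<in> {1..n}. \<forall>y \<in> {1..n}. \<forall>cs. x \<noteq> y \<and> distinct cs \<and> set cs = {1..s} \<longrightarrow>
                    real (num_ordered_paths M x y cs) \<ge> \<beta> * real n ^ (s - 1) / real b ^ s))
              True {} {}))"
proof -
  define m where "m = (s + 1) div 2"
  define r where "r = 8 * m"
  define K where "K = walk_const r s + s * 4 ^ s"
  define cF :: real where "cF = 1 / (2 ^ (s - 1) * 3 ^ s)"
  let ?good = "\<lambda>n b M. rainbow_connected n M \<and>
    (\<forall>x \<in> {1..n}. \<forall>y \<in> {1..n}. \<forall>cs. x \<noteq> y \<and> distinct cs \<and> set cs = {1..s} \<longrightarrow>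
      real (num_ordered_paths M x y cs) \<ge> cF / 8 * real n ^ (s - 1) / real b ^ s)"
  define \<gamma> where "\<gamma> = min 1 (cF / (96 * s * 4 ^ s * K\<^sup>2))"
  \<comment> \<open>The sum of all lower bounds on n that do not involve a logarithm:
    \<open>n_init\<close> and \<open>2 * s\<close> for Maker, \<open>20 ^ m\<close> for
    Breaker.\<close>
  define a where "a = card (color_orders s) + card (color_lists s) * (real (r * s) ^ s) ^ r + 2 * s + 20 ^ m"
  have m: "m \<ge> 2" using assms unfolding m_def by simp
  have K: "K \<ge> 1" unfolding K_def using walk_const_ge_1[of r s] by (simp add: add_increasing2)
  have cF: "cF > 0" unfolding cF_def by simp
  have \<gamma>: "0 < \<gamma>" "\<gamma> \<le> 1" unfolding \<gamma>_def using cF K assms by auto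
  have \<gamma>_small: "96 * s * 4 ^ s * K\<^sup>2 * \<gamma> \<le> cF"
  proof -
    have "96 * s * 4 ^ s * K\<^sup>2 * \<gamma> \<le> 96 * s * 4 ^ s * K\<^sup>2 * (cF / (96 * s * 4 ^ s * K\<^sup>2))"
      unfolding \<gamma>_def by (intro mult_left_mono) auto
    also have "\<dots> = cF" using K assms by simp
    finally show ?thesis .
  qed
  obtain N where N: "\<And>n. n \<ge> N \<Longrightarrow> a \<le> real n \<and> 128 * K ^ 3 * ln n \<le> cF * real n powr (1 / (2 * m))"
    using eventually_large[of "1 / (2 * m)" cF "128 * K ^ 3" a] m cF K by auto
  have exponent: "real_of_int \<lceil>real s / 2\<rceil> = real m" unfolding ceiling_half m_def by simp
  have a_parts: "0 \<le> card (color_lists s) * (real (r * s) ^ s) ^ r" "(20::real) ^ m \<ge> 0" by simp_all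
  have breaker: "breaker_wins (rc_board s n) (rc_winning_sets s n) b"
    if "n \<ge> N" "40 * real s * real n powr (1 - 1 / m) \<le> real b" for n b
  proof (rule breaker_wins_above_threshold[OF assms m_def _ that(2)])
    show "20 ^ m \<le> real n" using N[OF that(1)] a_parts unfolding a_def by linarith
  qed
  have maker: "maker_wins (rc_board s n) (rc_winning_sets s n) b \<and>
      maker_forces (rc_board s n) b (?good n b) True {} {}"
    if n: "n \<ge> N" and b: "b \<ge> 1" "real b \<le> \<gamma> * real n powr (1 - 1 / m)" for n b
  proof -
    \<comment> \<open>With this \<nu>, \<open>\<nu>\<^sup>2 = n powr (1 / m)\<close>, so the
      assumption on b reads \<open>\<nu>\<^sup>2 * b \<le> \<gamma> * n\<close>.\<close>
    define \<nu> where "\<nu> = real n powr (1 / (2 * m))"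
    have an: "a \<le> real n" and large: "128 * K ^ 3 * ln n \<le> cF * \<nu>" using N[OF n] unfolding \<nu>_def by simp_all
    have n2s: "2 * real s \<le> n" using an a_parts unfolding a_def by linarith
    then have n1: "real n \<ge> 1" using assms by simp
    interpret R: rainbow_maker s n b m r \<gamma> \<nu>
    proof
      show "3 \<le> s" "m = (s + 1) div 2" "r = 8 * m" "1 \<le> b" "0 < \<gamma>" "\<gamma> \<le> 1"
        using assms m_def r_def b \<gamma> by simp_all
      show "1 \<le> \<nu>" unfolding \<nu>_def using n1 by (intro ge_one_powr_ge_zero) auto
      show "\<nu> ^ (2 * m) = real n" unfolding \<nu>_def using n1 m by (subst powr_power) simp_all
      have "\<nu>\<^sup>2 = real n powr (1 / m)" unfolding \<nu>_def using n1 by (subst powr_power) simp_all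
      then have "\<nu>\<^sup>2 * b \<le> real n powr (1 / m) * (\<gamma> * real n powr (1 - 1 / m))"
        using b(2) by (simp only: mult_left_mono powr_ge_zero)
      also have "\<dots> = \<gamma> * (real n powr (1 / m) * real n powr (1 - 1 / m))" by (simp only: ac_simps)
      also have "\<dots> = \<gamma> * n" using n1 by (simp flip: powr_add)
      finally show "\<nu>\<^sup>2 * b \<le> \<gamma> * n" .
      show "96 * s * 4 ^ s * (walk_const r s + s * 4 ^ s)\<^sup>2 * \<gamma> \<le> 1 / (2 ^ (s - 1) * 3 ^ s)"
        using \<gamma>_small unfolding K_def cF_def .
      show "2 * s \<le> n" using n2s by simp
      show "128 * (walk_const r s + s * 4 ^ s) ^ 3 * ln n \<le> \<nu> / (2 ^ (s - 1) * 3 ^ s)"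
        using large unfolding K_def cF_def by simp
      show "card (color_orders s) + card (color_lists s) * (real (r * s) ^ s) ^ r + s \<le> n"
        using an a_parts unfolding a_def by linarith
    qed
    have cF_eq: "R.cF = cF" unfolding R.cF_def cF_def ..
    let ?Q = "\<lambda>M. M \<subseteq> rc_board s n \<and> R.many_paths M"
    have conn: "rainbow_connected n M" if "?Q M" for M
      using that by (intro R.rainbow_connected_if_many_paths) simp_all
    have win: "\<exists>A\<in>rc_winning_sets s n. A \<subseteq> M" if "?Q M" for M
      using that conn[OF that] unfolding rc_winning_sets_def by blast
    have count: "cF / 8 * real n ^ (s - 1) / real b ^ s \<le> real (num_ordered_paths M x y cs)"
      if "?Q M" "x \<in> {1..n}" "y \<in> {1..n}" "x \<noteq> y \<and> distinct cs \<and> set cs = {1..s}" for M x y cs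
      unfolding cF_eq[symmetric] using that by (intro R.num_ordered_paths_ge) simp_all
    show ?thesis
      unfolding maker_wins_def
    proof (rule conjI)
      show "maker_forces (rc_board s n) b (\<lambda>M. \<exists>A\<in>rc_winning_sets s n. A \<subseteq> M) True {} {}"
        by (rule maker_forces_mono[OF R.maker_forces_many_paths win])
      show "maker_forces (rc_board s n) b (?good n b) True {} {}"
        by (rule maker_forces_mono[OF R.maker_forces_many_paths])
          (rule conjI, erule conn, intro ballI allI impI, rule count; assumption)
    qed
  qed
  show ?thesis
    unfolding exponent
  proof (rule exI[of _ "40 * real s"], rule exI[of _ "cF / 8"], rule exI[of _ \<gamma>], intro conjI exI[of _ N] allI impI)
    show "0 < 40 * real s" "0 < cF / 8" "0 < \<gamma>" using assms cF \<gamma> by simp_all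
  next
    fix n b :: nat
    assume "N \<le> n" "40 * real s * real n powr (1 - 1 / real m) \<le> real b"
    then show "breaker_wins (rc_board s n) (rc_winning_sets s n) b" by (rule breaker)
  next
    fix n b :: nat
    assume "N \<le> n" "1 \<le> b \<and> real b \<le> \<gamma> * real n powr (1 - 1 / real m)"
    then show "maker_wins (rc_board s n) (rc_winning_sets s n) b"
      by (elim conjE) (rule maker[THEN conjunct1])
  next
    fix n b :: nat
    assume "N \<le> n" "1 \<le> b \<and> real b \<le> \<gamma> * real n powr (1 - 1 / real m)"
    then show "maker_forces (rc_board s n) b (?good n b) True {} {}"
      by (elim conjE) (rule maker[THEN conjunct2])
  qed
qed

end
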